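(* Consider the store-and-forward packet routing problem on the uni-directional line with $n$ nodes, uniform link capacity $c$ and uniform buffer size $B$, where $B,c\in[1,\log_2 n]$ are integers, and packet requests have no deadlines. There exists an online randomized centralized nonpreemptive packet-routing algorithm whose competitive ratio (against an oblivious adversary) is $O(\log n)$.
   Context: Store-and-forward packet routing model on the uni-directional line $v_1\to\cdots\to v_n$: each edge can carry at most $c$ packets per time step (traversal takes one time step); each node can store at most $B$ packets; time is discrete and synchronous. Each request is $r_i=(a_i,b_i,t_i)$: the packet is input at source $a_i$ at time $t_i$ via a local input (any number per node per step) and must be delivered to destination $b_i$, which is $a_i$ or a later node on the path (no deadline). In each time step, each node delivers packets destined to it, forwards at most $c$ of the other present packets (locally input, arriving, or buffered) along its outgoing edge, stores at most $B$, and deletes the rest. Deleting a locally input packet is rejection; an algorithm is nonpreemptive if it never deletes a packet it has injected before the packet reaches its destination. Throughput = number of delivered packets. An online algorithm learns nothing about $r_i$ before $t_i$. A randomized online algorithm ALG is $\rho$-competitive against an oblivious adversary if for every input sequence $\sigma$ (fixed in advance), $\mathbb{E}[|\mathrm{ALG}(\sigma)|]\ge\frac1\rho|\mathrm{OPT}(\sigma)|$, where $|\mathrm{OPT}(\sigma)|$ is the maximum achievable throughput and the expectation is over the algorithm's random choices. *)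

theory Defs
  imports "HOL-Probability.Probability"
begin

text \<open>Nodes of the line v_1 .. v_n are numbered 0 .. n-1; the only edges are v -> v+1.
  A request is a triple (a, b, t): source a, destination b (a \<le> b), release time t.
  An input sequence is a list of requests ordered by release time; request i is
  the i-th element of the list.\<close>

type_synonym request = "nat \<times> nat \<times> nat"

definition src :: "request \<Rightarrow> nat" where "src r = fst r"
definition dst :: "request \<Rightarrow> nat" where "dst r = fst (snd r)"
definition rtime :: "request \<Rightarrow> nat" where "rtime r = snd (snd r)"

definition valid_input :: "nat \<Rightarrow> request list \<Rightarrow> bool" where
  "valid_input n \<sigma> \<longleftrightarrow>
     (\<forall>r \<in> set \<sigma>. src r \<le> dst r \<and> dst r < n) \<and> sorted (map rtime \<sigma>)"

text \<open>A run (schedule): run i t = Some v iff packet i is present at node v during time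
  step t (locally input, arriving, or buffered there); None otherwise (not yet input,
  delivered, or deleted).\<close>

type_synonym run = "nat \<Rightarrow> nat \<Rightarrow> nat option"

definition forwarded :: "request list \<Rightarrow> run \<Rightarrow> nat \<Rightarrow> nat \<Rightarrow> nat set" where
  "forwarded \<sigma> \<rho> v t = {i. i < length \<sigma> \<and> \<rho> i t = Some v \<and> v \<noteq> dst (\<sigma> ! i)
                               \<and> \<rho> i (Suc t) = Some (Suc v)}"

definition stored :: "request list \<Rightarrow> run \<Rightarrow> nat \<Rightarrow> nat \<Rightarrow> nat set" where
  "stored \<sigma> \<rho> v t = {i. i < length \<sigma> \<and> \<rho> i t = Some v \<and> v \<noteq> dst (\<sigma> ! i)
                               \<and> \<rho> i (Suc t) = Some v}"

definition feasible :: "nat \<Rightarrow> nat \<Rightarrow> request list \<Rightarrow> run \<Rightarrow> bool" where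
  "feasible B c \<sigma> \<rho> \<longleftrightarrow>
     (\<forall>i < length \<sigma>.
        (\<forall>t < rtime (\<sigma> ! i). \<rho> i t = None) \<and>
        \<rho> i (rtime (\<sigma> ! i)) = Some (src (\<sigma> ! i)) \<and>
        (\<forall>t \<ge> rtime (\<sigma> ! i). \<forall>v. \<rho> i t = Some v \<longrightarrow>
            (if v = dst (\<sigma> ! i) then \<rho> i (Suc t) = None
             else \<rho> i (Suc t) \<in> {None, Some v, Some (Suc v)})) \<and>
        (\<forall>t \<ge> rtime (\<sigma> ! i). \<rho> i t = None \<longrightarrow> \<rho> i (Suc t) = None)) \<and>
     (\<forall>v t. card (forwarded \<sigma> \<rho> v t) \<le> c) \<and>
     (\<forall>v t. card (stored \<sigma> \<rho> v t) \<le> B)"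

definition delivered :: "request list \<Rightarrow> run \<Rightarrow> nat \<Rightarrow> bool" where
  "delivered \<sigma> \<rho> i \<longleftrightarrow> (\<exists>t. \<rho> i t = Some (dst (\<sigma> ! i)))"

definition throughput :: "request list \<Rightarrow> run \<Rightarrow> nat" where
  "throughput \<sigma> \<rho> = card {i. i < length \<sigma> \<and> delivered \<sigma> \<rho> i}"

definition OPT :: "nat \<Rightarrow> nat \<Rightarrow> request list \<Rightarrow> nat" where
  "OPT B c \<sigma> = Max {throughput \<sigma> \<rho> | \<rho>. feasible B c \<sigma> \<rho>}"

text \<open>Nonpreemptive: a packet that is injected (still present after its input step)
  is eventually delivered.\<close>
definition nonpreemptive :: "request list \<Rightarrow> run \<Rightarrow> bool" where
  "nonpreemptive \<sigma> \<rho> \<longleftrightarrow>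
     (\<forall>i < length \<sigma>. (\<exists>t > rtime (\<sigma> ! i). \<rho> i t \<noteq> None) \<longrightarrow> delivered \<sigma> \<rho> i)"

text \<open>A deterministic algorithm maps an input sequence to a run. It is online if its
  behaviour up to (and including) the decisions of step T depends only on the requests
  released at times \<le> T (which, inputs being time-sorted, form a common prefix).\<close>
definition online :: "nat \<Rightarrow> (request list \<Rightarrow> run) \<Rightarrow> bool" where
  "online n alg \<longleftrightarrow>
     (\<forall>\<sigma> \<sigma>' T. valid_input n \<sigma> \<longrightarrow> valid_input n \<sigma>' \<longrightarrow>
        filter (\<lambda>r. rtime r \<le> T) \<sigma> = filter (\<lambda>r. rtime r \<le> T) \<sigma>' \<longrightarrow>
        (\<forall>i < length (filter (\<lambda>r. rtime r \<le> T) \<sigma>). \<forall>t \<le> Suc T.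
            alg \<sigma> i t = alg \<sigma>' i t))"

text \<open>A randomized online nonpreemptive algorithm: a probability distribution over
  deterministic online nonpreemptive algorithms producing feasible runs (the random
  choice is made independently of the input: oblivious adversary).\<close>
definition rand_online_nonpreemptive ::
  "nat \<Rightarrow> nat \<Rightarrow> nat \<Rightarrow> (request list \<Rightarrow> run) pmf \<Rightarrow> bool" where
  "rand_online_nonpreemptive n B c A \<longleftrightarrow>
     (\<forall>alg \<in> set_pmf A. online n alg \<and>
        (\<forall>\<sigma>. valid_input n \<sigma> \<longrightarrow> feasible B c \<sigma> (alg \<sigma>) \<and> nonpreemptive \<sigma> (alg \<sigma>)))"

definition exp_throughput :: "(request list \<Rightarrow> run) pmf \<Rightarrow> request list \<Rightarrow> real" where
  "exp_throughput A \<sigma> = measure_pmf.expectation A (\<lambda>alg. real (throughput \<sigma> (alg \<sigma>)))"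

end

theory Submission
  imports Defs
begin

text \<open>
  In the coordinates (node, time + n - node) a schedule is a family of monotone grid paths:
  forwarding is a horizontal step (capacity c), storing a vertical one (capacity B).
  The algorithm draws one of five classes of requests uniformly and serves only that class, so it
  suffices to be O(log n)-competitive on every class.

  Near requests (distance O(log n)) wait at the source for less than B/c + 1 steps and then ride
  without stopping. A rejected request sees max(B, c) accepted requests in a window of width
  O(log n), while an optimal schedule gets at most B + c + max(B, c) requests out of one node in
  about B/c rows.

  For far requests the grid is cut into cells of O(log n) x O(log n) points such that
  every side of a cell has the same capacity, which is at least proportional to log n, and four
  cells form a tile. The four far classes are the four positions of the source cell in its tile. A request is accepted
  if it finds a tile path whose total exponential edge price is below 1, and if its row or its
  column inside the source cell is free. Prices keep the tile edge loads below a
  constant fraction of the capacity, so every packet that has to turn finds room to do so within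
  one cell, by a local rule that gives way to packets going straight. Rejections for a high price
  are paid by the primal-dual argument. Rejections at the source cell are charged to
  accepted packets, each of which blocks only O(log n) points.
\<close>

section \<open>Sequential decisions and monotone paths\<close>

text \<open>Exponential pricing may load an edge up to \<open>m * k\<close> before its price reaches
  1, where \<open>2 ^ k\<close> exceeds the bound \<open>P\<close> on the number of edges of a path.
  So it needs capacities of order \<open>log n\<close>, whereas \<open>B\<close> and
  \<open>c\<close> may be 1. Bundling the parallel edges on a tile side supplies this capacity, but
  a tile path says nothing about single edges: the detailed routing has to be settled later, online
  and without deletions. The source cell is treated separately because a request may start next to a
  cell side, where too little of the cell is left for a turn; if it goes straight until the cell
  ends, its row or column is the only resource. Keeping through traffic out of source cells is what
  forces the parity classes. Serving one random class costs a constant factor in expectation,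
  whereas a fixed class could be starved by an input from another one. The cell shape
  \<open>c * q\<close> by \<open>B * q\<close> is the one in which both sides have capacity
  \<open>c * q * B\<close>, and \<open>B\<close>, \<open>c\<close> of at most \<open>log n\<close>
  keep both lengths in \<open>O(log n)\<close> even for the least \<open>q\<close>.\<close>

primrec build :: "((nat \<Rightarrow> 'j option) \<Rightarrow> request \<Rightarrow> 'j option) \<Rightarrow> request list \<Rightarrow> nat \<Rightarrow> nat \<Rightarrow> 'j option" where
  "build D \<sigma> 0 = (\<lambda>_. None)"
| "build D \<sigma> (Suc i) = (build D \<sigma> i)(i := D (build D \<sigma> i) (\<sigma> ! i))"

definition plan :: "((nat \<Rightarrow> 'j option) \<Rightarrow> request \<Rightarrow> 'j option) \<Rightarrow> request list \<Rightarrow> nat \<Rightarrow> 'j option" where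
  "plan D \<sigma> = build D \<sigma> (length \<sigma>)"

lemma build_ge: "i \<le> j \<Longrightarrow> build D \<sigma> i j = None"
  by (induction i) auto

lemma build_lt: "j < i \<Longrightarrow> build D \<sigma> i j = D (build D \<sigma> j) (\<sigma> ! j)"
  by (induction i) (auto simp: less_Suc_eq)

lemma build_cong: "(\<And>j. j < i \<Longrightarrow> \<sigma> ! j = \<sigma>' ! j) \<Longrightarrow> build D \<sigma> i = build D \<sigma>' i"
  by (induction i) auto

lemma plan_nth: "i < length \<sigma> \<Longrightarrow> plan D \<sigma> i = D (build D \<sigma> i) (\<sigma> ! i)"
  by (simp add: plan_def build_lt)

lemma plan_ge: "length \<sigma> \<le> i \<Longrightarrow> plan D \<sigma> i = None"
  by (simp add: plan_def build_ge)

lemma build_eq_plan: "i \<le> length \<sigma> \<Longrightarrow> build D \<sigma> i j = (if j < i then plan D \<sigma> j else None)"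
  by (auto simp: build_ge build_lt plan_def)

lemma plan_Some_less: "plan D \<sigma> i = Some v \<Longrightarrow> i < length \<sigma>"
  by (metis not_le option.distinct(1) plan_ge)

text \<open>Decision \<open>i\<close> reads only the requests up to \<open>i\<close>, so acceptances
  made through a decision function are online by construction.\<close>

lemma plan_cong:
  assumes "i < length \<sigma>" "i < length \<sigma>'" "\<And>j. j \<le> i \<Longrightarrow> \<sigma> ! j = \<sigma>' ! j"
  shows "plan D \<sigma> i = plan D \<sigma>' i"
  using assms build_cong[of i \<sigma> \<sigma>' D] by (simp add: plan_nth)

lemma finite_plan: "finite {j. \<exists>v. plan D \<sigma> j = Some v \<and> Q j v}"
  by (rule finite_subset[of _ "{..<length \<sigma>}"]) (auto dest: plan_Some_less)

lemma finite_build: "i \<le> length \<sigma> \<Longrightarrow> finite {j. \<exists>v. build D \<sigma> i j = Some v \<and> Q j v}"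
  by (rule finite_subset[of _ "{..<i}"]) (auto simp: build_eq_plan split: if_splits)

text \<open>The latest element has all others before it, so a test made only when an element joins
  bounds the final size.\<close>

lemma card_le_by_Max:
  fixes S :: "nat set"
  assumes "finite S" "\<And>i. i \<in> S \<Longrightarrow> card {j \<in> S. j < i} < c"
  shows "card S \<le> c"
proof (cases "S = {}")
  case False
  define i where "i = Max S"
  have i: "i \<in> S" "\<And>j. j \<in> S \<Longrightarrow> j \<le> i" using False assms(1) by (auto simp: i_def)
  have "S = insert i {j \<in> S. j < i}" using i by fastforce
  then have "card S = Suc (card {j \<in> S. j < i})"
    using assms(1) by (metis (no_types, lifting) card_insert_disjoint finite_Collect_conjI
        finite_subset less_irrefl mem_Collect_eq subset_insertI)
  then show ?thesis using assms(2)[OF i(1)] by simp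
qed simp

section \<open>The online condition on time-sorted inputs\<close>

lemma sorted_filter_prefix:
  assumes "sorted (map rtime \<sigma>)" "i < length \<sigma>"
  shows "i < length (filter (\<lambda>r. rtime r \<le> T) \<sigma>) \<longleftrightarrow> rtime (\<sigma> ! i) \<le> T"
    and "i < length (filter (\<lambda>r. rtime r \<le> T) \<sigma>) \<Longrightarrow> filter (\<lambda>r. rtime r \<le> T) \<sigma> ! i = \<sigma> ! i"
proof -
  have "filter (\<lambda>r. rtime r \<le> T) \<sigma> = takeWhile (\<lambda>r. rtime r \<le> T) \<sigma>"
    using assms(1)
  proof (induction \<sigma>)
    case (Cons r \<sigma>)
    have "filter (\<lambda>r. rtime r \<le> T) \<sigma> = []" if "\<not> rtime r \<le> T"
      using that Cons.prems by (intro filter_False) auto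
    then show ?case using Cons by auto
  qed simp
  moreover have "i < length (takeWhile (\<lambda>r. rtime r \<le> T) \<sigma>) \<longleftrightarrow> rtime (\<sigma> ! i) \<le> T"
  proof
    assume "i < length (takeWhile (\<lambda>r. rtime r \<le> T) \<sigma>)"
    then show "rtime (\<sigma> ! i) \<le> T" by (metis nth_mem set_takeWhileD takeWhile_nth)
  next
    assume a: "rtime (\<sigma> ! i) \<le> T"
    show "i < length (takeWhile (\<lambda>r. rtime r \<le> T) \<sigma>)"
    proof (rule ccontr)
      assume n: "\<not> i < length (takeWhile (\<lambda>r. rtime r \<le> T) \<sigma>)"
      define l where "l = length (takeWhile (\<lambda>r. rtime r \<le> T) \<sigma>)"
      have "l \<le> i" using n by (simp add: l_def)
      then have "map rtime \<sigma> ! l \<le> map rtime \<sigma> ! i"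
        using assms by (intro sorted_nth_mono) auto
      moreover have "\<not> rtime (\<sigma> ! l) \<le> T"
        unfolding l_def using \<open>l \<le> i\<close> assms(2) by (intro nth_length_takeWhile) (auto simp: l_def)
      ultimately show False using a \<open>l \<le> i\<close> assms(2) by simp
    qed
  qed
  ultimately show "i < length (filter (\<lambda>r. rtime r \<le> T) \<sigma>) \<longleftrightarrow> rtime (\<sigma> ! i) \<le> T"
    and "i < length (filter (\<lambda>r. rtime r \<le> T) \<sigma>) \<Longrightarrow> filter (\<lambda>r. rtime r \<le> T) \<sigma> ! i = \<sigma> ! i"
    by (auto simp: takeWhile_nth)
qed

lemma onlineI:
  assumes "\<And>\<sigma> \<sigma>' T p i t. \<lbrakk>valid_input n \<sigma>; valid_input n \<sigma>'; p \<le> length \<sigma>; p \<le> length \<sigma>';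
      \<And>j. j < p \<Longrightarrow> \<sigma> ! j = \<sigma>' ! j;
      \<And>j. p \<le> j \<Longrightarrow> j < length \<sigma> \<Longrightarrow> T < rtime (\<sigma> ! j);
      \<And>j. p \<le> j \<Longrightarrow> j < length \<sigma>' \<Longrightarrow> T < rtime (\<sigma>' ! j); i < p; t \<le> Suc T\<rbrakk>
      \<Longrightarrow> alg \<sigma> i t = alg \<sigma>' i t"
  shows "online n alg"
  unfolding online_def
proof (intro allI impI)
  fix \<sigma> \<sigma>' T i t
  assume v: "valid_input n \<sigma>" "valid_input n \<sigma>'"
    and eq: "filter (\<lambda>r. rtime r \<le> T) \<sigma> = filter (\<lambda>r. rtime r \<le> T) \<sigma>'"
    and i: "i < length (filter (\<lambda>r. rtime r \<le> T) \<sigma>)" and t: "t \<le> Suc T"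
  have s: "sorted (map rtime \<sigma>)" "sorted (map rtime \<sigma>')" using v by (auto simp: valid_input_def)
  define p where "p = length (filter (\<lambda>r. rtime r \<le> T) \<sigma>)"
  have p: "p \<le> length \<sigma>" "p \<le> length \<sigma>'" by (simp_all add: p_def) (simp add: eq)
  show "alg \<sigma> i t = alg \<sigma>' i t"
  proof (rule assms[OF v p _ _ _ _ t])
    show "\<sigma> ! j = \<sigma>' ! j" if "j < p" for j
      using that p sorted_filter_prefix(2)[OF s(1), of j T] sorted_filter_prefix(2)[OF s(2), of j T] eq
      by (metis less_le_trans p p_def)
    show "T < rtime (\<sigma> ! j)" if "p \<le> j" "j < length \<sigma>" for j
      using that sorted_filter_prefix(1)[OF s(1), of j T] by (simp add: p_def)
    show "T < rtime (\<sigma>' ! j)" if "p \<le> j" "j < length \<sigma>'" for j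
      using that sorted_filter_prefix(1)[OF s(2), of j T] eq by (simp add: p_def)
    show "i < p" using i by (simp add: p_def)
  qed
qed

text \<open>Forwarding a packet keeps its row, storing it increases its row by one. The summand n
  avoids truncated subtraction.\<close>

definition row_of :: "nat \<Rightarrow> request \<Rightarrow> nat" where "row_of n r = rtime r + n - src r"

text \<open>A monotone path from (a, d) is encoded by the row e x in which it leaves column x; it then
  enters column x in row enter a d e x.\<close>

definition enter :: "nat \<Rightarrow> nat \<Rightarrow> (nat \<Rightarrow> nat) \<Rightarrow> nat \<Rightarrow> nat" where
  "enter a d e x = (if x = a then d else e (x - 1))"

section \<open>Delivered packets as monotone paths\<close>

lemma finite_forwarded [simp]: "finite (forwarded \<sigma> \<rho> v t)"
  by (simp add: forwarded_def)

lemma finite_stored [simp]: "finite (stored \<sigma> \<rho> v t)"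
  by (simp add: stored_def)

text \<open>A packet found at its destination was never absent since its release, and its node
  number grows by at most one per step. So it leaves every column exactly once, and the leaving
  times, turned into rows, describe its path completely.\<close>

lemma delivered_path:
  assumes v: "valid_input n \<sigma>" and f: "feasible B c \<sigma> \<rho>" and i: "i < length \<sigma>" and d: "delivered \<sigma> \<rho> i"
  shows "\<exists>e. \<forall>x. src (\<sigma> ! i) \<le> x \<and> x < dst (\<sigma> ! i) \<longrightarrow>
     enter (src (\<sigma> ! i)) (row_of n (\<sigma> ! i)) e x \<le> e x \<and>
     i \<in> forwarded \<sigma> \<rho> x (e x + x - n) \<and>
     (\<forall>y. enter (src (\<sigma> ! i)) (row_of n (\<sigma> ! i)) e x \<le> y \<and> y < e x \<longrightarrow> i \<in> stored \<sigma> \<rho> x (y + x - n))"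
proof -
  define a b t0 where "a = src (\<sigma> ! i)" and "b = dst (\<sigma> ! i)" and "t0 = rtime (\<sigma> ! i)"
  have ab: "a \<le> b" "b < n" using v i by (auto simp: valid_input_def a_def b_def)
  obtain tf where tf: "\<rho> i tf = Some b" using d by (auto simp: delivered_def b_def)
  have f1: "\<And>t. t < t0 \<Longrightarrow> \<rho> i t = None" "\<rho> i t0 = Some a"
    "\<And>t v. t \<ge> t0 \<Longrightarrow> \<rho> i t = Some v \<Longrightarrow>
            (if v = b then \<rho> i (Suc t) = None else \<rho> i (Suc t) \<in> {None, Some v, Some (Suc v)})"
    "\<And>t. t \<ge> t0 \<Longrightarrow> \<rho> i t = None \<Longrightarrow> \<rho> i (Suc t) = None"
    using f i unfolding feasible_def a_def b_def t0_def by blast+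
  have t0f: "t0 \<le> tf" using f1(1) tf by (metis not_le option.distinct(1))
  have none: "\<rho> i u = None" if "\<rho> i t = None" "t0 \<le> t" "t \<le> u" for t u
    using that(3) by (induction u rule: dec_induct) (use that f1(4) in auto)
  define p where "p t = the (\<rho> i t)" for t
  have p: "\<rho> i t = Some (p t)" if "t0 \<le> t" "t \<le> tf" for t
    using none[of t tf] that tf by (cases "\<rho> i t") (auto simp: p_def)
  have st: "p t \<noteq> b \<and> (p (Suc t) = p t \<or> p (Suc t) = Suc (p t))" if "t0 \<le> t" "t < tf" for t
    using f1(3)[of t "p t"] p[of t] p[of "Suc t"] that by (auto split: if_splits)
  have mono: "p t \<le> p u" if "t0 \<le> t" "t \<le> u" "u \<le> tf" for t u
    using that(2,3)
  proof (induction u rule: dec_induct)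
    case (step u)
    then show ?case using st[of u] that(1) by (auto simp: le_Suc_eq)
  qed simp
  have pe: "p t0 = a" "p tf = b" using f1(2) tf by (auto simp: p_def)
  \<comment> \<open>By monotonicity the last moment at a node up to \<open>x\<close> is the moment
    just before the hop from \<open>x\<close> to \<open>Suc x\<close>.\<close>
  define \<tau> where "\<tau> x = Max {t. t0 \<le> t \<and> t \<le> tf \<and> p t \<le> x}" for x
  have \<tau>: "t0 \<le> \<tau> x \<and> \<tau> x < tf \<and> p (\<tau> x) = x \<and> p (Suc (\<tau> x)) = Suc x \<and>
       (\<forall>t. t0 \<le> t \<and> t \<le> \<tau> x \<longrightarrow> p t \<le> x) \<and> (\<forall>t. \<tau> x < t \<and> t \<le> tf \<longrightarrow> x < p t)"
    if x: "a \<le> x" "x < b" for x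
  proof -
    let ?S = "{t. t0 \<le> t \<and> t \<le> tf \<and> p t \<le> x}"
    have fin: "finite ?S" by (rule finite_subset[of _ "{..tf}"]) auto
    moreover have "t0 \<in> ?S" using x pe t0f by auto
    ultimately have m: "\<tau> x \<in> ?S" unfolding \<tau>_def using Max_in by blast
    have g: "t \<le> \<tau> x" if "t \<in> ?S" for t using fin that by (simp add: \<tau>_def)
    have "\<tau> x \<noteq> tf" using m pe x by auto
    then have l: "\<tau> x < tf" using m by auto
    have gt: "x < p t" if "\<tau> x < t" "t \<le> tf" for t
    proof (rule ccontr)
      assume "\<not> x < p t"
      then have "t \<in> ?S" using that m by auto
      then show False using g[of t] that by simp
    qed
    have "x < p (Suc (\<tau> x))" using gt[of "Suc (\<tau> x)"] l by simp
    then have "p (\<tau> x) = x \<and> p (Suc (\<tau> x)) = Suc x" using st[of "\<tau> x"] m l by auto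
    moreover have "p t \<le> x" if "t0 \<le> t" "t \<le> \<tau> x" for t
      using mono[of t "\<tau> x"] m that by auto
    ultimately show ?thesis using m l gt by auto
  qed
  define e where "e x = \<tau> x + n - x" for x
  show ?thesis
  proof (intro exI[of _ e] allI impI)
    fix x assume "src (\<sigma> ! i) \<le> x \<and> x < dst (\<sigma> ! i)"
    then have x: "a \<le> x" "x < b" by (auto simp: a_def b_def)
    have ex: "e x + x - n = \<tau> x" using x ab by (simp add: e_def)
    \<comment> \<open>Arrival time in column \<open>x\<close>. A hop raises time and node by one
      each, so the arrival row is the row \<open>e (x - 1)\<close> of the departure.\<close>
    define t1 where "t1 = (if x = a then t0 else Suc (\<tau> (x - 1)))"
    have ent: "enter (src (\<sigma> ! i)) (row_of n (\<sigma> ! i)) e x = t1 + n - x"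
      using x ab by (auto simp: enter_def t1_def e_def row_of_def a_def t0_def)
    have t1: "t0 \<le> t1 \<and> (\<forall>t. t1 \<le> t \<and> t \<le> \<tau> x \<longrightarrow> p t = x) \<and> t1 \<le> \<tau> x"
    proof (cases "x = a")
      case True
      then show ?thesis using \<tau>[OF x] mono[of t0] pe x by (force simp: t1_def)
    next
      case False
      then have x1: "a \<le> x - 1" "x - 1 < b" using x by auto
      have "p t = x" if "Suc (\<tau> (x-1)) \<le> t" "t \<le> \<tau> x" for t
      proof -
        have "x - 1 < p t" using \<tau>[OF x1] that \<tau>[OF x] by auto
        moreover have "p t \<le> x" using \<tau>[OF x] that \<tau>[OF x1] by auto
        ultimately show ?thesis by simp
      qed
      moreover have "Suc (\<tau> (x-1)) \<le> \<tau> x"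
      proof (rule ccontr)
        assume "\<not> Suc (\<tau> (x-1)) \<le> \<tau> x"
        then have "p (\<tau> x) \<le> x - 1" using \<tau>[OF x1] \<tau>[OF x] by auto
        then show False using \<tau>[OF x] x1 x False by auto
      qed
      ultimately show ?thesis using False \<tau>[OF x1] by (auto simp: t1_def)
    qed
    have fw: "i \<in> forwarded \<sigma> \<rho> x (\<tau> x)"
      using \<tau>[OF x] p[of "\<tau> x"] p[of "Suc (\<tau> x)"] i x by (auto simp: forwarded_def b_def)
    moreover have "i \<in> stored \<sigma> \<rho> x (y + x - n)" if "t1 + n - x \<le> y" "y < e x" for y
    proof -
      define t where "t = y + x - n"
      have t: "t1 \<le> t" "t < \<tau> x" using that x ab by (auto simp: t_def e_def)
      have "p t = x" "p (Suc t) = x" using t1 t by auto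
      then show ?thesis using p[of t] p[of "Suc t"] t t1 \<tau>[OF x] i x by (auto simp: stored_def b_def t_def[symmetric])
    qed
    moreover have "t1 + n - x \<le> e x" using t1 by (simp add: e_def diff_le_mono)
    ultimately show "enter (src (\<sigma> ! i)) (row_of n (\<sigma> ! i)) e x \<le> e x \<and>
     i \<in> forwarded \<sigma> \<rho> x (e x + x - n) \<and>
     (\<forall>y. enter (src (\<sigma> ! i)) (row_of n (\<sigma> ! i)) e x \<le> y \<and> y < e x \<longrightarrow> i \<in> stored \<sigma> \<rho> x (y + x - n))"
      unfolding ent ex by blast
  qed
qed

text \<open>Within a block of \<open>g\<close> rows a packet either leaves its source on one of
  \<open>g\<close> horizontal edges of capacity \<open>c\<close>, or is stored there across the last
  row of the block, which at most \<open>B\<close> packets are.\<close>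

lemma card_sources_le:
  assumes v: "valid_input n \<sigma>" and f: "feasible B c \<sigma> \<rho>" and g: "0 < g"
  shows "card {i. i < length \<sigma> \<and> delivered \<sigma> \<rho> i \<and> src (\<sigma> ! i) = a \<and> a < dst (\<sigma> ! i) \<and>
            row_of n (\<sigma> ! i) div g = l} \<le> g * c + B" (is "card ?S \<le> _")
proof -
  have "?S \<subseteq> (\<Union>d\<in>{l*g..<l*g+g}. forwarded \<sigma> \<rho> a (d + a - n)) \<union> stored \<sigma> \<rho> a (l*g+g-1 + a - n)"
  proof
    fix i assume i: "i \<in> ?S"
    obtain e where e: "\<And>x. src (\<sigma> ! i) \<le> x \<and> x < dst (\<sigma> ! i) \<Longrightarrow>
     enter (src (\<sigma> ! i)) (row_of n (\<sigma> ! i)) e x \<le> e x \<and>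
     i \<in> forwarded \<sigma> \<rho> x (e x + x - n) \<and>
     (\<forall>y. enter (src (\<sigma> ! i)) (row_of n (\<sigma> ! i)) e x \<le> y \<and> y < e x \<longrightarrow> i \<in> stored \<sigma> \<rho> x (y + x - n))"
      using delivered_path[OF v f] i by blast
    have r: "l*g \<le> row_of n (\<sigma> ! i)" "row_of n (\<sigma> ! i) < l*g+g"
      using i g div_mult_mod_eq[of "row_of n (\<sigma> ! i)" g] mod_less_divisor[OF g, of "row_of n (\<sigma> ! i)"] by auto
    have ea: "row_of n (\<sigma> ! i) \<le> e a" "i \<in> forwarded \<sigma> \<rho> a (e a + a - n)"
      "\<And>y. row_of n (\<sigma> ! i) \<le> y \<Longrightarrow> y < e a \<Longrightarrow> i \<in> stored \<sigma> \<rho> a (y + a - n)"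
      using e[of a] i by (auto simp: enter_def)
    show "i \<in> (\<Union>d\<in>{l*g..<l*g+g}. forwarded \<sigma> \<rho> a (d + a - n)) \<union> stored \<sigma> \<rho> a (l*g+g-1 + a - n)"
    proof (cases "e a < l*g+g")
      case True
      then show ?thesis using ea r by (intro UnI1 UN_I[of "e a"]) auto
    next
      case False
      then show ?thesis using ea(3)[of "l*g+g-1"] r by auto
    qed
  qed
  then have "card ?S \<le> card ((\<Union>d\<in>{l*g..<l*g+g}. forwarded \<sigma> \<rho> a (d + a - n)) \<union> stored \<sigma> \<rho> a (l*g+g-1 + a - n))"
    by (intro card_mono) auto
  also have "\<dots> \<le> card (\<Union>d\<in>{l*g..<l*g+g}. forwarded \<sigma> \<rho> a (d + a - n)) + card (stored \<sigma> \<rho> a (l*g+g-1 + a - n))"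
    by (rule card_Un_le)
  also have "\<dots> \<le> (\<Sum>d\<in>{l*g..<l*g+g}. card (forwarded \<sigma> \<rho> a (d + a - n))) + B"
    using f by (intro add_mono card_UN_le) (auto simp: feasible_def)
  also have "(\<Sum>d\<in>{l*g..<l*g+g}. card (forwarded \<sigma> \<rho> a (d + a - n))) \<le> (\<Sum>d\<in>{l*g..<l*g+g}. c)"
    using f by (intro sum_mono) (auto simp: feasible_def)
  finally show ?thesis by simp
qed

section \<open>Near requests\<close>

definition cnt :: "(nat \<Rightarrow> 'j option) \<Rightarrow> ('j \<Rightarrow> bool) \<Rightarrow> nat" where
  "cnt H Q = card {j. \<exists>v. H j = Some v \<and> Q v}"

lemma cnt_build_le:
  assumes "i \<le> length \<sigma>"
  shows "cnt (build D \<sigma> i) Q \<le> cnt (plan D \<sigma>) Q"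
  unfolding cnt_def
  by (intro card_mono finite_plan) (auto simp: build_eq_plan assms split: if_splits)

text \<open>Turns admission tests into capacity bounds: when the members of \<open>S\<close>
  conflict pairwise and each saw fewer than \<open>b\<close> conflicting predecessors, the latest
  member saw all the others.\<close>

lemma card_plan_le:
  assumes S: "\<And>i. i \<in> S \<Longrightarrow> \<exists>v. plan D \<sigma> i = Some v \<and> cnt (build D \<sigma> i) (Q v) < b"
    and Q: "\<And>i j v u. i \<in> S \<Longrightarrow> j \<in> S \<Longrightarrow> plan D \<sigma> i = Some v \<Longrightarrow> plan D \<sigma> j = Some u \<Longrightarrow> Q v u"
  shows "card S \<le> b"
proof (rule card_le_by_Max)
  show "finite S"
  proof (rule finite_subset)
    show "S \<subseteq> {..<length \<sigma>}"
    proof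
      fix i assume "i \<in> S"
      then obtain v where "plan D \<sigma> i = Some v" using S by blast
      from plan_Some_less[OF this] show "i \<in> {..<length \<sigma>}" by simp
    qed
  qed simp
  fix i assume i: "i \<in> S"
  obtain v where v: "plan D \<sigma> i = Some v" "cnt (build D \<sigma> i) (Q v) < b" using S[OF i] by blast
  have l: "i < length \<sigma>" using plan_Some_less[OF v(1)] .
  have "card {j \<in> S. j < i} \<le> cnt (build D \<sigma> i) (Q v)"
    unfolding cnt_def
  proof (rule card_mono)
    show "finite {j. \<exists>u. build D \<sigma> i j = Some u \<and> Q v u}"
      using l by (intro finite_build) simp
    show "{j \<in> S. j < i} \<subseteq> {j. \<exists>u. build D \<sigma> i j = Some u \<and> Q v u}"
    proof
      fix j assume j: "j \<in> {j \<in> S. j < i}"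
      then obtain u where "plan D \<sigma> j = Some u" using S[of j] by blast
      then show "j \<in> {j. \<exists>u. build D \<sigma> i j = Some u \<and> Q v u}"
        using Q[OF i _ v(1)] j l by (auto simp: build_eq_plan)
    qed
  qed
  then show "card {j \<in> S. j < i} < b" using v by simp
qed

text \<open>The pair (r, y) stands for request r waiting y steps at its source and then riding to its
  destination. The counts include all accepted requests that could possibly compete, so
  that no edge has to be inspected individually.\<close>

definition near_ok :: "nat \<Rightarrow> nat \<Rightarrow> nat \<Rightarrow> nat \<Rightarrow> nat \<Rightarrow> (nat \<Rightarrow> (request \<times> nat) option) \<Rightarrow> request \<Rightarrow> nat \<Rightarrow> bool" where
  "near_ok n B c w g H r y \<longleftrightarrow> src r < dst r \<and> dst r < src r + w \<and> y < g \<and>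
     cnt H (\<lambda>(r', y'). row_of n r' + y' = row_of n r + y \<and> src r < src r' + w \<and> src r' < src r + w) < c \<and>
     (y = 0 \<or> cnt H (\<lambda>(r', y'). src r' = src r \<and> row_of n r < row_of n r' + g \<and> row_of n r' < row_of n r + g) < B)"

definition near_decide :: "nat \<Rightarrow> nat \<Rightarrow> nat \<Rightarrow> nat \<Rightarrow> nat \<Rightarrow> (nat \<Rightarrow> (request \<times> nat) option) \<Rightarrow> request \<Rightarrow> (request \<times> nat) option" where
  "near_decide n B c w g H r =
     (if \<exists>y. near_ok n B c w g H r y then Some (r, SOME y. near_ok n B c w g H r y) else None)"

definition near_alg :: "nat \<Rightarrow> nat \<Rightarrow> nat \<Rightarrow> nat \<Rightarrow> nat \<Rightarrow> request list \<Rightarrow> run" where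
  "near_alg n B c w g \<sigma> i t =
     (let r = \<sigma> ! i in
      if t < rtime r then None else if t = rtime r then Some (src r)
      else case plan (near_decide n B c w g) \<sigma> i of None \<Rightarrow> None
        | Some (_, y) \<Rightarrow> if t \<le> rtime r + y then Some (src r)
            else if t \<le> rtime r + y + (dst r - src r) then Some (src r + (t - (rtime r + y))) else None)"

lemma near_plan_Some:
  assumes "plan (near_decide n B c w g) \<sigma> i = Some v"
  shows "i < length \<sigma>" "fst v = \<sigma> ! i"
    "near_ok n B c w g (build (near_decide n B c w g) \<sigma> i) (\<sigma> ! i) (snd v)"
proof -
  show i: "i < length \<sigma>" using plan_Some_less[OF assms] .
  let ?ok = "near_ok n B c w g (build (near_decide n B c w g) \<sigma> i) (\<sigma> ! i)"
  have ex: "\<exists>y. ?ok y" and v: "v = (\<sigma> ! i, SOME y. ?ok y)"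
    using assms unfolding plan_nth[OF i] near_decide_def[of n B c w g "build _ _ _"]
    by (metis option.distinct(1), metis option.distinct(1) option.inject)
  show "fst v = \<sigma> ! i" "?ok (snd v)" using someI_ex[OF ex] by (simp_all add: v)
qed

lemma near_online: "online n (near_alg n B c w g)"
proof (rule onlineI)
  fix \<sigma> \<sigma>' :: "request list" and T p i t
  assume "p \<le> length \<sigma>" "p \<le> length \<sigma>'" "i < p" and eq: "\<And>j. j < p \<Longrightarrow> \<sigma> ! j = \<sigma>' ! j"
  then have pl: "plan (near_decide n B c w g) \<sigma> i = plan (near_decide n B c w g) \<sigma>' i"
    by (intro plan_cong) auto
  show "near_alg n B c w g \<sigma> i t = near_alg n B c w g \<sigma>' i t"
    unfolding near_alg_def Let_def eq[OF \<open>i < p\<close>] pl ..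
qed

text \<open>A near packet is stored only at its source and then stays in one row, so the two counts
  in \<open>near_ok\<close> cover every edge that it uses.\<close>

lemma near_moves:
  assumes v: "valid_input n \<sigma>"
  shows "i \<in> forwarded \<sigma> (near_alg n B c w g \<sigma>) x t \<Longrightarrow>
      \<exists>y. plan (near_decide n B c w g) \<sigma> i = Some (\<sigma> ! i, y) \<and> row_of n (\<sigma> ! i) + y = t + n - x \<and>
        src (\<sigma> ! i) \<le> x \<and> x < dst (\<sigma> ! i)"
    and "i \<in> stored \<sigma> (near_alg n B c w g \<sigma>) x t \<Longrightarrow>
      \<exists>y. plan (near_decide n B c w g) \<sigma> i = Some (\<sigma> ! i, y) \<and> y \<noteq> 0 \<and>
        src (\<sigma> ! i) = x \<and> row_of n (\<sigma> ! i) \<le> t + n - x \<and> t + n - x < row_of n (\<sigma> ! i) + y"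
proof -
  have sd: "src (\<sigma> ! i) \<le> dst (\<sigma> ! i)" "dst (\<sigma> ! i) < n" if "i < length \<sigma>" for i
    using v that by (auto simp: valid_input_def)
  {
    assume "i \<in> forwarded \<sigma> (near_alg n B c w g \<sigma>) x t"
    then have i: "i < length \<sigma>" "x \<noteq> dst (\<sigma> ! i)" "near_alg n B c w g \<sigma> i t = Some x"
       "near_alg n B c w g \<sigma> i (Suc t) = Some (Suc x)" by (auto simp: forwarded_def)
    then obtain u where u: "plan (near_decide n B c w g) \<sigma> i = Some u"
      by (cases "plan (near_decide n B c w g) \<sigma> i") (auto simp: near_alg_def Let_def split: if_splits)
    obtain y where y: "u = (\<sigma> ! i, y)" using near_plan_Some(2)[OF u] by (cases u) auto
    show "\<exists>y. plan (near_decide n B c w g) \<sigma> i = Some (\<sigma> ! i, y) \<and> row_of n (\<sigma> ! i) + y = t + n - x \<and>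
        src (\<sigma> ! i) \<le> x \<and> x < dst (\<sigma> ! i)"
      using i(3,4) u y sd[OF i(1)]
      by (intro exI[of _ y]) (auto simp: near_alg_def Let_def row_of_def split: if_splits)
  }
  {
    assume "i \<in> stored \<sigma> (near_alg n B c w g \<sigma>) x t"
    then have i: "i < length \<sigma>" "x \<noteq> dst (\<sigma> ! i)" "near_alg n B c w g \<sigma> i t = Some x"
       "near_alg n B c w g \<sigma> i (Suc t) = Some x" by (auto simp: stored_def)
    then obtain u where u: "plan (near_decide n B c w g) \<sigma> i = Some u"
      by (cases "plan (near_decide n B c w g) \<sigma> i") (auto simp: near_alg_def Let_def split: if_splits)
    obtain y where y: "u = (\<sigma> ! i, y)" using near_plan_Some(2)[OF u] by (cases u) auto
    show "\<exists>y. plan (near_decide n B c w g) \<sigma> i = Some (\<sigma> ! i, y) \<and> y \<noteq> 0 \<and>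
        src (\<sigma> ! i) = x \<and> row_of n (\<sigma> ! i) \<le> t + n - x \<and> t + n - x < row_of n (\<sigma> ! i) + y"
      using i(3,4) u y sd[OF i(1)]
      by (intro exI[of _ y]) (auto simp: near_alg_def Let_def row_of_def split: if_splits)
  }
qed

lemma near_feasible:
  assumes v: "valid_input n \<sigma>"
  shows "feasible B c \<sigma> (near_alg n B c w g \<sigma>)"
proof -
  let ?pl = "plan (near_decide n B c w g) \<sigma>" and ?bd = "build (near_decide n B c w g) \<sigma>"
  have sd: "src (\<sigma> ! i) \<le> dst (\<sigma> ! i)" "dst (\<sigma> ! i) < n" if "i < length \<sigma>" for i
    using v that by (auto simp: valid_input_def)
  have "card (forwarded \<sigma> (near_alg n B c w g \<sigma>) x t) \<le> c" for x t
  proof (rule card_plan_le[where D = "near_decide n B c w g" and \<sigma> = \<sigma> and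
     Q = "\<lambda>(r, y) (r', y'). row_of n r' + y' = row_of n r + y \<and> src r < src r' + w \<and> src r' < src r + w"])
    fix i assume i: "i \<in> forwarded \<sigma> (near_alg n B c w g \<sigma>) x t"
    obtain y where y: "?pl i = Some (\<sigma> ! i, y)" using near_moves(1)[OF v i] by blast
    show "\<exists>v. ?pl i = Some v \<and> cnt (?bd i) (case v of (r, y) \<Rightarrow>
        \<lambda>(r', y'). row_of n r' + y' = row_of n r + y \<and> src r < src r' + w \<and> src r' < src r + w) < c"
      using y near_plan_Some(3)[OF y] by (auto simp: near_ok_def)
    \<comment> \<open>Both packets cover column \<open>x\<close> and travel less than
      \<open>w\<close> columns, so their sources are less than \<open>w\<close> apart.\<close>
    fix j u u' assume j: "j \<in> forwarded \<sigma> (near_alg n B c w g \<sigma>) x t" and u: "?pl i = Some u" "?pl j = Some u'"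
    show "(case u of (r, y) \<Rightarrow>
        \<lambda>(r', y'). row_of n r' + y' = row_of n r + y \<and> src r < src r' + w \<and> src r' < src r + w) u'"
      using near_moves(1)[OF v i] near_moves(1)[OF v j] near_plan_Some(3)[OF u(1)] near_plan_Some(3)[OF u(2)] u
      by (auto simp: near_ok_def)
  qed
  moreover have "card (stored \<sigma> (near_alg n B c w g \<sigma>) x t) \<le> B" for x t
  proof (rule card_plan_le[where D = "near_decide n B c w g" and \<sigma> = \<sigma> and
     Q = "\<lambda>(r, y) (r', y'). src r' = src r \<and> row_of n r < row_of n r' + g \<and> row_of n r' < row_of n r + g"])
    fix i assume i: "i \<in> stored \<sigma> (near_alg n B c w g \<sigma>) x t"
    obtain y where y: "?pl i = Some (\<sigma> ! i, y)" "y \<noteq> 0" using near_moves(2)[OF v i] by blast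
    show "\<exists>v. ?pl i = Some v \<and> cnt (?bd i) (case v of (r, y) \<Rightarrow>
        \<lambda>(r', y'). src r' = src r \<and> row_of n r < row_of n r' + g \<and> row_of n r' < row_of n r + g) < B"
      using y near_plan_Some(3)[OF y(1)] by (auto simp: near_ok_def)
    fix j u u' assume j: "j \<in> stored \<sigma> (near_alg n B c w g \<sigma>) x t" and u: "?pl i = Some u" "?pl j = Some u'"
    show "(case u of (r, y) \<Rightarrow>
        \<lambda>(r', y'). src r' = src r \<and> row_of n r < row_of n r' + g \<and> row_of n r' < row_of n r + g) u'"
      using near_moves(2)[OF v i] near_moves(2)[OF v j] near_plan_Some(3)[OF u(1)] near_plan_Some(3)[OF u(2)] u
      by (auto simp: near_ok_def)
  qed
  moreover have "(if x = dst (\<sigma> ! i) then near_alg n B c w g \<sigma> i (Suc t) = None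
             else near_alg n B c w g \<sigma> i (Suc t) \<in> {None, Some x, Some (Suc x)})"
    if i: "i < length \<sigma>" and t: "t \<ge> rtime (\<sigma> ! i)" and x: "near_alg n B c w g \<sigma> i t = Some x" for i t x
  proof (cases "?pl i")
    case None
    then show ?thesis using t by (auto simp: near_alg_def Let_def)
  next
    case (Some u)
    obtain y where y: "u = (\<sigma> ! i, y)" using near_plan_Some(2)[OF Some] by (cases u) auto
    have "src (\<sigma> ! i) < dst (\<sigma> ! i)" using near_plan_Some(3)[OF Some] by (simp add: near_ok_def)
    then show ?thesis using t x Some y by (auto simp: near_alg_def Let_def split: if_splits)
  qed
  moreover have "near_alg n B c w g \<sigma> i (Suc t) = None"
    if i: "i < length \<sigma>" and t: "t \<ge> rtime (\<sigma> ! i)" and x: "near_alg n B c w g \<sigma> i t = None" for i t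
    using t x by (auto simp: near_alg_def Let_def split: if_splits option.splits)
  moreover have "\<forall>t<rtime (\<sigma> ! i). near_alg n B c w g \<sigma> i t = None"
    "near_alg n B c w g \<sigma> i (rtime (\<sigma> ! i)) = Some (src (\<sigma> ! i))" for i
    by (simp_all add: near_alg_def Let_def)
  ultimately show ?thesis unfolding feasible_def by blast
qed

lemma near_delivered:
  assumes "plan (near_decide n B c w g) \<sigma> i = Some u"
  shows "delivered \<sigma> (near_alg n B c w g \<sigma>) i"
proof -
  obtain y where y: "u = (\<sigma> ! i, y)" using near_plan_Some(2)[OF assms] by (cases u) auto
  have "src (\<sigma> ! i) < dst (\<sigma> ! i)" using near_plan_Some(3)[OF assms] by (simp add: near_ok_def)
  then have "near_alg n B c w g \<sigma> i (rtime (\<sigma> ! i) + y + (dst (\<sigma> ! i) - src (\<sigma> ! i))) = Some (dst (\<sigma> ! i))"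
    using assms y by (auto simp: near_alg_def Let_def)
  then show ?thesis by (auto simp: delivered_def)
qed

lemma near_nonpreemptive: "nonpreemptive \<sigma> (near_alg n B c w g \<sigma>)"
  unfolding nonpreemptive_def
proof (intro allI impI)
  fix i assume "\<exists>t>rtime (\<sigma> ! i). near_alg n B c w g \<sigma> i t \<noteq> None"
  then obtain u where "plan (near_decide n B c w g) \<sigma> i = Some u"
    by (cases "plan (near_decide n B c w g) \<sigma> i") (auto simp: near_alg_def Let_def)
  then show "delivered \<sigma> (near_alg n B c w g \<sigma>) i" by (rule near_delivered)
qed

text \<open>Every wait \<open>y < g\<close> was refused. If the source column has room, or
  \<open>g = 1\<close>, all \<open>g\<close> rows are full, and these rows are disjoint and hold
  \<open>g * c\<close> packets. If the column is full, it supplies \<open>B\<close> packets, and for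
  \<open>c > B\<close> the refusal of \<open>y = 0\<close> supplies \<open>c\<close>.\<close>

lemma near_rejected:
  assumes i: "i < length \<sigma>" and no: "plan (near_decide n B c w g) \<sigma> i = None"
    and far: "src (\<sigma> ! i) < dst (\<sigma> ! i)" "dst (\<sigma> ! i) < src (\<sigma> ! i) + w"
    and g: "0 < g" "g = 1 \<Longrightarrow> B \<le> c" "B \<le> g * c" "1 \<le> c"
  shows "max B c \<le> cnt (plan (near_decide n B c w g) \<sigma>) (\<lambda>(r', y'). src (\<sigma> ! i) < src r' + w \<and> src r' < src (\<sigma> ! i) + w \<and>
           row_of n (\<sigma> ! i) < row_of n r' + g \<and> row_of n r' < row_of n (\<sigma> ! i) + g)"
proof -
  let ?H = "build (near_decide n B c w g) \<sigma> i" and ?r = "\<sigma> ! i"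
  let ?D = "near_decide n B c w g"
  let ?W = "\<lambda>(r', y'). src ?r < src r' + w \<and> src r' < src ?r + w \<and>
           row_of n ?r < row_of n r' + g \<and> row_of n r' < row_of n ?r + g"
  let ?h = "\<lambda>y (r', y'). row_of n r' + y' = row_of n ?r + y \<and> src ?r < src r' + w \<and> src r' < src ?r + w"
  let ?v = "\<lambda>(r', y'). src r' = src ?r \<and> row_of n ?r < row_of n r' + g \<and> row_of n r' < row_of n ?r + g"
  have fin: "finite {j. \<exists>v. ?H j = Some v \<and> Q j v}" for Q using i by (intro finite_build) simp
  have yg: "y' < g" if "?H j = Some (r', y')" for j r' y'
  proof -
    have "plan ?D \<sigma> j = Some (r', y')" using that i by (auto simp: build_eq_plan split: if_splits)
    from near_plan_Some(3)[OF this] show ?thesis by (simp add: near_ok_def)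
  qed
  have nok: "\<not> near_ok n B c w g ?H ?r y" for y
    using no by (auto simp: plan_nth[OF i] near_decide_def split: if_splits)
  \<comment> \<open>Equal final rows and waits below \<open>g\<close> put the starting rows less
    than \<open>g\<close> apart.\<close>
  have sub: "{j. \<exists>v. ?H j = Some v \<and> ?h y v} \<subseteq> {j. \<exists>v. ?H j = Some v \<and> ?W v}" if "y < g" for y
    using that yg by (fastforce)
  have "max B c \<le> cnt ?H ?W"
  proof (cases "g \<noteq> 1 \<and> cnt ?H ?v \<ge> B")
    case True
    show ?thesis
    proof (cases "c \<le> B")
      case True
      have "cnt ?H ?v \<le> cnt ?H ?W"
        unfolding cnt_def using far by (intro card_mono fin) auto
      then show ?thesis using True \<open>g \<noteq> 1 \<and> cnt ?H ?v \<ge> B\<close> by simp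
    next
      case False
      then have "c \<le> cnt ?H (?h 0)"
        using nok[of 0] far g by (auto simp: near_ok_def)
      also have "\<dots> \<le> cnt ?H ?W" unfolding cnt_def using g by (intro card_mono fin sub) auto
      finally show ?thesis using False by simp
    qed
  next
    case F: False
    have c: "c \<le> cnt ?H (?h y)" if "y < g" for y
      using nok[of y] far that F by (cases "g = 1") (auto simp: near_ok_def)
    have "g * c = (\<Sum>y<g. c)" by simp
    also have "\<dots> \<le> (\<Sum>y<g. cnt ?H (?h y))" by (intro sum_mono c) auto
    also have "\<dots> = card (\<Union>y<g. {j. \<exists>v. ?H j = Some v \<and> ?h y v})"
      unfolding cnt_def by (rule card_UN_disjoint[symmetric]; (intro finite_lessThan ballI fin)?) auto
    also have "\<dots> \<le> cnt ?H ?W" unfolding cnt_def using sub by (intro card_mono fin UN_least) simp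
    finally have "g * c \<le> cnt ?H ?W" .
    moreover have "max B c \<le> g * c" using g by simp
    ultimately show ?thesis by linarith
  qed
  also have "\<dots> \<le> cnt (plan ?D \<sigma>) ?W" using i by (intro cnt_build_le) simp
  finally show ?thesis .
qed

text \<open>Double counting of the pairs with \<open>N p j\<close>: a group of at most
  \<open>L * K\<close> rejected elements sees at least \<open>K\<close> accepted ones, each of which
  is seen by at most \<open>V\<close> groups.\<close>

lemma charging_bound:
  fixes F :: "'a \<Rightarrow> 'p" and R :: "'a set" and M :: "'b set"
  assumes "finite R" "finite M"
    and F: "\<And>p. p \<in> F ` R \<Longrightarrow> card {i \<in> R. F i = p} \<le> L * K \<and> K \<le> card {j \<in> M. N p j}"
    and N: "\<And>j. j \<in> M \<Longrightarrow> card {p \<in> F ` R. N p j} \<le> V"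
  shows "card R \<le> L * V * card M"
proof -
  have "card R = card (\<Union>p\<in>F ` R. {i \<in> R. F i = p})" by (rule arg_cong[of _ _ card]) auto
  also have "\<dots> \<le> (\<Sum>p\<in>F ` R. card {i \<in> R. F i = p})" using assms(1) by (intro card_UN_le) auto
  also have "\<dots> \<le> (\<Sum>p\<in>F ` R. L * card {j \<in> M. N p j})"
    by (intro sum_mono order_trans[OF conjunct1[OF F]] mult_le_mono2 conjunct2[OF F])
  also have "\<dots> = L * (\<Sum>p\<in>F ` R. \<Sum>j\<in>M. if N p j then 1 else 0)"
    using assms(2) by (simp add: sum_distrib_left[symmetric] sum.If_cases Int_def)
  also have "\<dots> = L * (\<Sum>j\<in>M. \<Sum>p\<in>F ` R. if N p j then 1 else 0)"
    by (subst sum.swap) simp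
  also have "\<dots> = L * (\<Sum>j\<in>M. card {p \<in> F ` R. N p j})"
    using assms(1) by (simp add: sum.If_cases Int_def)
  also have "\<dots> \<le> L * (\<Sum>j\<in>M. V)" by (intro mult_le_mono2 sum_mono N)
  finally show ?thesis by (simp add: mult_ac)
qed

lemma near_competitive:
  assumes v: "valid_input n \<sigma>" and f: "feasible B c \<sigma> \<rho>"
    and g: "0 < g" "g = 1 \<Longrightarrow> B \<le> c" "B \<le> g * c" "1 \<le> c" "g * c \<le> B + c"
  shows "card {i. i < length \<sigma> \<and> delivered \<sigma> \<rho> i \<and> dst (\<sigma> ! i) < src (\<sigma> ! i) + w}
    \<le> (1 + 18 * w) * throughput \<sigma> (near_alg n B c w g \<sigma>)"
proof -
  let ?pl = "plan (near_decide n B c w g) \<sigma>"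
  define M where "M = {j. ?pl j \<noteq> None}"
  have M: "finite M" "M \<subseteq> {..<length \<sigma>}"
  proof -
    show "M \<subseteq> {..<length \<sigma>}"
    proof
      fix j assume "j \<in> M"
      then have "plan (near_decide n B c w g) \<sigma> j \<noteq> None" by (simp only: M_def mem_Collect_eq not_False_eq_True)
      then have "\<not> length \<sigma> \<le> j" by (rule contrapos_nn) (rule plan_ge)
      then show "j \<in> {..<length \<sigma>}" by simp
    qed
    then show "finite M" by (rule finite_subset) simp
  qed
  \<comment> \<open>Requests with equal source and destination are delivered at release without any
    decision.\<close>
  define Z where "Z = {i. i < length \<sigma> \<and> src (\<sigma> ! i) = dst (\<sigma> ! i)}"
  define R where "R = {i. i < length \<sigma> \<and> delivered \<sigma> \<rho> i \<and> src (\<sigma> ! i) < dst (\<sigma> ! i) \<and> dst (\<sigma> ! i) < src (\<sigma> ! i) + w \<and> ?pl i = None}"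
  have sub: "{i. i < length \<sigma> \<and> delivered \<sigma> \<rho> i \<and> dst (\<sigma> ! i) < src (\<sigma> ! i) + w} \<subseteq> (M \<union> Z) \<union> R"
  proof
    fix i assume i: "i \<in> {i. i < length \<sigma> \<and> delivered \<sigma> \<rho> i \<and> dst (\<sigma> ! i) < src (\<sigma> ! i) + w}"
    then have "src (\<sigma> ! i) \<le> dst (\<sigma> ! i)" using v by (auto simp: valid_input_def)
    then show "i \<in> (M \<union> Z) \<union> R"
      using i unfolding M_def Z_def R_def by (cases "src (\<sigma> ! i) = dst (\<sigma> ! i)") auto
  qed
  have Rf: "finite R" "finite Z" by (auto simp: R_def Z_def)
  have "M \<union> Z \<subseteq> {i. i < length \<sigma> \<and> delivered \<sigma> (near_alg n B c w g \<sigma>) i}"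
  proof (intro Un_least subsetI)
    fix i assume "i \<in> M" then show "i \<in> {i. i < length \<sigma> \<and> delivered \<sigma> (near_alg n B c w g \<sigma>) i}"
      using near_delivered[of n B c w g \<sigma> i] subsetD[OF M(2), of i] unfolding M_def by blast
  next
    fix i assume "i \<in> Z"
    then have "near_alg n B c w g \<sigma> i (rtime (\<sigma> ! i)) = Some (dst (\<sigma> ! i))" by (simp add: Z_def near_alg_def)
    then show "i \<in> {i. i < length \<sigma> \<and> delivered \<sigma> (near_alg n B c w g \<sigma>) i}"
      using \<open>i \<in> Z\<close> by (auto simp: delivered_def Z_def)
  qed
  then have MZ: "card (M \<union> Z) \<le> throughput \<sigma> (near_alg n B c w g \<sigma>)"
    unfolding throughput_def by (intro card_mono) auto
  \<comment> \<open>Groups are pairs of a source and a block of \<open>g\<close> rows. Rows less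
    than \<open>g\<close> apart lie in equal or adjacent blocks, so an accepted packet is seen from
    at most \<open>2 * w\<close> sources and three blocks, which gives \<open>6 * w\<close>.\<close>
  let ?N = "\<lambda>(a, l) j. a < src (\<sigma> ! j) + w \<and> src (\<sigma> ! j) < a + w \<and>
      l \<le> row_of n (\<sigma> ! j) div g + 1 \<and> row_of n (\<sigma> ! j) div g \<le> l + 1"
  have "card R \<le> 3 * (6 * w) * card M"
  proof (rule charging_bound[where F = "\<lambda>i. (src (\<sigma> ! i), row_of n (\<sigma> ! i) div g)" and K = "max B c" and N = ?N])
    fix p assume "p \<in> (\<lambda>i. (src (\<sigma> ! i), row_of n (\<sigma> ! i) div g)) ` R"
    then obtain i where i: "i \<in> R" and p: "p = (src (\<sigma> ! i), row_of n (\<sigma> ! i) div g)" by auto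
    have "card {j \<in> R. (src (\<sigma> ! j), row_of n (\<sigma> ! j) div g) = p} \<le>
       card {j. j < length \<sigma> \<and> delivered \<sigma> \<rho> j \<and> src (\<sigma> ! j) = fst p \<and> fst p < dst (\<sigma> ! j) \<and>
            row_of n (\<sigma> ! j) div g = snd p}"
      by (intro card_mono) (auto simp: R_def)
    also have "\<dots> \<le> g * c + B" by (rule card_sources_le[OF v f g(1)])
    \<comment> \<open>The factor 3 is \<open>g * c + B \<le> 2 * B + c\<close>.\<close>
    also have "\<dots> \<le> 3 * max B c" using g(5) by (simp add: max_def)
    finally have 1: "card {j \<in> R. (src (\<sigma> ! j), row_of n (\<sigma> ! j) div g) = p} \<le> 3 * max B c" .
    have near: "x div g \<le> y div g + 1" if "x < y + g" for x y :: nat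
      using div_le_mono[of x "y + g" g] that g(1) by simp
    have "max B c \<le> cnt ?pl (\<lambda>(r', y'). src (\<sigma> ! i) < src r' + w \<and> src r' < src (\<sigma> ! i) + w \<and>
           row_of n (\<sigma> ! i) < row_of n r' + g \<and> row_of n r' < row_of n (\<sigma> ! i) + g)"
      using i g by (intro near_rejected) (auto simp: R_def)
    also have "\<dots> \<le> card {j \<in> M. ?N p j}"
      unfolding cnt_def
    proof (intro card_mono)
      show "finite {j \<in> M. ?N p j}" using M by simp
      show "{j. \<exists>v. ?pl j = Some v \<and> (case v of (r', y') \<Rightarrow> src (\<sigma> ! i) < src r' + w \<and> src r' < src (\<sigma> ! i) + w \<and>
           row_of n (\<sigma> ! i) < row_of n r' + g \<and> row_of n r' < row_of n (\<sigma> ! i) + g)} \<subseteq> {j \<in> M. ?N p j}"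
        using near_plan_Some(2) near by (fastforce simp: M_def p)
    qed
    finally show "card {j \<in> R. (src (\<sigma> ! j), row_of n (\<sigma> ! j) div g) = p} \<le> 3 * max B c \<and> max B c \<le> card {j \<in> M. ?N p j}"
      using 1 by simp
  next
    fix j assume "j \<in> M"
    let ?a = "src (\<sigma> ! j)" and ?l = "row_of n (\<sigma> ! j) div g"
    have "{p \<in> (\<lambda>i. (src (\<sigma> ! i), row_of n (\<sigma> ! i) div g)) ` R. ?N p j}
      \<subseteq> {?a + 1 - w..<?a + w} \<times> {?l - 1..?l + 1}" by auto
    from card_mono[OF _ this]
    have "card {p \<in> (\<lambda>i. (src (\<sigma> ! i), row_of n (\<sigma> ! i) div g)) ` R. ?N p j} \<le> (?a + w - (?a + 1 - w)) * (?l + 2 - (?l - 1))"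
      by (simp add: card_cartesian_product)
    also have "\<dots> \<le> (2 * w) * 3" by (intro mult_le_mono) auto
    finally show "card {p \<in> (\<lambda>i. (src (\<sigma> ! i), row_of n (\<sigma> ! i) div g)) ` R. ?N p j} \<le> 6 * w"
      by simp
  qed (use Rf M in auto)
  moreover have "card M \<le> card (M \<union> Z)" using M Rf by (intro card_mono) auto
  ultimately have "card R \<le> 18 * w * throughput \<sigma> (near_alg n B c w g \<sigma>)"
  proof -
    assume r: "card R \<le> 3 * (6 * w) * card M" and m: "card M \<le> card (M \<union> Z)"
    have "3 * (6 * w) * card M \<le> 3 * (6 * w) * throughput \<sigma> (near_alg n B c w g \<sigma>)"
      using m MZ by (intro mult_le_mono2) simp
    with r have "card R \<le> 3 * (6 * w) * throughput \<sigma> (near_alg n B c w g \<sigma>)" by (rule order_trans)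
    also have "\<dots> = 18 * w * throughput \<sigma> (near_alg n B c w g \<sigma>)" by simp
    finally show ?thesis .
  qed
  moreover have "card {i. i < length \<sigma> \<and> delivered \<sigma> \<rho> i \<and> dst (\<sigma> ! i) < src (\<sigma> ! i) + w} \<le> card (M \<union> Z) + card R"
    using card_mono[OF _ sub] card_Un_le[of "M \<union> Z" R] M(1) Rf by (simp add: order_trans)
  ultimately show ?thesis using MZ by (simp add: algebra_simps)
qed

section \<open>Local switching in the tiled grid\<close>

text \<open>A job (r, \<delta>, z) moves request r straight through its source cell, upwards if \<delta> and to the
  right otherwise, and then through the tiles, leaving tile column I in tile row z I.\<close>

type_synonym job = "request \<times> bool \<times> (nat \<Rightarrow> nat)"

text \<open>A is the set of packets stored at a node, P the set of packets present, V those that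
  arrived by a vertical step, W those that want to go up. Packets that already move in the wanted
  direction are never diverted, and a packet misses its direction only if that is full.\<close>

definition up_choice :: "nat \<Rightarrow> nat \<Rightarrow> nat set \<Rightarrow> nat set \<Rightarrow> nat set \<Rightarrow> nat set \<Rightarrow> bool" where
  "up_choice B c P V W A \<longleftrightarrow> A \<subseteq> P \<and> P \<inter> V \<inter> W \<subseteq> A \<and> A \<subseteq> V \<union> W \<and> card A \<le> B \<and> card (P - A) \<le> c \<and>
     (P \<inter> W - A \<noteq> {} \<longrightarrow> card A = B) \<and> (A - W \<noteq> {} \<longrightarrow> card (P - A) = c)"

text \<open>Among the sets obeying the first five conditions, one that fulfils the most wishes also
  has the last two: a packet missing its direction could be moved over as long as that direction had
  room. Such sets exist because \<open>P \<inter> V\<close>, everybody going straight on, is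
  one.\<close>

lemma up_choice_ex:
  assumes fin: "finite P" and "card (P \<inter> V) \<le> B" "card (P - V) \<le> c"
  shows "\<exists>A. up_choice B c P V W A"
proof -
  define \<A> where "\<A> = {A. A \<subseteq> P \<and> P \<inter> V \<inter> W \<subseteq> A \<and> A \<subseteq> V \<union> W \<and> card A \<le> B \<and> card (P - A) \<le> c}"
  define s where "s A = card (A \<inter> W) + card ((P - A) - W)" for A
  have "finite \<A>" unfolding \<A>_def using fin by (rule rev_finite_subset[OF finite_Pow_iff[THEN iffD2]]) auto
  moreover have "P \<inter> V \<in> \<A>"
  proof -
    have "P - P \<inter> V = P - V" by auto
    then show ?thesis using assms by (auto simp: \<A>_def)
  qed
  ultimately have "finite (s ` \<A>)" "s ` \<A> \<noteq> {}" by auto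
  then have m: "Max (s ` \<A>) \<in> s ` \<A>" and ge: "\<And>A'. A' \<in> \<A> \<Longrightarrow> s A' \<le> Max (s ` \<A>)"
    by (auto intro: Max_in)
  from m obtain A where A: "A \<in> \<A>" and "Max (s ` \<A>) = s A" by blast
  then have mx: "\<And>A'. A' \<in> \<A> \<Longrightarrow> s A' \<le> s A" using ge by simp
  have finA: "finite A" using A fin finite_subset by (auto simp: \<A>_def)
  have 1: "card A = B" if i: "i \<in> P \<inter> W - A" for i
  proof (rule ccontr)
    assume "card A \<noteq> B"
    then have l: "card A < B" using A by (auto simp: \<A>_def)
    have "card (P - insert i A) \<le> card (P - A)" using fin by (intro card_mono) auto
    then have "insert i A \<in> \<A>" using A i l finA by (auto simp: \<A>_def)
    moreover have "s (insert i A) > s A"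
    proof -
      have "(P - insert i A) - W = (P - A) - W" using i by auto
      moreover have "insert i A \<inter> W = insert i (A \<inter> W)" using i by auto
      ultimately show ?thesis using i finA by (simp add: s_def)
    qed
    ultimately show False using mx by (meson not_le)
  qed
  have 2: "card (P - A) = c" if i: "i \<in> A - W" for i
  proof (rule ccontr)
    assume "card (P - A) \<noteq> c"
    then have l: "card (P - A) < c" using A by (auto simp: \<A>_def)
    have iP: "i \<in> P" using i A by (auto simp: \<A>_def)
    have eq: "P - (A - {i}) = insert i (P - A)" using iP by auto
    have "card (P - (A - {i})) = Suc (card (P - A))"
      unfolding eq using fin i by simp
    moreover have "card (A - {i}) \<le> card A" using finA by (intro card_mono) auto
    ultimately have "A - {i} \<in> \<A>" using A i l finA by (auto simp: \<A>_def)
    moreover have "s (A - {i}) > s A"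
    proof -
      have "(P - (A - {i})) - W = insert i ((P - A) - W)" using i iP by auto
      moreover have "(A - {i}) \<inter> W = A \<inter> W" using i by auto
      ultimately show ?thesis using i fin by (simp add: s_def)
    qed
    ultimately show False using mx by (meson not_le)
  qed
  show ?thesis using A 1 2 by (intro exI[of _ A]) (auto simp: up_choice_def \<A>_def)
qed

section \<open>Tile geometry and the step-by-step simulation\<close>

locale grid =
  fixes n B c w h sx sd :: nat
begin

text \<open>Cells have w columns and h rows and are indexed by XC and YC; two by two cells form the tile
  (TI, TJ). Sources lie in the lower left cell of a tile. Traffic enters a tile only through its
  upper left and lower right cells and leaves it only from its upper right cell, so it
  never meets the source cell.\<close>

definition XC :: "nat \<Rightarrow> nat" where "XC x = x div w + sx"
definition YC :: "nat \<Rightarrow> nat" where "YC d = d div h + sd"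
definition TI :: "nat \<Rightarrow> nat" where "TI x = XC x div 2"
definition TJ :: "nat \<Rightarrow> nat" where "TJ d = YC d div 2"

text \<open>Two cell widths always cross a tile boundary; hence a far request never ends in the tile
  column of its source.\<close>

lemma TI_less:
  assumes "0 < w" "x + 2 * w \<le> y"
  shows "TI x < TI y"
proof -
  have "(x + 2 * w) div w \<le> y div w" using assms(2) by (rule div_le_mono)
  then have "x div w + 2 \<le> y div w" using assms(1) by simp
  then have "(XC x + 2) div 2 \<le> XC y div 2" unfolding XC_def by (intro div_le_mono) simp
  then show ?thesis by (simp add: TI_def)
qed

text \<open>The tile path is consulted only in the upper right cell, where the traffic of the tile
  collects. In the tile column of the destination the answer there is to go right until the packet
  meets its node.\<close>

fun wants_up :: "job \<Rightarrow> bool \<Rightarrow> nat \<Rightarrow> nat \<Rightarrow> bool" where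
  "wants_up (r, _, z) \<delta> x d =
     (if even (XC x) then even (YC d) \<and> \<delta>
      else even (YC d) \<or> TI x < TI (dst r) \<and> TJ d < z (TI x))"

text \<open>The last disjunct is the destination tile, which is entered from the left and for whose
  column \<open>z\<close> prescribes nothing.\<close>

fun onpath :: "job \<Rightarrow> nat \<Rightarrow> nat \<Rightarrow> bool" where
  "onpath (r, _, z) I J \<longleftrightarrow>
     TI (src r) \<le> I \<and> I < TI (dst r) \<and> enter (TI (src r)) (TJ (row_of n r)) z I \<le> J \<and> J \<le> z I \<or>
     I = TI (dst r) \<and> J = z (I - 1)"

text \<open>A state assigns to every packet in the network its node and whether its last step was
  vertical.\<close>

definition present :: "(nat \<Rightarrow> job option) \<Rightarrow> (nat \<Rightarrow> (nat \<times> bool) option) \<Rightarrow> nat \<Rightarrow> nat set" where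
  "present J S x = {i. \<exists>v \<delta>. J i = Some v \<and> S i = Some (x, \<delta>) \<and> x \<noteq> dst (fst v)}"

definition up_in :: "(nat \<Rightarrow> (nat \<times> bool) option) \<Rightarrow> nat set" where
  "up_in S = {i. \<exists>x. S i = Some (x, True)}"

definition up_want :: "(nat \<Rightarrow> job option) \<Rightarrow> nat \<Rightarrow> (nat \<Rightarrow> (nat \<times> bool) option) \<Rightarrow> nat set" where
  "up_want J t S = {i. \<exists>v x \<delta>. J i = Some v \<and> S i = Some (x, \<delta>) \<and> wants_up v \<delta> x (t + n - x)}"

definition go_up :: "(nat \<Rightarrow> job option) \<Rightarrow> nat \<Rightarrow> (nat \<Rightarrow> (nat \<times> bool) option) \<Rightarrow> nat \<Rightarrow> nat set" where
  "go_up J t S x = (SOME A. up_choice B c (present J S x) (up_in S) (up_want J t S) A)"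

definition move :: "(nat \<Rightarrow> job option) \<Rightarrow> nat \<Rightarrow> (nat \<Rightarrow> (nat \<times> bool) option) \<Rightarrow> nat \<Rightarrow> (nat \<times> bool) option" where
  "move J t S i = (case J i of None \<Rightarrow> None | Some v \<Rightarrow>
     (case S i of None \<Rightarrow> None | Some (x, \<delta>) \<Rightarrow>
        if x = dst (fst v) then None
        else if i \<in> go_up J t S x then Some (x, True) else Some (Suc x, False)))"

text \<open>A new packet gets its chosen direction as that of a fictitious last step; the switching
  rule then treats it as going straight and never diverts it in its source cell.\<close>

definition inject :: "(nat \<Rightarrow> job option) \<Rightarrow> nat \<Rightarrow> (nat \<Rightarrow> (nat \<times> bool) option) \<Rightarrow> nat \<Rightarrow> (nat \<times> bool) option" where
  "inject J t S i = (case J i of None \<Rightarrow> None | Some (r, \<delta>, z) \<Rightarrow>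
     if rtime r = t then Some (src r, \<delta>) else S i)"

primrec sim :: "(nat \<Rightarrow> job option) \<Rightarrow> nat \<Rightarrow> nat \<Rightarrow> (nat \<times> bool) option" where
  "sim J 0 = inject J 0 (\<lambda>_. None)"
| "sim J (Suc t) = inject J (Suc t) (move J t (sim J t))"

lemma sim_Some:
  assumes "sim J t i = Some s"
  shows "\<exists>v. J i = Some v \<and> rtime (fst v) \<le> t"
  using assms
proof (induction t arbitrary: s)
  case 0
  then show ?case by (auto simp: inject_def split: option.splits if_splits)
next
  case (Suc t)
  then obtain v where v: "J i = Some v" by (auto simp: inject_def split: option.splits)
  show ?case
  proof (cases "rtime (fst v) = Suc t")
    case True then show ?thesis using v by auto
  next
    case False
    then have "sim J t i \<noteq> None" using Suc.prems v
      by (cases v; cases "sim J t i") (auto simp: inject_def move_def)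
    then show ?thesis using Suc.IH by (metis le_SucI not_None_eq)
  qed
qed

lemma sim_start: "J i = Some v \<Longrightarrow> sim J (rtime (fst v)) i = Some (src (fst v), fst (snd v))"
  by (cases "rtime (fst v)") (auto simp: inject_def split: prod.splits)

lemma sim_Suc:
  assumes "J i = Some v" "rtime (fst v) \<noteq> Suc t"
  shows "sim J (Suc t) i = (case sim J t i of None \<Rightarrow> None | Some (x, \<delta>) \<Rightarrow>
        if x = dst (fst v) then None
        else if i \<in> go_up J t (sim J t) x then Some (x, True) else Some (Suc x, False))"
  using assms by (auto simp: inject_def move_def split: prod.splits)

text \<open>Each step keeps the row or raises it by one; the inequality between rows is written
  without the subtraction in \<open>t + n - x\<close>.\<close>

lemma sim_row_mono:
  assumes "sim J s i = Some (x, \<delta>)" "sim J t i = Some (x', \<delta>')" "s \<le> t"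
  shows "s + x' \<le> t + x"
  using assms(3,2)
proof (induction t arbitrary: x' \<delta>' rule: dec_induct)
  case base then show ?case using assms(1) by simp
next
  case (step t)
  obtain v where v: "J i = Some v" "rtime (fst v) \<le> s" using sim_Some[OF assms(1)] by blast
  then have "rtime (fst v) \<noteq> Suc t" using step by simp
  from sim_Suc[of J i v t, OF v(1) this] step.prems obtain x0 \<delta>0 where
    "sim J t i = Some (x0, \<delta>0)" "x' = x0 \<or> x' = Suc x0" by (auto split: option.splits if_splits)
  then show ?case using step.IH[of x0 \<delta>0] by auto
qed

text \<open>Packets released after \<open>T\<close> are not yet in the state, so the switching
  decisions up to step \<open>T\<close> coincide. At time \<open>Suc T\<close> new packets may
  differ, which is why the second claim speaks only of a packet whose job agrees.\<close>

lemma sim_cong: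
  assumes "\<And>i. J i = J' i \<or> (\<forall>v. J i = Some v \<or> J' i = Some v \<longrightarrow> T < rtime (fst v))"
  shows "t \<le> T \<Longrightarrow> sim J t = sim J' t"
    and "J i = J' i \<Longrightarrow> sim J (Suc T) i = sim J' (Suc T) i"
proof -
  have mv: "move J t (sim J t) i = move J' t (sim J t) i" if t: "t \<le> T" and eq: "sim J t = sim J' t" and i: "J i = J' i" for t i
  proof -
    let ?S = "sim J t"
    have *: "J i = J' i" if "?S i = Some s" for i s
      using sim_Some[of J t i s] sim_Some[of J' t i s] that eq assms[of i] t by fastforce
    have "present J ?S x = present J' ?S x" for x
      using * by (fastforce simp: present_def)
    moreover have "up_want J t ?S = up_want J' t ?S"
      using * by (fastforce simp: up_want_def)
    ultimately have "go_up J t ?S x = go_up J' t ?S x" for x by (simp add: go_up_def)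
    then show ?thesis using i by (cases "J' i"; cases "sim J t i") (auto simp: move_def)
  qed
  show 1: "t \<le> T \<Longrightarrow> sim J t = sim J' t" for t
  proof (induction t)
    case 0
    show ?case
    proof
      fix i
      show "sim J 0 i = sim J' 0 i"
      proof (cases "J i = J' i")
        case True
        then show ?thesis by (simp add: inject_def)
      next
        case False
        then have "\<forall>v. J i = Some v \<or> J' i = Some v \<longrightarrow> T < rtime (fst v)" using assms by blast
        then have "sim J 0 i = None" "sim J' 0 i = None"
          using sim_Some[of J 0 i] sim_Some[of J' 0 i]
          by (metis le_zero_eq not_less_zero option.exhaust)+
        then show ?thesis by simp
      qed
    qed
  next
    case (Suc t)
    show ?case
    proof
      fix i
      show "sim J (Suc t) i = sim J' (Suc t) i"
      proof (cases "J i = J' i")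
        case True
        then show ?thesis using mv[of t i] Suc by (cases "J' i") (auto simp: inject_def)
      next
        case False
        then have "\<forall>v. J i = Some v \<or> J' i = Some v \<longrightarrow> T < rtime (fst v)" using assms by blast
        then have "sim J (Suc t) i = None" "sim J' (Suc t) i = None"
          using sim_Some[of J "Suc t" i] sim_Some[of J' "Suc t" i] Suc.prems
          by (metis not_less option.exhaust order_less_le_trans)+
        then show ?thesis by simp
      qed
    qed
  qed
  show "J i = J' i \<Longrightarrow> sim J (Suc T) i = sim J' (Suc T) i"
    using mv[of T i] 1[of T] by (cases "J' i") (auto simp: inject_def)
qed

end

text \<open>\<open>wh\<close> equates the capacities of the two sides of a cell, \<open>w\<close>
  vertical and \<open>h\<close> horizontal edges. \<open>J_tile\<close> keeps the visits to a tile
  strictly below this number, so that no cell can be blocked on its whole width or height;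
  \<open>J_up\<close> and \<open>J_right\<close> take care of the source cells.\<close>

locale routing = grid +
  fixes J :: "nat \<Rightarrow> job option"
  assumes w0: "0 < w" and h0: "0 < h" and wh: "w * B = h * c"
    and finJ: "finite {i. J i \<noteq> None}"
    and J_src: "\<And>i r \<delta> z. J i = Some (r, \<delta>, z) \<Longrightarrow> even (XC (src r)) \<and> even (YC (row_of n r))"
    and J_dst: "\<And>i r \<delta> z. J i = Some (r, \<delta>, z) \<Longrightarrow> src r + 2 * w \<le> dst r \<and> dst r < n"
    and J_mono: "\<And>i r \<delta> z I. J i = Some (r, \<delta>, z) \<Longrightarrow> TI (src r) \<le> I \<Longrightarrow> I < TI (dst r) \<Longrightarrow>
        enter (TI (src r)) (TJ (row_of n r)) z I \<le> z I"
    and J_up: "\<And>x Y. card {i. \<exists>r z. J i = Some (r, True, z) \<and> src r = x \<and> YC (row_of n r) = Y} \<le> B"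
    and J_right: "\<And>X d. card {i. \<exists>r z. J i = Some (r, False, z) \<and> XC (src r) = X \<and> row_of n r = d} \<le> c"
    and J_tile: "\<And>I K. card {i. \<exists>v. J i = Some v \<and> onpath v I K} < w * B"
begin

section \<open>Invariants of the switching rule\<close>

abbreviation "st \<equiv> sim J"
definition "pres t x = present J (st t) x"
definition "ups t x = go_up J t (st t) x"

lemma finite_pres [simp]: "finite (pres t x)"
  by (rule finite_subset[OF _ finJ]) (auto simp: pres_def present_def)

lemma TI_src_less: "J i = Some (r, \<delta>, z) \<Longrightarrow> TI (src r) < TI (dst r)"
  using J_dst TI_less[OF w0] by blast

text \<open>The last two conjuncts record that a packet moving in an unwanted direction has found the
  wanted one full ever since it entered its cell.\<close>

definition packet_inv :: "nat \<Rightarrow> nat \<Rightarrow> bool" where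
  "packet_inv t i \<longleftrightarrow> (\<forall>r \<delta>0 z x \<delta>. J i = Some (r, \<delta>0, z) \<longrightarrow> st t i = Some (x, \<delta>) \<longrightarrow>
     src r \<le> x \<and> x \<le> dst r \<and>
     onpath (r, \<delta>0, z) (TI x) (TJ (t + n - x)) \<and>
     (even (XC x) \<and> even (YC (t + n - x)) \<longrightarrow> XC x = XC (src r) \<and> YC (t + n - x) = YC (row_of n r) \<and>
          \<delta> = \<delta>0 \<and> (if \<delta> then x = src r else t + n - x = row_of n r)) \<and>
     (TI x = TI (dst r) \<longrightarrow> \<not> \<delta> \<and> odd (YC (t + n - x))) \<and>
     (\<not> \<delta> \<and> wants_up (r, \<delta>0, z) \<delta> x (t + n - x) \<longrightarrow>
        (\<forall>x'<x. XC x' = XC x \<longrightarrow> x \<le> x' + t \<and> card (ups (t + x' - x) x') = B)) \<and>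
     (\<delta> \<and> \<not> wants_up (r, \<delta>0, z) \<delta> x (t + n - x) \<longrightarrow>
        (\<forall>k. 0 < k \<longrightarrow> k \<le> t + n - x \<longrightarrow> YC (t + n - x - k) = YC (t + n - x) \<longrightarrow>
            k \<le> t \<and> card (pres (t - k) x - ups (t - k) x) = c)))"

text \<open>Bounds the arrivals at a node, split by their last direction. This is what
  \<open>up_choice_ex\<close> needs in order to keep the departures within capacity.\<close>

definition cap :: "nat \<Rightarrow> bool" where
  "cap t \<longleftrightarrow> (\<forall>x. card (pres t x \<inter> up_in (st t)) \<le> B \<and> card (pres t x - up_in (st t)) \<le> c)"

lemma ups_choice:
  assumes "cap t"
  shows "up_choice B c (pres t x) (up_in (st t)) (up_want J t (st t)) (ups t x)"
proof -
  have "\<exists>A. up_choice B c (pres t x) (up_in (st t)) (up_want J t (st t)) A"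
    using assms by (intro up_choice_ex) (auto simp: cap_def)
  from someI_ex[OF this] show ?thesis by (simp add: ups_def go_up_def pres_def)
qed

lemma ups_subset: "cap t \<Longrightarrow> ups t x \<subseteq> pres t x"
  using ups_choice[of t x] by (simp add: up_choice_def)

lemma pres_D:
  assumes "i \<in> pres t x"
  obtains r \<delta>0 z \<delta> where "J i = Some (r, \<delta>0, z)" "st t i = Some (x, \<delta>)" "x \<noteq> dst r" "rtime r \<le> t"
  using assms sim_Some[of J t i] by (fastforce simp: pres_def present_def)

lemma block_card:
  fixes k x s :: nat assumes "0 < k" "Suc x div k \<noteq> x div k"
  shows "card {y. y \<le> x \<and> y div k + s = x div k + s} = k"
proof -
  have e: "Suc x div k = Suc (x div k)" using assms by (metis div_Suc)
  have "{y. y \<le> x \<and> y div k + s = x div k + s} = {x div k * k..<x div k * k + k}"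
  proof (intro equalityI subsetI; clarsimp)
    fix y assume "y div k = x div k"
    then show "x div k * k \<le> y \<and> y < x div k * k + k"
      using assms(1) by (metis add.commute div_mult_mod_eq le_add1 mod_less_divisor nat_add_left_cancel_less)
  next
    fix y assume y: "x div k * k \<le> y" "y < x div k * k + k"
    then have "y div k = x div k" by (intro div_nat_eqI) (auto simp: mult.commute)
    moreover have "y \<le> x"
    proof (rule ccontr)
      assume "\<not> y \<le> x"
      then have "Suc x div k \<le> y div k" by (intro div_le_mono) simp
      then show False using e calculation by simp
    qed
    ultimately show "y \<le> x \<and> y div k = x div k" by simp
  qed
  then show ?thesis by simp
qed

text \<open>A packet that fails to turn throughout a cell passes w full vertical edges (or h full
  horizontal ones), which are used by pairwise different packets visiting the same tile: more than
  there are.\<close>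

lemma tile_visits:
  assumes packet_inv: "\<And>s i. s \<le> t \<Longrightarrow> packet_inv s i" and fin: "finite K"
    and K: "\<And>k. k \<in> K \<Longrightarrow> f k \<le> t \<and> A k \<subseteq> pres (f k) (g k) \<and> TI (g k) = I \<and> TJ (f k + n - g k) = L"
    and card: "\<And>k. k \<in> K \<Longrightarrow> card (A k) = b"
    and disj: "\<And>k l i. k \<in> K \<Longrightarrow> l \<in> K \<Longrightarrow> k \<noteq> l \<Longrightarrow> i \<in> A k \<Longrightarrow> i \<in> A l \<Longrightarrow> False"
  shows "card K * b < w * B"
proof -
  have "card K * b = (\<Sum>k\<in>K. card (A k))" using card by simp
  also have "\<dots> = card (\<Union>k\<in>K. A k)"
  proof (rule card_UN_disjoint[symmetric])
    show "\<forall>k\<in>K. finite (A k)" using K finite_subset[OF _ finite_pres] by meson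
    show "\<forall>k\<in>K. \<forall>l\<in>K. k \<noteq> l \<longrightarrow> A k \<inter> A l = {}" using disj by (auto simp: disjoint_iff)
  qed (rule fin)
  also have "\<dots> \<le> card {i. \<exists>v. J i = Some v \<and> onpath v I L}"
  proof (rule card_mono)
    show "finite {i. \<exists>v. J i = Some v \<and> onpath v I L}" by (rule finite_subset[OF _ finJ]) auto
    show "(\<Union>k\<in>K. A k) \<subseteq> {i. \<exists>v. J i = Some v \<and> onpath v I L}"
    proof
      fix i assume "i \<in> (\<Union>k\<in>K. A k)"
      then obtain k where k: "k \<in> K" "i \<in> pres (f k) (g k)" using K by blast
      then obtain r \<delta>0 z \<delta> where "J i = Some (r, \<delta>0, z)" "st (f k) i = Some (g k, \<delta>)"
        by (auto elim: pres_D)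
      then show "i \<in> {i. \<exists>v. J i = Some v \<and> onpath v I L}"
        using packet_inv[of "f k" i] K[OF k(1)] unfolding packet_inv_def by blast
    qed
  qed
  also have "\<dots> < w * B" by (rule J_tile)
  finally show ?thesis .
qed

text \<open>At time \<open>t + x' - x\<close> the packet was in column \<open>x'\<close> of its
  present row. A packet going up there is above this row at all later times, hence absent from the
  full sets of the columns further right.\<close>

lemma no_full_up:
  assumes packet_inv: "\<And>s i. s \<le> t \<Longrightarrow> packet_inv s i" and cp: "\<And>s. s \<le> t \<Longrightarrow> cap s"
    and xn: "x \<le> n" and bd: "XC (Suc x) \<noteq> XC x"
    and full: "\<And>x'. x' \<le> x \<Longrightarrow> XC x' = XC x \<Longrightarrow> x \<le> x' + t \<and> card (ups (t + x' - x) x') = B"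
  shows False
proof -
  let ?K = "{y. y \<le> x \<and> XC y = XC x}"
  have "card ?K * B < w * B"
  proof (rule tile_visits[OF packet_inv])
    fix y assume y: "y \<in> ?K"
    show "t + y - x \<le> t \<and> ups (t + y - x) y \<subseteq> pres (t + y - x) y \<and> TI y = TI x \<and> TJ (t + y - x + n - y) = TJ (t + n - x)"
      using y full[of y] xn cp[of "t + y - x"] by (auto simp: TI_def intro: ups_subset[THEN subsetD])
    show "card (ups (t + y - x) y) = B" using full y by blast
  next
    have dis: False if y: "y \<in> ?K" and y': "y' \<in> ?K" and l: "y < y'" and i: "i \<in> ups (t + y - x) y" "i \<in> ups (t + y' - x) y'" for y y' i
    proof -
      have le: "x \<le> y + t" "x \<le> y' + t" "y \<le> x" "y' \<le> x" using full y y' by auto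
      have "i \<in> pres (t + y - x) y" "i \<in> pres (t + y' - x) y'"
        using subsetD[OF ups_subset[OF cp] i(1)] subsetD[OF ups_subset[OF cp] i(2)] le by auto
      then obtain r \<delta>0 z \<delta> \<delta>' where v: "J i = Some (r, \<delta>0, z)" "st (t + y - x) i = Some (y, \<delta>)" "y \<noteq> dst r"
         "rtime r \<le> t + y - x" "st (t + y' - x) i = Some (y', \<delta>')" by (elim pres_D) auto
      then have "st (Suc (t + y - x)) i = Some (y, True)"
        using sim_Suc[of J i _ "t + y - x", OF v(1)] i(1) by (auto simp: ups_def)
      moreover have "Suc (t + y - x) \<le> t + y' - x" using l le by arith
      ultimately have "Suc (t + y - x) + y' \<le> t + y' - x + y" using sim_row_mono[OF _ v(5)] by blast
      then show False using l le by arith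
    qed
    show False if "y \<in> ?K" "y' \<in> ?K" "y \<noteq> y'" "i \<in> ups (t + y - x) y" "i \<in> ups (t + y' - x) y'" for y y' i
      using dis[of y y' i] dis[of y' y i] that by (metis nat_neq_iff)
  qed auto
  moreover have "card ?K = w" using block_card[OF w0, of x sx] bd by (simp add: XC_def)
  ultimately show False by simp
qed

text \<open>The mirror image within column \<open>x\<close>: a packet that left the column never
  returns, so the \<open>h\<close> full horizontal edges carry \<open>h * c = w * B\<close>
  different packets.\<close>

lemma no_full_right:
  assumes packet_inv: "\<And>s i. s \<le> t \<Longrightarrow> packet_inv s i" and cp: "\<And>s. s \<le> t \<Longrightarrow> cap s"
    and xn: "x \<le> n" and bd: "YC (Suc (t + n - x)) \<noteq> YC (t + n - x)"
    and full: "\<And>k. k \<le> t + n - x \<Longrightarrow> YC (t + n - x - k) = YC (t + n - x) \<Longrightarrow>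
        k \<le> t \<and> card (pres (t - k) x - ups (t - k) x) = c"
  shows False
proof -
  define d where "d = t + n - x"
  let ?K = "{y. y \<le> d \<and> YC y = YC d}"
  have K: "d - y \<le> t \<and> t - (d - y) + n - x = y \<and> card (pres (t - (d - y)) x - ups (t - (d - y)) x) = c" if "y \<in> ?K" for y
  proof -
    have "d - y \<le> t \<and> card (pres (t - (d - y)) x - ups (t - (d - y)) x) = c"
    proof -
      have "t + n - x - (d - y) = y" "d - y \<le> t + n - x" using that by (auto simp: d_def)
      moreover have "YC y = YC (t + n - x)" using that by (simp add: d_def)
      ultimately show ?thesis using full[of "d - y"] by simp
    qed
    then show ?thesis using that xn by (auto simp: d_def)
  qed
  have "card ?K * c < w * B"
  proof (rule tile_visits[OF packet_inv])
    fix y assume y: "y \<in> ?K"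
    show "t - (d - y) \<le> t \<and> pres (t - (d - y)) x - ups (t - (d - y)) x \<subseteq> pres (t - (d - y)) x \<and> TI x = TI x \<and> TJ (t - (d - y) + n - x) = TJ d"
      using K[OF y] y by (auto simp: TJ_def)
    show "card (pres (t - (d - y)) x - ups (t - (d - y)) x) = c" using K y by blast
  next
    have dis: False if y: "y \<in> ?K" and y': "y' \<in> ?K" and l: "y < y'"
      and i: "i \<in> pres (t - (d - y)) x - ups (t - (d - y)) x" "i \<in> pres (t - (d - y')) x - ups (t - (d - y')) x" for y y' i
    proof -
      let ?s = "t - (d - y)" and ?s' = "t - (d - y')"
      have "d - y \<le> t" "d - y' \<le> t" "y' \<le> d" using K[OF y] K[OF y'] y' by auto
      then have le: "?s < ?s'" using l by arith
      obtain r \<delta>0 z \<delta> \<delta>' where v: "J i = Some (r, \<delta>0, z)" "st ?s i = Some (x, \<delta>)" "x \<noteq> dst r"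
         "rtime r \<le> ?s" "st ?s' i = Some (x, \<delta>')" using i by (auto elim!: pres_D)
      then have "st (Suc ?s) i = Some (Suc x, False)"
        using sim_Suc[of J i _ ?s, OF v(1)] i(1) by (auto simp: ups_def)
      \<comment> \<open>Columns never decrease, so the packet stays at \<open>Suc x\<close> or
        beyond and its presence in column \<open>x\<close> at the later time is absurd.\<close>
      moreover have "st (Suc ?s) i = Some (x, True) \<or> x \<ge> Suc x" if "st ?s' i = Some (x, \<delta>')"
      proof -
        have "Suc x \<le> x'" if "st u i = Some (x', b)" "Suc ?s \<le> u" for u x' b
          using that(2,1)
        proof (induction u arbitrary: x' b rule: dec_induct)
          case base then show ?case using calculation by simp
        next
          case (step u)
          have "rtime (fst (r, \<delta>0, z)) \<noteq> Suc u" using step v(4) by simp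
          from sim_Suc[of J i _ u, OF v(1) this] step.prems obtain x0 \<delta>0 where
            "st u i = Some (x0, \<delta>0)" "x' = x0 \<or> x' = Suc x0" by (auto split: option.splits if_splits)
          then show ?case using step.IH[of x0 \<delta>0] by auto
        qed
        then show ?thesis using v(5) le by (meson Suc_leI)
      qed
      ultimately show False using v(5) by simp
    qed
    show False if "y \<in> ?K" "y' \<in> ?K" "y \<noteq> y'" "i \<in> pres (t - (d - y)) x - ups (t - (d - y)) x" "i \<in> pres (t - (d - y')) x - ups (t - (d - y')) x" for y y' i
      using dis[of y y' i] dis[of y' y i] that by (metis nat_neq_iff)
  qed auto
  moreover have "card ?K = h" using block_card[OF h0, of d sd] bd by (simp add: YC_def d_def)
  ultimately show False using wh by simp
qed

end

context grid
begin

lemma XC_mono: "x \<le> y \<Longrightarrow> XC x \<le> XC y" by (simp add: XC_def div_le_mono)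
lemma YC_mono: "x \<le> y \<Longrightarrow> YC x \<le> YC y" by (simp add: YC_def div_le_mono)
lemma TI_mono: "x \<le> y \<Longrightarrow> TI x \<le> TI y" by (simp add: TI_def div_le_mono XC_mono)
lemma TJ_mono: "x \<le> y \<Longrightarrow> TJ x \<le> TJ y" by (simp add: TJ_def div_le_mono YC_mono)

lemma XC_Suc: "XC (Suc x) = XC x \<or> XC (Suc x) = Suc (XC x)"
  by (simp add: XC_def div_Suc)

lemma YC_Suc: "YC (Suc x) = YC x \<or> YC (Suc x) = Suc (YC x)"
  by (simp add: YC_def div_Suc)

text \<open>Outside source cells the wish depends on the cell alone. It is therefore constant while
  a packet stays in a cell, and the record of full edges can be continued.\<close>

lemma wants_up_cong:
  "\<not> (even (XC x) \<and> even (YC d)) \<Longrightarrow> XC x' = XC x \<Longrightarrow> YC d' = YC d \<Longrightarrow>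
   wants_up v \<delta> x d = wants_up v \<delta>' x' d'"
  by (cases v) (auto simp: TI_def TJ_def)

end

section \<open>Preservation of the packet invariant and of the capacities\<close>

context routing
begin

lemma turn:
  assumes "cap t" "J i = Some v" "st t i = Some (x, \<delta>)" "x \<noteq> dst (fst v)"
  shows "\<delta> \<Longrightarrow> wants_up v \<delta> x (t + n - x) \<Longrightarrow> i \<in> ups t x"
    and "i \<in> ups t x \<Longrightarrow> \<delta> \<or> wants_up v \<delta> x (t + n - x)"
    and "i \<notin> ups t x \<Longrightarrow> wants_up v \<delta> x (t + n - x) \<Longrightarrow> card (ups t x) = B"
    and "i \<in> ups t x \<Longrightarrow> \<not> wants_up v \<delta> x (t + n - x) \<Longrightarrow> card (pres t x - ups t x) = c"
proof -
  have i: "i \<in> pres t x" "i \<in> up_in (st t) \<longleftrightarrow> \<delta>" "i \<in> up_want J t (st t) \<longleftrightarrow> wants_up v \<delta> x (t + n - x)"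
    using assms by (auto simp: pres_def present_def up_in_def up_want_def simp del: split_paired_Ex)
  note u = ups_choice[OF assms(1), of x, unfolded up_choice_def]
  show "\<delta> \<Longrightarrow> wants_up v \<delta> x (t + n - x) \<Longrightarrow> i \<in> ups t x"
    "i \<in> ups t x \<Longrightarrow> \<delta> \<or> wants_up v \<delta> x (t + n - x)"
    "i \<notin> ups t x \<Longrightarrow> wants_up v \<delta> x (t + n - x) \<Longrightarrow> card (ups t x) = B"
    "i \<in> ups t x \<Longrightarrow> \<not> wants_up v \<delta> x (t + n - x) \<Longrightarrow> card (pres t x - ups t x) = c"
    using u i by blast+
qed

lemma step_cases:
  assumes "J i = Some v" "rtime (fst v) \<noteq> Suc t" "st (Suc t) i = Some (x', \<delta>')"
  obtains x \<delta> where "st t i = Some (x, \<delta>)" "x \<noteq> dst (fst v)" "i \<in> pres t x"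
    "i \<in> ups t x \<and> x' = x \<and> \<delta>' \<or> i \<notin> ups t x \<and> x' = Suc x \<and> \<not> \<delta>'"
proof -
  note eq = sim_Suc[of J i v t, OF assms(1,2), unfolded assms(3)]
  obtain x \<delta> where s: "st t i = Some (x, \<delta>)" using eq by (cases "st t i") auto
  have x: "x \<noteq> dst (fst v)" using eq s by auto
  have "i \<in> pres t x" using assms(1) s x by (auto simp: pres_def present_def simp del: split_paired_Ex)
  moreover have "i \<in> ups t x \<and> x' = x \<and> \<delta>' \<or> i \<notin> ups t x \<and> x' = Suc x \<and> \<not> \<delta>'"
    using eq s x by (cases "i \<in> ups t x") (simp_all add: ups_def)
  ultimately show thesis using that s x by blast
qed

lemma packet_invI:
  assumes "J i = Some (r, \<delta>0, z)" "st t i = Some (x, \<delta>)" and d: "d = t + n - x"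
    and "src r \<le> x" "x \<le> dst r" "onpath (r, \<delta>0, z) (TI x) (TJ d)"
    and "even (XC x) \<and> even (YC d) \<longrightarrow> XC x = XC (src r) \<and> YC d = YC (row_of n r) \<and>
          \<delta> = \<delta>0 \<and> (if \<delta> then x = src r else d = row_of n r)"
    and "TI x = TI (dst r) \<longrightarrow> \<not> \<delta> \<and> odd (YC d)"
    and "\<not> \<delta> \<and> wants_up (r, \<delta>0, z) \<delta> x d \<longrightarrow>
        (\<forall>x'<x. XC x' = XC x \<longrightarrow> x \<le> x' + t \<and> card (ups (t + x' - x) x') = B)"
    and "\<delta> \<and> \<not> wants_up (r, \<delta>0, z) \<delta> x d \<longrightarrow>
        (\<forall>k. 0 < k \<longrightarrow> k \<le> d \<longrightarrow> YC (d - k) = YC d \<longrightarrow>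
            k \<le> t \<and> card (pres (t - k) x - ups (t - k) x) = c)"
  shows "packet_inv t i"
  using assms(4-) unfolding packet_inv_def d assms(1,2) option.inject prod.inject by blast

text \<open>The fictitious direction agrees with the wish in the source cell, so the two clauses
  about full edges hold vacuously.\<close>

lemma packet_inv_start:
  assumes J: "J i = Some (r, \<delta>0, z)" and t: "rtime r = t"
  shows "packet_inv t i"
proof -
  have s: "st t i = Some (src r, \<delta>0)" using sim_start[of J i, OF J] t by simp
  have "TI (src r) < TI (dst r)" by (rule TI_src_less[OF J])
  moreover from this have "enter (TI (src r)) (TJ (row_of n r)) z (TI (src r)) \<le> z (TI (src r))"
    using J_mono[OF J] by blast
  moreover have "t + n - src r = row_of n r" using t by (simp add: row_of_def)
  ultimately show ?thesis
    using s J J_src[OF J] J_dst[OF J] by (auto simp: packet_inv_def enter_def)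
qed

text \<open>Inside a cell the step only adds the current edge to the record of full edges. At the
  top side an unwanted step would complete the record, which \<open>no_full_right\<close> excludes;
  so a cell is left upwards only on purpose.\<close>

lemma packet_inv_up:
  assumes packet_inv: "\<And>s i. s \<le> t \<Longrightarrow> packet_inv s i" and cp: "\<And>s. s \<le> t \<Longrightarrow> cap s"
    and J: "J i = Some (r, \<delta>0, z)" and s: "st t i = Some (x, \<delta>)" "x \<noteq> dst r" and up: "i \<in> ups t x"
    and s': "st (Suc t) i = Some (x, True)"
  shows "packet_inv (Suc t) i"
proof -
  define d where "d = t + n - x"
  have I: "src r \<le> x" "x \<le> dst r" "onpath (r, \<delta>0, z) (TI x) (TJ d)"
     "even (XC x) \<Longrightarrow> even (YC d) \<Longrightarrow> XC x = XC (src r) \<and> YC d = YC (row_of n r) \<and>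
          \<delta> = \<delta>0 \<and> (if \<delta> then x = src r else d = row_of n r)"
     "TI x = TI (dst r) \<Longrightarrow> \<not> \<delta> \<and> odd (YC d)"
     "\<And>k. \<delta> \<Longrightarrow> \<not> wants_up (r, \<delta>0, z) \<delta> x d \<Longrightarrow> 0 < k \<Longrightarrow> k \<le> d \<Longrightarrow> YC (d - k) = YC d \<Longrightarrow>
            k \<le> t \<and> card (pres (t - k) x - ups (t - k) x) = c"
    using packet_inv[of t i] J s unfolding packet_inv_def d_def by blast+
  note T = turn[OF cp[OF order_refl] J s(1), folded d_def, simplified fst_conv, OF s(2)]
  have xn: "x \<le> n" using I(2) J_dst[OF J] by simp
  have d': "Suc t + n - x = Suc d" using xn by (simp add: d_def)
  have noTop: "TI x \<noteq> TI (dst r)" using I(5) T(2) up by (auto split: if_splits)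
  have sw: "even (XC x) \<Longrightarrow> even (YC d) \<Longrightarrow> \<delta> \<and> wants_up (r, \<delta>0, z) \<delta> x d" using T(2)[OF up] by auto
  \<comment> \<open>The invariant covers \<open>0 < k\<close>; the edge that is full in the current
    step supplies \<open>k = 0\<close>, as \<open>no_full_right\<close> requires.\<close>
  have turned: "k \<le> t \<and> card (pres (t - k) x - ups (t - k) x) = c"
    if "\<not> wants_up (r, \<delta>0, z) \<delta> x d" "k \<le> d" "YC (d - k) = YC d" for k
  proof (cases "k = 0")
    case True
    then show ?thesis using T(4)[OF up that(1)] by simp
  next
    case False
    have \<delta> using T(2)[OF up] that(1) by blast
    from I(6)[OF this that(1) _ that(2,3)] False show ?thesis by simp
  qed
  have *: "onpath (r, \<delta>0, z) (TI x) (TJ (Suc d)) \<and>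
     (even (XC x) \<and> even (YC (Suc d)) \<longrightarrow> XC x = XC (src r) \<and> YC (Suc d) = YC (row_of n r) \<and> \<delta>0 \<and> x = src r) \<and>
     (\<not> wants_up (r, \<delta>0, z) True x (Suc d) \<longrightarrow>
        (\<forall>k. 0 < k \<longrightarrow> k \<le> Suc d \<longrightarrow> YC (Suc d - k) = YC (Suc d) \<longrightarrow>
            k \<le> Suc t \<and> card (pres (Suc t - k) x - ups (Suc t - k) x) = c))"
  proof (cases "YC (Suc d) = YC d")
    case True
    have "k \<le> Suc t \<and> card (pres (Suc t - k) x - ups (Suc t - k) x) = c"
      if nw: "\<not> wants_up (r, \<delta>0, z) True x (Suc d)" and k: "0 < k" "k \<le> Suc d" "YC (Suc d - k) = YC (Suc d)" for k
    proof -
      have "\<not> wants_up (r, \<delta>0, z) \<delta> x d"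
        using nw wants_up_cong[of x d x "Suc d" "(r, \<delta>0, z)" \<delta> True] True by auto
      moreover obtain k' where "k = Suc k'" using k(1) by (cases k) auto
      ultimately show ?thesis using turned[of k'] k True by auto
    qed
    then show ?thesis using True I(3,4) sw by (auto simp: TJ_def)
  next
    case False
    then have Y: "YC (Suc d) = Suc (YC d)" using YC_Suc by blast
    have w: "wants_up (r, \<delta>0, z) \<delta> x d"
    proof (rule ccontr)
      assume "\<not> wants_up (r, \<delta>0, z) \<delta> x d"
      note nw = this
      show False
      proof (rule no_full_right[of t x])
        show "packet_inv s i" if "s \<le> t" for s i using packet_inv[OF that] .
        show "cap s" if "s \<le> t" for s using cp[OF that] .
        show "x \<le> n" by (rule xn)
        show "YC (Suc (t + n - x)) \<noteq> YC (t + n - x)" using False unfolding d_def .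
        show "k \<le> t \<and> card (pres (t - k) x - ups (t - k) x) = c"
          if "k \<le> t + n - x" "YC (t + n - x - k) = YC (t + n - x)" for k
          using turned[OF nw, unfolded d_def, OF that] .
      qed
    qed
    \<comment> \<open>The packet stands in the lowest row of the new cell, so the record for this
      cell starts empty.\<close>
    have "YC (Suc d - k) \<noteq> YC (Suc d)" if "0 < k" for k
    proof -
      have "Suc d - k \<le> d" using that by simp
      then show ?thesis using YC_mono[of "Suc d - k" d] Y by simp
    qed
    moreover have "onpath (r, \<delta>0, z) (TI x) (TJ (Suc d))"
    proof (cases "even (YC d)")
      case True
      then have "TJ (Suc d) = TJ d" using Y by (simp add: TJ_def)
      then show ?thesis using I(3) by simp
    next
      case False
      then have "TJ (Suc d) = Suc (TJ d)" using Y by (simp add: TJ_def)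
      then show ?thesis using I(3) noTop w False by (auto split: if_splits)
    qed
    \<comment> \<open>In an even cell column up is wanted only in an even cell row, so no packet
      climbs into a source cell.\<close>
    moreover have "\<not> (even (XC x) \<and> even (YC (Suc d)))" using w Y by auto
    ultimately show ?thesis by blast
  qed
  show ?thesis
    by (rule packet_invI[OF J s' d'[symmetric] I(1,2)])
      (use * noTop in \<open>simp_all del: wants_up.simps onpath.simps\<close>)
qed

text \<open>Mirrors the vertical step with \<open>no_full_up\<close>; in addition, entering a new
  tile column has to agree with the tile path.\<close>

lemma packet_inv_right:
  assumes packet_inv: "\<And>s i. s \<le> t \<Longrightarrow> packet_inv s i" and cp: "\<And>s. s \<le> t \<Longrightarrow> cap s"
    and J: "J i = Some (r, \<delta>0, z)" and s: "st t i = Some (x, \<delta>)" "x \<noteq> dst r" and up: "i \<notin> ups t x"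
    and s': "st (Suc t) i = Some (Suc x, False)"
  shows "packet_inv (Suc t) i"
proof -
  define d where "d = t + n - x"
  have I: "src r \<le> x" "x \<le> dst r" "onpath (r, \<delta>0, z) (TI x) (TJ d)"
     "even (XC x) \<Longrightarrow> even (YC d) \<Longrightarrow> XC x = XC (src r) \<and> YC d = YC (row_of n r) \<and>
          \<delta> = \<delta>0 \<and> (if \<delta> then x = src r else d = row_of n r)"
     "TI x = TI (dst r) \<Longrightarrow> \<not> \<delta> \<and> odd (YC d)"
     "\<And>x'. \<not> \<delta> \<Longrightarrow> wants_up (r, \<delta>0, z) \<delta> x d \<Longrightarrow> x' < x \<Longrightarrow> XC x' = XC x \<Longrightarrow>
            x \<le> x' + t \<and> card (ups (t + x' - x) x') = B"
    using packet_inv[of t i] J s unfolding packet_inv_def d_def by blast+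
  note T = turn[OF cp[OF order_refl] J s(1), folded d_def, simplified fst_conv, OF s(2)]
  have xn: "x \<le> n" "Suc x \<le> dst r" using I(2) J_dst[OF J] s(2) by simp_all
  have d': "Suc t + n - Suc x = d" by (simp add: d_def)
  have le: "TI (Suc x) \<le> TI (dst r)" "TI (src r) \<le> TI x" using xn(2) I(1) by (simp_all add: TI_mono)
  have sw: "even (XC x) \<Longrightarrow> even (YC d) \<Longrightarrow> \<not> \<delta> \<and> \<not> wants_up (r, \<delta>0, z) \<delta> x d" using T(1) up by auto
  have turned: "x \<le> x' + t \<and> card (ups (t + x' - x) x') = B"
    if "wants_up (r, \<delta>0, z) \<delta> x d" "x' \<le> x" "XC x' = XC x" for x'
  proof (cases "x' = x")
    case True
    then show ?thesis using T(3)[OF up that(1)] by simp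
  next
    case False
    have "\<not> \<delta>"
    proof
      assume \<delta>
      then have "\<delta> = True" by simp
      then show False using T(1) that(1) up by blast
    qed
    from I(6)[OF this that(1) _ that(3)] False that(2) show ?thesis by simp
  qed
  have *: "onpath (r, \<delta>0, z) (TI (Suc x)) (TJ d) \<and>
     (even (XC (Suc x)) \<and> even (YC d) \<longrightarrow> XC (Suc x) = XC (src r) \<and> YC d = YC (row_of n r) \<and> \<not> \<delta>0 \<and> d = row_of n r) \<and>
     (TI (Suc x) = TI (dst r) \<longrightarrow> odd (YC d)) \<and>
     (wants_up (r, \<delta>0, z) False (Suc x) d \<longrightarrow>
        (\<forall>x'<Suc x. XC x' = XC (Suc x) \<longrightarrow> Suc x \<le> x' + Suc t \<and> card (ups (Suc t + x' - Suc x) x') = B))"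
  proof (cases "XC (Suc x) = XC x")
    case True
    have "Suc x \<le> x' + Suc t \<and> card (ups (Suc t + x' - Suc x) x') = B"
      if nw: "wants_up (r, \<delta>0, z) False (Suc x) d" and k: "x' < Suc x" "XC x' = XC (Suc x)" for x'
    proof -
      have "wants_up (r, \<delta>0, z) \<delta> x d"
        using nw wants_up_cong[of x d "Suc x" d "(r, \<delta>0, z)" \<delta> False] True by auto
      then show ?thesis using turned[of x'] k True by auto
    qed
    moreover have "TI (Suc x) = TI x" using True by (simp add: TI_def)
    ultimately show ?thesis using True I(3,4,5) sw by auto
  next
    case False
    then have X: "XC (Suc x) = Suc (XC x)" using XC_Suc by blast
    have w: "\<not> wants_up (r, \<delta>0, z) \<delta> x d"
    proof
      assume "wants_up (r, \<delta>0, z) \<delta> x d"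
      note nw = this
      show False
      proof (rule no_full_up[of t x])
        show "packet_inv s i" if "s \<le> t" for s i using packet_inv[OF that] .
        show "cap s" if "s \<le> t" for s using cp[OF that] .
        show "x \<le> x' + t \<and> card (ups (t + x' - x) x') = B" if "x' \<le> x" "XC x' = XC x" for x'
          using turned[OF nw that] .
      qed (use xn False in auto)
    qed
    have "XC x' \<noteq> XC (Suc x)" if "x' < Suc x" for x'
      using XC_mono[of x' x] that X by simp
    moreover have "onpath (r, \<delta>0, z) (TI (Suc x)) (TJ d) \<and> (TI (Suc x) = TI (dst r) \<longrightarrow> odd (YC d))"
    proof (cases "even (XC x)")
      case True
      then have "TI (Suc x) = TI x" using X by (simp add: TI_def)
      then show ?thesis using I(3,5) by auto
    next
      case False
      then have TI: "TI (Suc x) = Suc (TI x)" using X by (simp add: TI_def)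
      then have "TI x < TI (dst r)" using le by simp
      \<comment> \<open>In an upper right cell before the last tile column, not wanting up means
        that the tile row \<open>z (TI x)\<close> is reached; \<open>onpath\<close> excludes having
        passed it.\<close>
      then have z: "TJ d = z (TI x)" using I(3) w False by (auto split: if_splits)
      show ?thesis
      proof (cases "Suc (TI x) < TI (dst r)")
        case True
        then show ?thesis
          using J_mono[OF J, of "Suc (TI x)"] TI z le by (auto simp: enter_def)
      next
        case F: False
        then have "Suc (TI x) = TI (dst r)" using TI le by simp
        moreover from this have "TI (dst r) - 1 = TI x" by simp
        ultimately show ?thesis using TI z w False by auto
      qed
    qed
    moreover have "\<not> (even (XC (Suc x)) \<and> even (YC d))" using w X by auto
    ultimately show ?thesis by blast
  qed
  show ?thesis
    by (rule packet_invI[OF J s' d'[symmetric] le_SucI[OF I(1)] xn(2)])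
      (use * in \<open>simp_all del: wants_up.simps onpath.simps\<close>)
qed

lemma packet_inv_step:
  assumes packet_inv: "\<And>s i. s \<le> t \<Longrightarrow> packet_inv s i" and cp: "\<And>s. s \<le> t \<Longrightarrow> cap s"
  shows "packet_inv (Suc t) i"
proof (cases "J i = None \<or> st (Suc t) i = None")
  case True
  then show ?thesis by (auto simp: packet_inv_def)
next
  case False
  then obtain r \<delta>0 z x' \<delta>' where J: "J i = Some (r, \<delta>0, z)" and s': "st (Suc t) i = Some (x', \<delta>')"
    by auto
  show ?thesis
  proof (cases "rtime r = Suc t")
    case True
    then show ?thesis by (rule packet_inv_start[OF J])
  next
    case F: False
    then have nt: "rtime (fst (r, \<delta>0, z)) \<noteq> Suc t" by simp
    show ?thesis
    proof (rule step_cases[OF J nt s'])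
      fix x \<delta> assume "st t i = Some (x, \<delta>)" "x \<noteq> dst (fst (r, \<delta>0, z))"
        "i \<in> ups t x \<and> x' = x \<and> \<delta>' \<or> i \<notin> ups t x \<and> x' = Suc x \<and> \<not> \<delta>'"
      then show ?thesis
        using packet_inv_up[of t i r \<delta>0 z x \<delta>, OF packet_inv cp J] packet_inv_right[of t i r \<delta>0 z x \<delta>, OF packet_inv cp J] s' by auto
    qed
  qed
qed

text \<open>Packets in a source cell still move straight along the line on which they started, and
  through traffic does not occur there. So the admission bounds \<open>J_up\<close> and
  \<open>J_right\<close> are capacity bounds.\<close>

lemma cap_SW:
  assumes packet_inv: "\<And>i. packet_inv t i" and e: "even (XC x)" "even (YC (t + n - x))"
  shows "card (pres t x \<inter> up_in (st t)) \<le> B" "card (pres t x - up_in (st t)) \<le> c"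
proof -
  have *: "XC x = XC (src r) \<and> YC (t + n - x) = YC (row_of n r) \<and>
          \<delta> = \<delta>0 \<and> (if \<delta> then x = src r else t + n - x = row_of n r)"
    if "J i = Some (r, \<delta>0, z)" "st t i = Some (x, \<delta>)" for i r \<delta>0 z \<delta>
    using packet_inv[of i] that e unfolding packet_inv_def by blast
  have "card (pres t x \<inter> up_in (st t)) \<le> card {i. \<exists>r z. J i = Some (r, True, z) \<and> src r = x \<and> YC (row_of n r) = YC (t + n - x)}"
  proof (rule card_mono)
    show "finite {i. \<exists>r z. J i = Some (r, True, z) \<and> src r = x \<and> YC (row_of n r) = YC (t + n - x)}"
      by (rule finite_subset[OF _ finJ]) auto
    show "pres t x \<inter> up_in (st t) \<subseteq> {i. \<exists>r z. J i = Some (r, True, z) \<and> src r = x \<and> YC (row_of n r) = YC (t + n - x)}"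
    proof
      fix i assume "i \<in> pres t x \<inter> up_in (st t)"
      then obtain r \<delta>0 z where "J i = Some (r, \<delta>0, z)" "st t i = Some (x, True)"
        by (auto simp: up_in_def elim!: pres_D)
      then show "i \<in> {i. \<exists>r z. J i = Some (r, True, z) \<and> src r = x \<and> YC (row_of n r) = YC (t + n - x)}"
        using *[of i r \<delta>0 z True] by (auto simp del: split_paired_Ex)
    qed
  qed
  then show "card (pres t x \<inter> up_in (st t)) \<le> B" using J_up le_trans by blast
  have "card (pres t x - up_in (st t)) \<le> card {i. \<exists>r z. J i = Some (r, False, z) \<and> XC (src r) = XC x \<and> row_of n r = t + n - x}"
  proof (rule card_mono)
    show "finite {i. \<exists>r z. J i = Some (r, False, z) \<and> XC (src r) = XC x \<and> row_of n r = t + n - x}"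
      by (rule finite_subset[OF _ finJ]) auto
    show "pres t x - up_in (st t) \<subseteq> {i. \<exists>r z. J i = Some (r, False, z) \<and> XC (src r) = XC x \<and> row_of n r = t + n - x}"
    proof
      fix i assume i: "i \<in> pres t x - up_in (st t)"
      then obtain r \<delta>0 z \<delta> where v: "J i = Some (r, \<delta>0, z)" "st t i = Some (x, \<delta>)"
        by (auto elim!: pres_D)
      then have "\<not> \<delta>" using i by (auto simp: up_in_def)
      then show "i \<in> {i. \<exists>r z. J i = Some (r, False, z) \<and> XC (src r) = XC x \<and> row_of n r = t + n - x}"
        using *[OF v] v by (auto simp del: split_paired_Ex)
    qed
  qed
  then show "card (pres t x - up_in (st t)) \<le> c" using J_right le_trans by blast
qed

lemma cap_0:
  assumes packet_inv: "\<And>i. packet_inv 0 i"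
  shows "cap 0"
  unfolding cap_def
proof
  fix x
  show "card (pres 0 x \<inter> up_in (st 0)) \<le> B \<and> card (pres 0 x - up_in (st 0)) \<le> c"
  proof (cases "even (XC x) \<and> even (YC (0 + n - x))")
    case True then show ?thesis using cap_SW[of 0 x, OF packet_inv] by blast
  next
    case False
    have "pres 0 x = {}"
    proof (rule ccontr)
      assume "pres 0 x \<noteq> {}"
      then obtain i r \<delta>0 z \<delta> where v: "J i = Some (r, \<delta>0, z)" "st 0 i = Some (x, \<delta>)" "rtime r \<le> 0"
        by (auto elim!: pres_D)
      then have "x = src r" using sim_start[of J i, OF v(1)] by simp
      then show False using J_src[OF v(1)] v(3) False by (simp add: row_of_def)
    qed
    then show ?thesis by simp
  qed
qed

text \<open>Outside source cells nothing is injected: the arrivals are departures of the previous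
  step, which the switching rule keeps within capacity.\<close>

lemma cap_step:
  assumes packet_inv: "\<And>i. packet_inv (Suc t) i" and cp: "cap t"
  shows "cap (Suc t)"
  unfolding cap_def
proof
  fix x
  show "card (pres (Suc t) x \<inter> up_in (st (Suc t))) \<le> B \<and> card (pres (Suc t) x - up_in (st (Suc t))) \<le> c"
  proof (cases "even (XC x) \<and> even (YC (Suc t + n - x))")
    case True then show ?thesis using cap_SW[of "Suc t" x, OF packet_inv] by blast
  next
    case False
    have *: "\<exists>x0. i \<in> pres t x0 \<and> (i \<in> ups t x0 \<and> x = x0 \<and> \<delta> \<or> i \<notin> ups t x0 \<and> x = Suc x0 \<and> \<not> \<delta>)"
      if v: "J i = Some v" "st (Suc t) i = Some (x, \<delta>)" for i v \<delta>
    proof -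
      obtain r \<delta>0 z where vv: "v = (r, \<delta>0, z)" by (cases v) auto
      have "rtime (fst v) \<noteq> Suc t"
      proof
        assume r: "rtime (fst v) = Suc t"
        then have "x = src r" using sim_start[of J i, OF v(1)] v(2) vv by simp
        then show False using J_src[of i r \<delta>0 z] v(1) r vv False by (simp add: row_of_def)
      qed
      then obtain x0 \<delta>1 where "i \<in> pres t x0" "i \<in> ups t x0 \<and> x = x0 \<and> \<delta> \<or> i \<notin> ups t x0 \<and> x = Suc x0 \<and> \<not> \<delta>"
        by (rule step_cases[OF v(1) _ v(2)])
      then show ?thesis by (intro exI[of _ x0]) simp
    qed
    have "pres (Suc t) x \<inter> up_in (st (Suc t)) \<subseteq> ups t x"
    proof
      fix i assume "i \<in> pres (Suc t) x \<inter> up_in (st (Suc t))"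
      then obtain r \<delta>0 z where "J i = Some (r, \<delta>0, z)" "st (Suc t) i = Some (x, True)"
        by (auto simp: up_in_def elim!: pres_D simp del: sim.simps)
      then show "i \<in> ups t x" using * by blast
    qed
    moreover have "finite (ups t x)" using ups_subset[OF cp] finite_pres finite_subset by blast
    moreover have u: "card (ups t x) \<le> B" for x using ups_choice[OF cp, of x] by (simp add: up_choice_def)
    ultimately have 1: "card (pres (Suc t) x \<inter> up_in (st (Suc t))) \<le> B" by (meson card_mono le_trans)
    have "pres (Suc t) x - up_in (st (Suc t)) \<subseteq> (if x = 0 then {} else pres t (x - 1) - ups t (x - 1))"
    proof
      fix i assume i: "i \<in> pres (Suc t) x - up_in (st (Suc t))"
      then obtain r \<delta>0 z \<delta> where v: "J i = Some (r, \<delta>0, z)" "st (Suc t) i = Some (x, \<delta>)"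
        by (auto elim!: pres_D simp del: sim.simps)
      then have "\<not> \<delta>" using i by (auto simp: up_in_def simp del: sim.simps)
      then show "i \<in> (if x = 0 then {} else pres t (x - 1) - ups t (x - 1))" using *[OF v] by auto
    qed
    moreover have "card (if x = 0 then {} else pres t (x - 1) - ups t (x - 1)) \<le> c"
      using ups_choice[OF cp, of "x - 1"] by (simp add: up_choice_def)
    moreover have "finite (if x = 0 then {} else pres t (x - 1) - ups t (x - 1))" by simp
    ultimately have "card (pres (Suc t) x - up_in (st (Suc t))) \<le> c" by (meson card_mono le_trans)
    then show ?thesis using 1 by blast
  qed
qed

text \<open>The induction has to be joint: turning relies on the capacities of all earlier steps,
  and the capacities in source cells rely on the invariant of the same step.\<close>

lemma packet_inv_cap: "(\<forall>s\<le>t. \<forall>i. packet_inv s i) \<and> (\<forall>s\<le>t. cap s)"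
proof (induction t)
  case 0
  have "packet_inv 0 i" for i
  proof (cases "J i = None \<or> st 0 i = None")
    case False
    then obtain r \<delta>0 z where J: "J i = Some (r, \<delta>0, z)" by auto
    with False have "rtime r = 0" using sim_Some[of J 0 i] by auto
    then show ?thesis by (rule packet_inv_start[OF J])
  qed (auto simp: packet_inv_def)
  then show ?case using cap_0 by simp
next
  case (Suc t)
  then have "packet_inv (Suc t) i" for i using packet_inv_step by blast
  moreover from this have "cap (Suc t)" using cap_step Suc by blast
  ultimately show ?case using Suc by (auto simp: le_Suc_eq)
qed

lemma packet_inv: "packet_inv t i" and cap: "cap t" using packet_inv_cap by blast+

text \<open>A packet vanishes only at its destination. Until then its column is bounded by the
  destination and its row by the highest tile row of its path, and time is row plus column up to a
  constant.\<close>

lemma reaches_dst: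
  assumes J: "J i = Some (r, \<delta>0, z)"
  shows "\<exists>t \<delta>. st t i = Some (dst r, \<delta>)"
proof (rule ccontr)
  assume no: "\<not> ?thesis"
  have alive: "\<exists>x \<delta>. st t i = Some (x, \<delta>)" if "rtime r \<le> t" for t
    using that
  proof (induction t rule: dec_induct)
    case base show ?case using sim_start[of J i, OF J] by auto
  next
    case (step t)
    then obtain x \<delta> where s: "st t i = Some (x, \<delta>)" by blast
    then have "x \<noteq> dst r" using no by blast
    then show ?case using s sim_Suc[of J i _ t, OF J] step by (auto simp del: sim.simps)
  qed
  define Z where "Z = Max (z ` {..TI (dst r)})"
  have Z: "z I \<le> Z" if "I \<le> TI (dst r)" for I
    unfolding Z_def using that by (intro Max_ge) auto
  \<comment> \<open>Tile rows up to \<open>Z\<close> lie below row \<open>h * (2 * Z + 2)\<close>,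
    while the row at time \<open>t\<close> is at least \<open>t\<close>.\<close>
  define t where "t = rtime r + h * (2 * Z + 2)"
  obtain x \<delta> where s: "st t i = Some (x, \<delta>)" using alive[of t] by (auto simp: t_def)
  have "x \<le> dst r" "onpath (r, \<delta>0, z) (TI x) (TJ (t + n - x))"
    using packet_inv[of t i] J s unfolding packet_inv_def by blast+
  then have "TJ (t + n - x) \<le> Z"
    using Z[of "TI x"] Z[of "TI (dst r) - 1"] by auto
  then have "YC (t + n - x) \<le> 2 * Z + 1" by (simp add: TJ_def)
  then have "(t + n - x) div h < 2 * Z + 2" by (simp add: YC_def)
  then have "t + n - x < (2 * Z + 2) * h" using h0 by (simp only: div_less_iff_less_mult)
  moreover have "t \<le> t + n - x" using \<open>x \<le> dst r\<close> J_dst[OF J] by linarith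
  ultimately show False by (simp add: t_def mult.commute)
qed

end

section \<open>The simulation as a feasible nonpreemptive run\<close>

definition (in grid) far_run :: "(nat \<Rightarrow> job option) \<Rightarrow> request list \<Rightarrow> run" where
  "far_run J \<sigma> i t = (if t < rtime (\<sigma> ! i) then None else if t = rtime (\<sigma> ! i) then Some (src (\<sigma> ! i))
     else map_option fst (sim J t i))"

lemma (in grid) sim_None: "J i = None \<Longrightarrow> sim J t i = None"
  using sim_Some[of J t i] by (cases "sim J t i") auto

locale routing_input = routing +
  fixes \<sigma> :: "request list"
  assumes J_input: "\<And>i v. J i = Some v \<Longrightarrow> fst v = \<sigma> ! i"
begin

lemma far_run_job: "J i = Some v \<Longrightarrow> rtime (\<sigma> ! i) \<le> t \<Longrightarrow> far_run J \<sigma> i t = map_option fst (st t i)"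
  using sim_start[of J i v] J_input[of i v] by (auto simp: far_run_def)

lemma far_run_Suc:
  assumes "far_run J \<sigma> i t = Some x" "far_run J \<sigma> i (Suc t) = Some x'" "x \<noteq> dst (\<sigma> ! i)"
  shows "i \<in> pres t x \<and> (if i \<in> ups t x then x' = x else x' = Suc x)"
proof -
  have t: "rtime (\<sigma> ! i) \<le> t" using assms(1) by (auto simp: far_run_def split: if_splits)
  then obtain \<delta>' where s': "st (Suc t) i = Some (x', \<delta>')" using assms(2) by (auto simp: far_run_def simp del: sim.simps)
  then obtain v where v: "J i = Some v" using sim_None[of J i "Suc t"] by (cases "J i") auto
  then obtain \<delta> where s: "st t i = Some (x, \<delta>)"
    using far_run_job[OF v t] assms(1) by (cases "st t i") auto
  have "rtime (fst v) \<noteq> Suc t" using t J_input[OF v] by simp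
  from step_cases[OF v this s'] obtain x0 \<delta>0 where "st t i = Some (x0, \<delta>0)" "i \<in> pres t x0"
    "i \<in> ups t x0 \<and> x' = x0 \<and> \<delta>' \<or> i \<notin> ups t x0 \<and> x' = Suc x0 \<and> \<not> \<delta>'" by blast
  then show ?thesis using s by auto
qed

lemma far_feasible: "feasible B c \<sigma> (far_run J \<sigma>)"
proof -
  have "card (forwarded \<sigma> (far_run J \<sigma>) x t) \<le> c" for x t
  proof -
    have "forwarded \<sigma> (far_run J \<sigma>) x t \<subseteq> pres t x - ups t x"
    proof
      fix i assume "i \<in> forwarded \<sigma> (far_run J \<sigma>) x t"
      then have "far_run J \<sigma> i t = Some x" "far_run J \<sigma> i (Suc t) = Some (Suc x)" "x \<noteq> dst (\<sigma> ! i)"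
        by (auto simp: forwarded_def)
      from far_run_Suc[OF this] show "i \<in> pres t x - ups t x" by (auto split: if_splits)
    qed
    then have "card (forwarded \<sigma> (far_run J \<sigma>) x t) \<le> card (pres t x - ups t x)" by (intro card_mono) auto
    then show ?thesis using ups_choice[OF cap, of t x] by (simp add: up_choice_def)
  qed
  moreover have "card (stored \<sigma> (far_run J \<sigma>) x t) \<le> B" for x t
  proof -
    have "stored \<sigma> (far_run J \<sigma>) x t \<subseteq> ups t x"
    proof
      fix i assume "i \<in> stored \<sigma> (far_run J \<sigma>) x t"
      then have "far_run J \<sigma> i t = Some x" "far_run J \<sigma> i (Suc t) = Some x" "x \<noteq> dst (\<sigma> ! i)"
        by (auto simp: stored_def)
      from far_run_Suc[OF this] show "i \<in> ups t x" by (auto split: if_splits)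
    qed
    moreover have "finite (ups t x)" using ups_subset[OF cap] finite_pres finite_subset by blast
    ultimately have "card (stored \<sigma> (far_run J \<sigma>) x t) \<le> card (ups t x)" by (intro card_mono)
    then show ?thesis using ups_choice[OF cap, of t x] by (simp add: up_choice_def)
  qed
  moreover have "\<forall>t<rtime (\<sigma> ! i). far_run J \<sigma> i t = None"
    "far_run J \<sigma> i (rtime (\<sigma> ! i)) = Some (src (\<sigma> ! i))" for i
    by (simp_all add: far_run_def)
  moreover have "(if x = dst (\<sigma> ! i) then far_run J \<sigma> i (Suc t) = None
             else far_run J \<sigma> i (Suc t) \<in> {None, Some x, Some (Suc x)})"
    if t: "t \<ge> rtime (\<sigma> ! i)" and x: "far_run J \<sigma> i t = Some x" for i t x
  proof (cases "J i")
    case None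
    then show ?thesis using t sim_None[of J i "Suc t"] by (simp add: far_run_def)
  next
    case (Some v)
    obtain \<delta> where s: "st t i = Some (x, \<delta>)"
      using far_run_job[OF Some t] x by (cases "st t i") auto
    have "rtime (fst v) \<noteq> Suc t" using t J_input[OF Some] by simp
    from sim_Suc[of J i v t, OF Some this] s J_input[OF Some] show ?thesis
      using far_run_job[OF Some, of "Suc t"] t by (auto simp del: sim.simps)
  qed
  moreover have "far_run J \<sigma> i (Suc t) = None"
    if t: "t \<ge> rtime (\<sigma> ! i)" and x: "far_run J \<sigma> i t = None" for i t
  proof (cases "J i")
    case None
    then show ?thesis using t sim_None[of J i "Suc t"] by (simp add: far_run_def)
  next
    case (Some v)
    have s: "st t i = None" using far_run_job[OF Some t] x by (cases "st t i") auto
    have "rtime (fst v) \<noteq> Suc t" using t J_input[OF Some] by simp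
    from sim_Suc[of J i v t, OF Some this] s show ?thesis
      using far_run_job[OF Some, of "Suc t"] t by (auto simp del: sim.simps)
  qed
  ultimately show ?thesis unfolding feasible_def by blast
qed

lemma far_delivered:
  assumes "J i = Some v"
  shows "delivered \<sigma> (far_run J \<sigma>) i"
proof -
  obtain r \<delta>0 z where v: "v = (r, \<delta>0, z)" by (cases v)
  obtain t \<delta> where s: "st t i = Some (dst r, \<delta>)" using reaches_dst assms v by blast
  then have "rtime r \<le> t" using sim_Some[of J t i] assms v by auto
  then have "far_run J \<sigma> i t = Some (dst (\<sigma> ! i))"
    using far_run_job[OF assms, of t] s J_input[OF assms] v by simp
  then show ?thesis by (auto simp: delivered_def)
qed

lemma far_nonpreemptive: "nonpreemptive \<sigma> (far_run J \<sigma>)"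
  unfolding nonpreemptive_def
proof (intro allI impI)
  fix i assume "\<exists>t>rtime (\<sigma> ! i). far_run J \<sigma> i t \<noteq> None"
  then obtain v where "J i = Some v"
    using sim_None[of J i] by (cases "J i") (auto simp: far_run_def)
  then show "delivered \<sigma> (far_run J \<sigma>) i" by (rule far_delivered)
qed

end

section \<open>Exponential edge prices\<close>

definition price :: "nat \<Rightarrow> nat \<Rightarrow> nat \<Rightarrow> real" where
  "price m P f = ((1 + 1 / real m) ^ f - 1) / real P"

lemma price_nonneg: "0 \<le> price m P f"
  by (simp add: price_def)

lemma price_mono: "f \<le> g \<Longrightarrow> price m P f \<le> price m P g"
  unfolding price_def by (intro divide_right_mono diff_right_mono power_increasing) auto

text \<open>This difference equation, the discrete form of \<open>m * p' = p + 1 / P\<close>, is the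
  reason for the shape of \<open>price\<close>.\<close>

lemma price_Suc:
  assumes "0 < m" "0 < P"
  shows "real m * (price m P (Suc f) - price m P f) = price m P f + 1 / real P"
  using assms by (simp add: price_def field_simps)

text \<open>By Bernoulli's inequality \<open>m\<close> further paths at least double the power, so
  load \<open>m * k\<close> brings it to \<open>2 ^ k\<close>, which means price 1 or more.\<close>

lemma price_less_1:
  assumes "price m P f < 1" "0 < m" "0 < P" "P + 1 \<le> 2 ^ k"
  shows "f < m * k"
proof (rule ccontr)
  assume "\<not> f < m * k"
  then have "(1 + 1 / real m) ^ (m * k) \<le> (1 + 1 / real m) ^ f"
    by (intro power_increasing) auto
  moreover have "2 \<le> (1 + 1 / real m) ^ m"
  proof -
    have "-1 \<le> 1 / real m" by (rule order_trans[of _ 0]) auto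
    from Bernoulli_inequality[OF this, of m] show ?thesis using assms(2) by simp
  qed
  then have "2 ^ k \<le> ((1 + 1 / real m) ^ m) ^ k" by (intro power_mono) auto
  moreover have "real (P + 1) \<le> 2 ^ k" using assms(4) by (metis of_nat_le_iff of_nat_numeral of_nat_power)
  ultimately have "real P + 1 \<le> (1 + 1 / real m) ^ f" by (simp add: power_mult)
  then have "1 \<le> price m P f" using assms(3) by (simp add: price_def)
  then show False using assms(1) by simp
qed

lemma cnt_build_Suc:
  assumes "i < length \<sigma>"
  shows "cnt (build D \<sigma> (Suc i)) Q = cnt (build D \<sigma> i) Q +
     (case plan D \<sigma> i of None \<Rightarrow> 0 | Some v \<Rightarrow> if Q v then 1 else 0)"
proof -
  have d: "D (build D \<sigma> i) (\<sigma> ! i) = plan D \<sigma> i" using plan_nth[OF assms, of D] by simp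
  have n: "build D \<sigma> i i = None" by (simp add: build_ge)
  have fin: "finite {j. \<exists>v. build D \<sigma> i j = Some v \<and> Q v}"
    using assms by (intro finite_build) simp
  have "{j. \<exists>v. build D \<sigma> (Suc i) j = Some v \<and> Q v} = {j. \<exists>v. build D \<sigma> i j = Some v \<and> Q v} \<union>
     (case plan D \<sigma> i of None \<Rightarrow> {} | Some v \<Rightarrow> if Q v then {i} else {})"
    using n by (auto simp: d split: option.splits if_splits)
  then show ?thesis using n fin by (auto simp: cnt_def split: option.splits)
qed

locale priced =
  fixes D :: "(nat \<Rightarrow> 'j option) \<Rightarrow> request \<Rightarrow> 'j option" and \<sigma> :: "request list"
    and E :: "'j \<Rightarrow> 'e set" and m P :: nat
  assumes m0: "0 < m" and P0: "0 < P"
    and accept: "\<And>i v. plan D \<sigma> i = Some v \<Longrightarrow> finite (E v) \<and> card (E v) \<le> P \<and>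
       (\<Sum>e\<in>E v. price m P (cnt (build D \<sigma> i) (\<lambda>u. e \<in> E u))) < 1"
begin

abbreviation "load i e \<equiv> cnt (build D \<sigma> i) (\<lambda>u. e \<in> E u)"

text \<open>An accepted request of price below 1 on at most P edges raises m times the total price by at
  most 1 + P / P.\<close>

lemma total_price_step:
  assumes "i \<le> length \<sigma>" "finite \<Omega>"
  shows "real m * (\<Sum>e\<in>\<Omega>. price m P (load i e)) \<le> 2 * real (cnt (build D \<sigma> i) (\<lambda>_. True))"
  using assms(1)
proof (induction i)
  case 0
  then show ?case by (simp add: cnt_def price_def)
next
  case (Suc i)
  then have i: "i < length \<sigma>" and IH: "real m * (\<Sum>e\<in>\<Omega>. price m P (load i e)) \<le> 2 * real (cnt (build D \<sigma> i) (\<lambda>_. True))"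
    by auto
  show ?case
  proof (cases "plan D \<sigma> i")
    case None
    then show ?thesis using IH by (simp add: cnt_build_Suc[OF i] del: build.simps)
  next
    case (Some v)
    have fin: "finite (E v)" and card: "card (E v) \<le> P" and less: "(\<Sum>e\<in>E v. price m P (load i e)) < 1"
      using accept[OF Some] by auto
    have "real m * (\<Sum>e\<in>\<Omega>. price m P (load (Suc i) e)) - real m * (\<Sum>e\<in>\<Omega>. price m P (load i e))
      = (\<Sum>e\<in>\<Omega>. real m * (price m P (load (Suc i) e) - price m P (load i e)))"
      by (simp add: sum_distrib_left sum_subtractf right_diff_distrib del: build.simps)
    also have "\<dots> = (\<Sum>e\<in>\<Omega>. if e \<in> E v then price m P (load i e) + 1 / real P else 0)"
      using Some price_Suc[OF m0 P0] by (intro sum.cong) (auto simp: cnt_build_Suc[OF i] simp del: build.simps)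
    also have "\<dots> = (\<Sum>e\<in>\<Omega> \<inter> E v. price m P (load i e) + 1 / real P)"
      using assms(2) by (simp add: sum.inter_restrict)
    also have "\<dots> \<le> (\<Sum>e\<in>E v. price m P (load i e) + 1 / real P)"
      using fin price_nonneg by (intro sum_mono2) auto
    also have "\<dots> = (\<Sum>e\<in>E v. price m P (load i e)) + real (card (E v)) / real P"
      by (simp add: sum.distrib)
    also have "\<dots> \<le> 2"
    proof -
      have "real (card (E v)) / real P \<le> 1" using card P0 by simp
      then show ?thesis using less by linarith
    qed
    finally show ?thesis using IH Some by (simp add: cnt_build_Suc[OF i] del: build.simps)
  qed
qed

lemma total_price:
  assumes "finite \<Omega>"
  shows "real m * (\<Sum>e\<in>\<Omega>. price m P (cnt (plan D \<sigma>) (\<lambda>u. e \<in> E u))) \<le> 2 * real (cnt (plan D \<sigma>) (\<lambda>_. True))"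
  unfolding plan_def by (rule total_price_step[OF order_refl assms])

text \<open>Prices being nonnegative, every single edge of an accepted path is cheaper than 1 at
  that moment.\<close>

lemma load_le:
  assumes "P + 1 \<le> 2 ^ k"
  shows "cnt (plan D \<sigma>) (\<lambda>u. e \<in> E u) \<le> m * k"
proof -
  have "load i e \<le> m * k" if "i \<le> length \<sigma>" for i
    using that
  proof (induction i)
    case 0
    then show ?case by (simp add: cnt_def)
  next
    case (Suc i)
    then have i: "i < length \<sigma>" and IH: "load i e \<le> m * k" by auto
    have "load i e < m * k" if v: "plan D \<sigma> i = Some v" "e \<in> E v" for v
    proof (rule price_less_1[OF _ m0 P0 assms])
      have "price m P (load i e) \<le> (\<Sum>e\<in>E v. price m P (load i e))"
        using accept[OF v(1)] v(2) price_nonneg by (intro member_le_sum) auto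
      then show "price m P (load i e) < 1" using accept[OF v(1)] by simp
    qed
    then show ?case using IH by (auto simp: cnt_build_Suc[OF i] Suc_le_eq simp del: build.simps split: option.splits)
  qed
  from this[OF order_refl] show ?thesis unfolding plan_def .
qed

text \<open>Weak duality. Each path \<open>F i\<close> cost at least 1 when refused, and prices only
  rise. An edge lies on at most \<open>L\<close> of these paths, so the final prices sum to at least
  \<open>card R / L\<close>, while \<open>total_price\<close> bounds the sum by twice the number of
  acceptances divided by \<open>m\<close>.\<close>

lemma rejected_by_price:
  assumes R: "finite R" and F: "\<And>i. i \<in> R \<Longrightarrow> i < length \<sigma> \<and> finite (F i) \<and> 1 \<le> (\<Sum>e\<in>F i. price m P (load i e))"
    and L: "\<And>e. card {i \<in> R. e \<in> F i} \<le> L"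
  shows "real m * real (card R) \<le> 2 * real L * real (cnt (plan D \<sigma>) (\<lambda>_. True))"
proof -
  let ?p = "\<lambda>e. price m P (cnt (plan D \<sigma>) (\<lambda>u. e \<in> E u))"
  define \<Omega> where "\<Omega> = (\<Union>i\<in>R. F i)"
  have fin: "finite \<Omega>" using R F by (auto simp: \<Omega>_def)
  have "real (card R) = (\<Sum>i\<in>R. 1)" by simp
  also have "\<dots> \<le> (\<Sum>i\<in>R. \<Sum>e\<in>F i. ?p e)"
  proof (rule sum_mono)
    fix i assume i: "i \<in> R"
    have "1 \<le> (\<Sum>e\<in>F i. price m P (load i e))" using F[OF i] by blast
    also have "\<dots> \<le> (\<Sum>e\<in>F i. ?p e)"
      using F[OF i] by (intro sum_mono price_mono cnt_build_le) simp
    finally show "1 \<le> (\<Sum>e\<in>F i. ?p e)" .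
  qed
  also have "\<dots> = (\<Sum>i\<in>R. \<Sum>e\<in>\<Omega>. if e \<in> F i then ?p e else 0)"
  proof (rule sum.cong[OF refl])
    fix i assume "i \<in> R"
    then have "\<Omega> \<inter> F i = F i" by (auto simp: \<Omega>_def)
    then show "(\<Sum>e\<in>F i. ?p e) = (\<Sum>e\<in>\<Omega>. if e \<in> F i then ?p e else 0)"
      using sum.inter_restrict[OF fin, of ?p "F i"] by simp
  qed
  also have "\<dots> = (\<Sum>e\<in>\<Omega>. \<Sum>i\<in>R. if e \<in> F i then ?p e else 0)" by (rule sum.swap)
  also have "\<dots> = (\<Sum>e\<in>\<Omega>. real (card {i \<in> R. e \<in> F i}) * ?p e)"
    using R by (intro sum.cong refl) (simp add: sum.If_cases Int_def)
  also have "\<dots> \<le> (\<Sum>e\<in>\<Omega>. real L * ?p e)"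
    using L price_nonneg by (intro sum_mono mult_right_mono) auto
  also have "\<dots> = real L * (\<Sum>e\<in>\<Omega>. ?p e)" by (simp add: sum_distrib_left)
  finally have "real m * real (card R) \<le> real m * (real L * (\<Sum>e\<in>\<Omega>. ?p e))"
    by (rule mult_left_mono) simp
  also have "\<dots> = real L * (real m * (\<Sum>e\<in>\<Omega>. ?p e))" by (rule mult.left_commute)
  also have "\<dots> \<le> real L * (2 * real (cnt (plan D \<sigma>) (\<lambda>_. True)))"
    by (intro mult_left_mono total_price fin) auto
  finally show ?thesis by (simp add: mult_ac)
qed

end

section \<open>Far requests\<close>

context grid
begin

text \<open>The tile edges used by a job: False marks the horizontal edge leaving tile (I, L) to
  the right, True the vertical edge leaving it upwards.\<close>

fun edges :: "job \<Rightarrow> (bool \<times> nat \<times> nat) set" where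
  "edges (r, _, z) = (\<lambda>I. (False, I, z I)) ` {TI (src r)..<TI (dst r)} \<union>
     (\<Union>I\<in>{TI (src r)..<TI (dst r)}. (\<lambda>L. (True, I, L)) ` {enter (TI (src r)) (TJ (row_of n r)) z I..<z I})"

text \<open>\<open>K\<close> bounds the climb, so that the number of edges of a path is bounded by
  \<open>P\<close>. The final test concerns the only line of the source cell that the packet is
  going to use.\<close>

fun far_ok :: "nat \<Rightarrow> nat \<Rightarrow> nat \<Rightarrow> (nat \<Rightarrow> job option) \<Rightarrow> job \<Rightarrow> bool" where
  "far_ok m P K H (r, \<delta>, z) \<longleftrightarrow>
     even (XC (src r)) \<and> even (YC (row_of n r)) \<and> src r + 2 * w \<le> dst r \<and>
     (\<forall>I. TI (src r) \<le> I \<and> I < TI (dst r) \<longrightarrow>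
        enter (TI (src r)) (TJ (row_of n r)) z I \<le> z I \<and> z I \<le> TJ (row_of n r) + K) \<and>
     (\<Sum>e\<in>edges (r, \<delta>, z). price m P (cnt H (\<lambda>u. e \<in> edges u))) < 1 \<and>
     (if \<delta> then cnt H (\<lambda>(r', \<delta>', _). \<delta>' \<and> src r' = src r \<and> YC (row_of n r') = YC (row_of n r)) < B
      else cnt H (\<lambda>(r', \<delta>', _). \<not> \<delta>' \<and> XC (src r') = XC (src r) \<and> row_of n r' = row_of n r) < c)"

definition far_decide :: "nat \<Rightarrow> nat \<Rightarrow> nat \<Rightarrow> (nat \<Rightarrow> job option) \<Rightarrow> request \<Rightarrow> job option" where
  "far_decide m P K H r = (if \<exists>v. far_ok m P K H v \<and> fst v = r
      then Some (SOME v. far_ok m P K H v \<and> fst v = r) else None)"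

definition far_alg :: "nat \<Rightarrow> nat \<Rightarrow> nat \<Rightarrow> request list \<Rightarrow> run" where
  "far_alg m P K \<sigma> = far_run (plan (far_decide m P K) \<sigma>) \<sigma>"

lemma far_plan_Some:
  assumes "plan (far_decide m P K) \<sigma> i = Some v"
  shows "i < length \<sigma>" "fst v = \<sigma> ! i" "far_ok m P K (build (far_decide m P K) \<sigma> i) v"
proof -
  show i: "i < length \<sigma>" using plan_Some_less[OF assms] .
  let ?ok = "\<lambda>v. far_ok m P K (build (far_decide m P K) \<sigma> i) v \<and> fst v = \<sigma> ! i"
  have e: "far_decide m P K (build (far_decide m P K) \<sigma> i) (\<sigma> ! i) = Some v"
    using assms plan_nth[OF i, of "far_decide m P K"] by simp
  have ex: "\<exists>v. ?ok v"
  proof (rule ccontr)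
    assume "\<not> ?thesis"
    then have "far_decide m P K (build (far_decide m P K) \<sigma> i) (\<sigma> ! i) = None"
      unfolding far_decide_def[of m P K "build _ _ _"] by (rule if_not_P)
    then show False using e by simp
  qed
  then have "far_decide m P K (build (far_decide m P K) \<sigma> i) (\<sigma> ! i) = Some (SOME v. ?ok v)"
    unfolding far_decide_def[of m P K "build _ _ _"] by (rule if_P)
  then have v: "v = (SOME v. ?ok v)" using e by simp
  show "fst v = \<sigma> ! i" "far_ok m P K (build (far_decide m P K) \<sigma> i) v"
    using someI_ex[OF ex] by (simp_all add: v)
qed

lemma far_online: "online n (far_alg m P K)"
proof (rule onlineI)
  fix \<sigma> \<sigma>' :: "request list" and T p i t
  assume p: "p \<le> length \<sigma>" "p \<le> length \<sigma>'" "i < p" and t: "t \<le> Suc T" and eq: "\<And>j. j < p \<Longrightarrow> \<sigma> ! j = \<sigma>' ! j"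
    and late: "\<And>j. p \<le> j \<Longrightarrow> j < length \<sigma> \<Longrightarrow> T < rtime (\<sigma> ! j)"
      "\<And>j. p \<le> j \<Longrightarrow> j < length \<sigma>' \<Longrightarrow> T < rtime (\<sigma>' ! j)"
  let ?J = "plan (far_decide m P K) \<sigma>" and ?J' = "plan (far_decide m P K) \<sigma>'"
  have J: "?J j = ?J' j" if "j < p" for j using that p eq by (intro plan_cong) auto
  have c: "?J j = ?J' j \<or> (\<forall>v. ?J j = Some v \<or> ?J' j = Some v \<longrightarrow> T < rtime (fst v))" for j
  proof (cases "j < p")
    case False
    then show ?thesis using far_plan_Some(1,2)[of m P K \<sigma> j] far_plan_Some(1,2)[of m P K \<sigma>' j] late[of j] by auto
  qed (simp add: J)
  have "sim ?J t i = sim ?J' t i"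
  proof (cases "t \<le> T")
    case True
    from sim_cong(1)[of ?J ?J' T t, OF c True] show ?thesis by (rule fun_cong)
  next
    case False
    with t have "t = Suc T" by simp
    then show ?thesis using sim_cong(2)[of ?J ?J' T i, OF c J[OF p(3)]] by (rule ssubst)
  qed
  then show "far_alg m P K \<sigma> i t = far_alg m P K \<sigma>' i t"
    unfolding far_alg_def far_run_def eq[OF p(3)] by (rule arg_cong)
qed

end

text \<open>The factor 3 in \<open>mk\<close> counts the tile edges that can witness a visit to a
  tile, each of load at most \<open>m * k\<close>.\<close>

locale far = grid +
  fixes m P K k :: nat
  assumes w0: "0 < w" and h0: "0 < h" and wh: "w * B = h * c" and m0: "0 < m"
    and P: "2 * (n + sx) * (K + 1) \<le> P" and k: "P + 1 \<le> 2 ^ k" and mk: "3 * (m * k) < w * B"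
begin

abbreviation "D \<equiv> far_decide m P K"

lemma TI_le: "TI x \<le> x + sx"
proof -
  have "XC x \<le> x + sx" by (simp add: XC_def)
  then show ?thesis by (simp add: TI_def)
qed

lemma finite_edges [simp]: "finite (edges v)"
  by (cases v) auto

text \<open>All edges lie in a box of two directions, \<open>n + sx\<close> tile columns and
  \<open>K + 1\<close> tile rows.\<close>

lemma card_edges:
  assumes "dst r < n" "\<And>I. TI (src r) \<le> I \<Longrightarrow> I < TI (dst r) \<Longrightarrow>
        enter (TI (src r)) (TJ (row_of n r)) z I \<le> z I \<and> z I \<le> TJ (row_of n r) + K"
  shows "card (edges (r, \<delta>, z)) \<le> P"
proof -
  define J0 where "J0 = TJ (row_of n r)"
  have ge: "J0 \<le> z I" if "TI (src r) \<le> I" "I < TI (dst r)" for I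
    using that
  proof (induction I rule: dec_induct)
    case base then show ?case using assms(2)[of "TI (src r)"] by (auto simp: enter_def J0_def)
  next
    case (step I) then show ?case using assms(2)[of "Suc I"] by (auto simp: enter_def)
  qed
  have ent: "J0 \<le> enter (TI (src r)) J0 z I" if "TI (src r) \<le> I" "I < TI (dst r)" for I
    using that ge[of "I - 1"] by (auto simp: enter_def)
  have "edges (r, \<delta>, z) \<subseteq> UNIV \<times> {..<n + sx} \<times> {J0..J0 + K}"
  proof
    fix e assume e: "e \<in> edges (r, \<delta>, z)"
    then obtain I where I: "TI (src r) \<le> I" "I < TI (dst r)" and
      L: "e = (False, I, z I) \<or> (\<exists>L. e = (True, I, L) \<and> enter (TI (src r)) J0 z I \<le> L \<and> L < z I)"
      by (auto simp: J0_def)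
    have "I < n + sx" using I(2) TI_le[of "dst r"] assms(1) by simp
    then show "e \<in> UNIV \<times> {..<n + sx} \<times> {J0..J0 + K}"
      using L ge[OF I] ent[OF I] assms(2)[OF I] by (auto simp: J0_def)
  qed
  then have "card (edges (r, \<delta>, z)) \<le> card ((UNIV :: bool set) \<times> {..<n + sx} \<times> {J0..J0 + K})"
    by (intro card_mono) auto
  also have "\<dots> = 2 * (n + sx) * (K + 1)" by (simp add: card_cartesian_product)
  finally show ?thesis using P by simp
qed

end

locale far_input = far +
  fixes \<sigma> :: "request list"
  assumes valid: "valid_input n \<sigma>" and P0: "0 < P"
begin

sublocale priced D \<sigma> edges m P
proof
  show "0 < m" by (rule m0)
  show "0 < P" by (rule P0)
  fix i v assume v: "plan D \<sigma> i = Some v"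
  obtain r \<delta> z where vv: "v = (r, \<delta>, z)" by (cases v)
  have ok: "far_ok m P K (build D \<sigma> i) (r, \<delta>, z)" using far_plan_Some(3)[OF v] vv by simp
  have "dst r < n" using far_plan_Some(1,2)[OF v] valid vv by (auto simp: valid_input_def)
  then have "card (edges v) \<le> P" unfolding vv using ok by (intro card_edges) auto
  then show "finite (edges v) \<and> card (edges v) \<le> P \<and> (\<Sum>e\<in>edges v. price m P (cnt (build D \<sigma> i) (\<lambda>u. e \<in> edges u))) < 1"
    using ok vv by (simp del: edges.simps)
qed

text \<open>A visited tile is left through one of its own two edges, unless it is the destination
  tile, entered through the edge of its left neighbour.\<close>

lemma onpath_edges:
  assumes "onpath (r, \<delta>, z) I L" "TI (src r) < TI (dst r)"
  shows "(False, I, L) \<in> edges (r, \<delta>, z) \<or> (True, I, L) \<in> edges (r, \<delta>, z) \<or> (False, I - 1, L) \<in> edges (r, \<delta>, z)"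
proof (cases "TI (src r) \<le> I \<and> I < TI (dst r) \<and> enter (TI (src r)) (TJ (row_of n r)) z I \<le> L \<and> L \<le> z I")
  case True
  then have I: "I \<in> {TI (src r)..<TI (dst r)}" by simp
  show ?thesis
  proof (cases "L = z I")
    case True
    then show ?thesis using I by simp
  next
    case False
    then have "L \<in> {enter (TI (src r)) (TJ (row_of n r)) z I..<z I}" using \<open>_ \<and> _\<close> by simp
    then have "(True, I, L) \<in> edges (r, \<delta>, z)"
      unfolding edges.simps by (intro UnI2 UN_I[OF I] imageI)
    then show ?thesis by blast
  qed
next
  case False
  then have "I = TI (dst r)" "L = z (I - 1)" using assms(1) by auto
  then have "(False, I - 1, L) \<in> edges (r, \<delta>, z)" using assms(2) by auto
  then show ?thesis by blast
qed

sublocale routing_input n B c w h sx sd "plan D \<sigma>" \<sigma>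
proof
  show "0 < w" "0 < h" "w * B = h * c" using w0 h0 wh by auto
  show "finite {i. plan D \<sigma> i \<noteq> None}"
    by (rule finite_subset[OF _ finite_plan[of D \<sigma> "\<lambda>_ _. True"]]) auto
  show "fst v = \<sigma> ! i" if "plan D \<sigma> i = Some v" for i v using far_plan_Some(2)[OF that] .
next
  fix i r \<delta> z assume v: "plan D \<sigma> i = Some (r, \<delta>, z)"
  note ok = far_plan_Some[OF v]
  show "even (XC (src r)) \<and> even (YC (row_of n r))" using ok(3) by simp
  show "src r + 2 * w \<le> dst r \<and> dst r < n" using ok valid by (auto simp: valid_input_def)
  show "enter (TI (src r)) (TJ (row_of n r)) z I \<le> z I" if "TI (src r) \<le> I" "I < TI (dst r)" for I
    using ok(3) that by simp
next
  fix x Y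
  show "card {i. \<exists>r z. plan D \<sigma> i = Some (r, True, z) \<and> src r = x \<and> YC (row_of n r) = Y} \<le> B"
  proof (rule card_plan_le[where D = D and \<sigma> = \<sigma> and
      Q = "\<lambda>(r, _, _) (r', \<delta>', _). \<delta>' \<and> src r' = src r \<and> YC (row_of n r') = YC (row_of n r)"])
    fix i assume "i \<in> {i. \<exists>r z. plan D \<sigma> i = Some (r, True, z) \<and> src r = x \<and> YC (row_of n r) = Y}"
    then obtain r z where v: "plan D \<sigma> i = Some (r, True, z)" by auto
    from far_plan_Some(3)[OF v] v
    show "\<exists>v. plan D \<sigma> i = Some v \<and> cnt (build D \<sigma> i) (case v of (r, _, _) \<Rightarrow> \<lambda>(r', \<delta>', _). \<delta>' \<and> src r' = src r \<and> YC (row_of n r') = YC (row_of n r)) < B"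
      by (intro exI[of _ "(r, True, z)"]) simp
  qed auto
  show "card {i. \<exists>r z. plan D \<sigma> i = Some (r, False, z) \<and> XC (src r) = x \<and> row_of n r = Y} \<le> c"
  proof (rule card_plan_le[where D = D and \<sigma> = \<sigma> and
      Q = "\<lambda>(r, _, _) (r', \<delta>', _). \<not> \<delta>' \<and> XC (src r') = XC (src r) \<and> row_of n r' = row_of n r"])
    fix i assume "i \<in> {i. \<exists>r z. plan D \<sigma> i = Some (r, False, z) \<and> XC (src r) = x \<and> row_of n r = Y}"
    then obtain r z where v: "plan D \<sigma> i = Some (r, False, z)" by auto
    from far_plan_Some(3)[OF v] v
    show "\<exists>v. plan D \<sigma> i = Some v \<and> cnt (build D \<sigma> i) (case v of (r, _, _) \<Rightarrow> \<lambda>(r', \<delta>', _). \<not> \<delta>' \<and> XC (src r') = XC (src r) \<and> row_of n r' = row_of n r) < c"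
      by (intro exI[of _ "(r, False, z)"]) simp
  qed auto
next
  fix I L
  let ?C = "\<lambda>e. {i. \<exists>v. plan D \<sigma> i = Some v \<and> e \<in> edges v}"
  have C: "finite (?C e)" "card (?C e) \<le> m * k" for e
    using load_le[OF k, of e] finite_plan[of D \<sigma> "\<lambda>_ v. e \<in> edges v"] unfolding cnt_def by blast+
  have "{i. \<exists>v. plan D \<sigma> i = Some v \<and> onpath v I L} \<subseteq> ?C (False, I, L) \<union> ?C (True, I, L) \<union> ?C (False, I - 1, L)"
  proof
    fix i assume "i \<in> {i. \<exists>v. plan D \<sigma> i = Some v \<and> onpath v I L}"
    then obtain r \<delta> z where v: "plan D \<sigma> i = Some (r, \<delta>, z)" "onpath (r, \<delta>, z) I L" by auto
    have "TI (src r) < TI (dst r)" using far_plan_Some(3)[OF v(1)] by (intro TI_less[OF w0]) simp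
    from onpath_edges[OF v(2) this] v(1) show "i \<in> ?C (False, I, L) \<union> ?C (True, I, L) \<union> ?C (False, I - 1, L)"
      by blast
  qed
  then have "card {i. \<exists>v. plan D \<sigma> i = Some v \<and> onpath v I L} \<le> card (?C (False, I, L) \<union> ?C (True, I, L) \<union> ?C (False, I - 1, L))"
    using C by (intro card_mono) auto
  also have "\<dots> \<le> card (?C (False, I, L)) + card (?C (True, I, L)) + card (?C (False, I - 1, L))"
    by (meson add_le_mono card_Un_le le_trans order_refl)
  also have "\<dots> \<le> 3 * (m * k)" using C(2)[of "(False, I, L)"] C(2)[of "(True, I, L)"] C(2)[of "(False, I - 1, L)"] by simp
  finally show "card {i. \<exists>v. plan D \<sigma> i = Some v \<and> onpath v I L} < w * B" using mk by simp
qed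

end

text \<open>Prices control only paths of polynomial length, whereas optimal packets may wait forever.
  With rows cut into windows of n * B rows, at most n * B packets cross the end M of
  a window. Each of them can instead wait at the crossing point for a row of its own in the
  next window; this at most doubles the load of every edge.\<close>

lemma short_paths:
  assumes v: "valid_input n \<sigma>" and f: "feasible B c \<sigma> \<rho>" and nB: "0 < n" "0 < B" "0 < c"
  defines "S \<equiv> {i. i < length \<sigma> \<and> delivered \<sigma> \<rho> i \<and> src (\<sigma> ! i) < dst (\<sigma> ! i)}"
  shows "\<exists>e. (\<forall>i\<in>S. \<forall>x. src (\<sigma> ! i) \<le> x \<and> x < dst (\<sigma> ! i) \<longrightarrow>
        enter (src (\<sigma> ! i)) (row_of n (\<sigma> ! i)) (e i) x \<le> e i x \<and> e i x \<le> row_of n (\<sigma> ! i) + 2 * (n * B)) \<and>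
     (\<forall>x d. card {i \<in> S. src (\<sigma> ! i) \<le> x \<and> x < dst (\<sigma> ! i) \<and> e i x = d} \<le> 2 * c) \<and>
     (\<forall>x d. card {i \<in> S. src (\<sigma> ! i) \<le> x \<and> x < dst (\<sigma> ! i) \<and>
         enter (src (\<sigma> ! i)) (row_of n (\<sigma> ! i)) (e i) x \<le> d \<and> d < e i x} \<le> 2 * B)"
proof -
  define s b rw where "s i = src (\<sigma> ! i)" and "b i = dst (\<sigma> ! i)" and "rw i = row_of n (\<sigma> ! i)" for i
  define W where "W = n * B"
  have W0: "0 < W" using nB by (simp add: W_def)
  have sb: "s i < b i" "b i < n" if "i \<in> S" for i using that v by (auto simp: S_def s_def b_def valid_input_def)
  have finS: "finite S" by (simp add: S_def)
  have "\<forall>i\<in>S. \<exists>e. \<forall>x. s i \<le> x \<and> x < b i \<longrightarrow>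
     enter (s i) (rw i) e x \<le> e x \<and> i \<in> forwarded \<sigma> \<rho> x (e x + x - n) \<and>
     (\<forall>y. enter (s i) (rw i) e x \<le> y \<and> y < e x \<longrightarrow> i \<in> stored \<sigma> \<rho> x (y + x - n))"
    unfolding s_def b_def rw_def
  proof
    fix i assume "i \<in> S"
    then have "i < length \<sigma>" "delivered \<sigma> \<rho> i" by (auto simp: S_def)
    from delivered_path[OF v f this] show "\<exists>e. \<forall>x. src (\<sigma> ! i) \<le> x \<and> x < dst (\<sigma> ! i) \<longrightarrow>
     enter (src (\<sigma> ! i)) (row_of n (\<sigma> ! i)) e x \<le> e x \<and> i \<in> forwarded \<sigma> \<rho> x (e x + x - n) \<and>
     (\<forall>y. enter (src (\<sigma> ! i)) (row_of n (\<sigma> ! i)) e x \<le> y \<and> y < e x \<longrightarrow> i \<in> stored \<sigma> \<rho> x (y + x - n))" .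
  qed
  from bchoice[OF this] obtain e where e: "\<And>i x. i \<in> S \<Longrightarrow> s i \<le> x \<Longrightarrow> x < b i \<Longrightarrow>
     enter (s i) (rw i) (e i) x \<le> e i x \<and> i \<in> forwarded \<sigma> \<rho> x (e i x + x - n) \<and>
     (\<forall>y. enter (s i) (rw i) (e i) x \<le> y \<and> y < e i x \<longrightarrow> i \<in> stored \<sigma> \<rho> x (y + x - n))"
    by blast
  define M where "M i = (rw i div W + 1) * W" for i
  have M: "rw i < M i" "M i \<le> rw i + W" for i
  proof -
    have "rw i = rw i div W * W + rw i mod W" by simp
    moreover have "rw i mod W < W" using W0 by simp
    moreover have "M i = rw i div W * W + W" by (simp add: M_def)
    ultimately show "rw i < M i" "M i \<le> rw i + W" by linarith+
  qed
  define C where "C N = {i \<in> S. M i = N \<and> (\<exists>x. s i \<le> x \<and> x < b i \<and> N \<le> e i x)}" for N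
  have cardC: "card (C N) \<le> W" for N
  proof -
    have "C N \<subseteq> (\<Union>x\<in>{..<n}. stored \<sigma> \<rho> x (N - 1 + x - n))"
    proof
      fix i assume i: "i \<in> C N"
      then have iS: "i \<in> S" and N: "M i = N" and ex: "\<exists>x. s i \<le> x \<and> x < b i \<and> N \<le> e i x" by (auto simp: C_def)
      \<comment> \<open>In the first column left beyond the window end the packet is stored across
        row \<open>N - 1\<close>, which at most \<open>n * B\<close> packets can be.\<close>
      define x where "x = (LEAST x. s i \<le> x \<and> x < b i \<and> N \<le> e i x)"
      have x: "s i \<le> x \<and> x < b i \<and> N \<le> e i x" unfolding x_def by (rule LeastI_ex[OF ex])
      have "enter (s i) (rw i) (e i) x \<le> N - 1"
      proof (cases "x = s i")
        case True
        then show ?thesis using M(1)[of i] N by (simp add: enter_def)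
      next
        case False
        have "\<not> (s i \<le> x - 1 \<and> x - 1 < b i \<and> N \<le> e i (x - 1))"
          using not_less_Least[of "x - 1" "\<lambda>x. s i \<le> x \<and> x < b i \<and> N \<le> e i x"] x False by (simp add: x_def)
        then show ?thesis using x False by (auto simp: enter_def)
      qed
      moreover have "N - 1 < e i x" using x N M(1)[of i] by linarith
      ultimately have "i \<in> stored \<sigma> \<rho> x (N - 1 + x - n)" using e[OF iS, of x] x by blast
      then show "i \<in> (\<Union>x\<in>{..<n}. stored \<sigma> \<rho> x (N - 1 + x - n))" using x sb[OF iS] by auto
    qed
    then have "card (C N) \<le> card (\<Union>x\<in>{..<n}. stored \<sigma> \<rho> x (N - 1 + x - n))" by (intro card_mono) auto
    also have "\<dots> \<le> (\<Sum>x\<in>{..<n}. card (stored \<sigma> \<rho> x (N - 1 + x - n)))" by (intro card_UN_le) auto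
    also have "\<dots> \<le> (\<Sum>x\<in>{..<n}. B)" using f by (intro sum_mono) (auto simp: feasible_def)
    finally show ?thesis by (simp add: W_def)
  qed
  have "\<exists>g. inj_on g (C N) \<and> g ` C N \<subseteq> {..<W}" for N
  proof -
    have "finite (C N)" using finS by (simp add: C_def)
    then obtain g :: "nat \<Rightarrow> nat" where "bij_betw g (C N) {0..<card (C N)}" using ex_bij_betw_finite_nat by blast
    then show ?thesis using cardC[of N] by (intro exI[of _ g]) (auto simp: bij_betw_def)
  qed
  then obtain rk where rk: "\<And>N. inj_on (rk N) (C N)" "\<And>N. rk N ` C N \<subseteq> {..<W}" by metis
  \<comment> \<open>Below the window end the path is kept; from the crossing column on it runs in a
    row that is private among the packets of the window.\<close>
  define e' where "e' i x = (if e i x < M i then e i x else M i + rk (M i) i)" for i x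
  have late: "i \<in> C (M i) \<and> rk (M i) i < W" if "i \<in> S" "s i \<le> x" "x < b i" "\<not> e i x < M i" for i x
  proof -
    have "i \<in> C (M i)" using that by (auto simp: C_def)
    then show ?thesis using rk(2) by blast
  qed
  have e1: "enter (s i) (rw i) (e' i) x \<le> e' i x" if i: "i \<in> S" "s i \<le> x" "x < b i" for i x
    using e[OF i] M(1)[of i] by (auto simp: e'_def enter_def split: if_splits)
  have e2: "e' i x \<le> rw i + 2 * W" if i: "i \<in> S" "s i \<le> x" "x < b i" for i x
    using late[OF i] M(2)[of i] by (auto simp: e'_def)
  have window: "d div W * W = N" if "N \<le> d" "d < N + W" "N = q * W" for d N q
  proof -
    have "d div W = q" using that W0 by (intro div_nat_eqI) (auto simp: mult.commute)
    then show ?thesis using that by simp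
  qed
  have Mq: "\<exists>q. M i = q * W" for i unfolding M_def by blast
  have e3: "card {i \<in> S. s i \<le> x \<and> x < b i \<and> e' i x = d} \<le> 2 * c" for x d
  proof -
    let ?N = "d div W * W"
    \<comment> \<open>A row carries old traffic and at most one private path, and
      \<open>c + 1 \<le> 2 * c\<close>.\<close>
    have "{i \<in> S. s i \<le> x \<and> x < b i \<and> e' i x = d} \<subseteq> forwarded \<sigma> \<rho> x (d + x - n) \<union> {i \<in> C ?N. rk ?N i = d - ?N}"
    proof
      fix i assume "i \<in> {i \<in> S. s i \<le> x \<and> x < b i \<and> e' i x = d}"
      then have i: "i \<in> S" "s i \<le> x" "x < b i" "e' i x = d" by auto
      show "i \<in> forwarded \<sigma> \<rho> x (d + x - n) \<union> {i \<in> C ?N. rk ?N i = d - ?N}"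
      proof (cases "e i x < M i")
        case True
        then show ?thesis using e[OF i(1-3)] i(4) by (auto simp: e'_def)
      next
        case False
        then have d: "d = M i + rk (M i) i" using i(4) by (simp add: e'_def)
        obtain q where "M i = q * W" using Mq by blast
        then have "?N = M i" using d late[OF i(1-3) False] by (intro window) auto
        then show ?thesis using late[OF i(1-3) False] d by auto
      qed
    qed
    moreover have "finite {i \<in> C ?N. rk ?N i = d - ?N}" using finS by (simp add: C_def)
    ultimately have "card {i \<in> S. s i \<le> x \<and> x < b i \<and> e' i x = d} \<le> card (forwarded \<sigma> \<rho> x (d + x - n)) + card {i \<in> C ?N. rk ?N i = d - ?N}"
      by (meson card_Un_le card_mono finite_UnI finite_forwarded le_trans)
    moreover have "card {i \<in> C ?N. rk ?N i = d - ?N} \<le> 1"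
      using rk(1)[of ?N] \<open>finite {i \<in> C ?N. rk ?N i = d - ?N}\<close> unfolding One_nat_def
      by (subst card_le_Suc0_iff_eq) (auto simp: inj_on_def)
    moreover have "card (forwarded \<sigma> \<rho> x (d + x - n)) \<le> c" using f by (auto simp: feasible_def)
    ultimately show ?thesis using nB(3) by linarith
  qed
  have e4: "card {i \<in> S. s i \<le> x \<and> x < b i \<and> enter (s i) (rw i) (e' i) x \<le> d \<and> d < e' i x} \<le> 2 * B" for x d
  proof -
    let ?N = "d div W * W"
    \<comment> \<open>Beyond the window end a packet climbs only in its crossing column, where the
      original schedule stored it across row \<open>?N - 1\<close>; this costs another
      \<open>B\<close>.\<close>
    have "{i \<in> S. s i \<le> x \<and> x < b i \<and> enter (s i) (rw i) (e' i) x \<le> d \<and> d < e' i x}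
       \<subseteq> stored \<sigma> \<rho> x (d + x - n) \<union> stored \<sigma> \<rho> x (?N - 1 + x - n)"
    proof
      fix i assume "i \<in> {i \<in> S. s i \<le> x \<and> x < b i \<and> enter (s i) (rw i) (e' i) x \<le> d \<and> d < e' i x}"
      then have i: "i \<in> S" "s i \<le> x" "x < b i" and d: "enter (s i) (rw i) (e' i) x \<le> d" "d < e' i x" by auto
      have st: "i \<in> stored \<sigma> \<rho> x (y + x - n)" if "enter (s i) (rw i) (e i) x \<le> y" "y < e i x" for y
        using e[OF i] that by blast
      show "i \<in> stored \<sigma> \<rho> x (d + x - n) \<union> stored \<sigma> \<rho> x (?N - 1 + x - n)"
      proof (cases "d < M i")
        case True
        have "enter (s i) (rw i) (e i) x \<le> d" using d True by (auto simp: enter_def e'_def split: if_splits)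
        moreover have "d < e i x" using d True by (auto simp: e'_def split: if_splits)
        ultimately show ?thesis using st by blast
      next
        case False
        then have nl: "\<not> e i x < M i" using d(2) by (auto simp: e'_def)
        then have dd: "d < M i + rk (M i) i" using d(2) by (simp add: e'_def)
        obtain q where "M i = q * W" using Mq by blast
        then have N: "?N = M i" using dd late[OF i nl] False by (intro window) auto
        have "enter (s i) (rw i) (e i) x \<le> M i - 1"
        proof (cases "x = s i")
          case True
          then show ?thesis using M(1)[of i] by (simp add: enter_def)
        next
          case F: False
          then have "e' i (x - 1) \<le> d" using d by (simp add: enter_def)
          then have "e i (x - 1) < M i" using dd by (auto simp: e'_def split: if_splits)
          then show ?thesis using F by (simp add: enter_def)
        qed
        moreover have "M i - 1 < e i x" using nl M(1)[of i] by linarith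
        ultimately show ?thesis using st N by simp
      qed
    qed
    then have "card {i \<in> S. s i \<le> x \<and> x < b i \<and> enter (s i) (rw i) (e' i) x \<le> d \<and> d < e' i x}
       \<le> card (stored \<sigma> \<rho> x (d + x - n)) + card (stored \<sigma> \<rho> x (?N - 1 + x - n))"
      by (meson card_Un_le card_mono finite_UnI finite_stored le_trans)
    moreover have "card (stored \<sigma> \<rho> x y) \<le> B" for y using f by (auto simp: feasible_def)
    ultimately show ?thesis by (smt (verit) add_le_mono le_trans mult_2)
  qed
  have "(\<forall>i\<in>S. \<forall>x. s i \<le> x \<and> x < b i \<longrightarrow> enter (s i) (rw i) (e' i) x \<le> e' i x \<and> e' i x \<le> rw i + 2 * W) \<and>
     (\<forall>x d. card {i \<in> S. s i \<le> x \<and> x < b i \<and> e' i x = d} \<le> 2 * c) \<and>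
     (\<forall>x d. card {i \<in> S. s i \<le> x \<and> x < b i \<and> enter (s i) (rw i) (e' i) x \<le> d \<and> d < e' i x} \<le> 2 * B)"
    by (intro conjI ballI allI impI e3 e4; elim conjE; intro e1 e2; assumption)
  then show ?thesis unfolding s_def b_def rw_def W_def by (rule exI[of _ e'])
qed

text \<open>A tile spans two cells of length \<open>k\<close>; with an odd shift \<open>s\<close>
  the first tile is cut off at 0, hence only an upper bound.\<close>

lemma card_tile_le:
  fixes k s I :: nat assumes "0 < k"
  shows "finite {x. (x div k + s) div 2 = I} \<and> card {x. (x div k + s) div 2 = I} \<le> 2 * k"
proof (cases "{x. (x div k + s) div 2 = I} = {}")
  case False
  then have ex: "\<exists>x. (x div k + s) div 2 = I" by blast
  define y where "y = (LEAST x. (x div k + s) div 2 = I)"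
  have y: "(y div k + s) div 2 = I" unfolding y_def by (rule LeastI_ex[OF ex])
  have sub: "{x. (x div k + s) div 2 = I} \<subseteq> {y..<y + 2 * k}"
  proof
    fix x assume x: "x \<in> {x. (x div k + s) div 2 = I}"
    then have "y \<le> x" unfolding y_def by (intro Least_le) simp
    moreover have "x < y + 2 * k"
    proof (rule ccontr)
      assume "\<not> x < y + 2 * k"
      then have "(y + 2 * k) div k \<le> x div k" by (intro div_le_mono) simp
      then have "y div k + 2 \<le> x div k" using assms by simp
      then have "(y div k + s + 2) div 2 \<le> (x div k + s) div 2" by (intro div_le_mono) simp
      then show False using x y by simp
    qed
    ultimately show "x \<in> {y..<y + 2 * k}" by simp
  qed
  then have "finite {x. (x div k + s) div 2 = I}" by (rule finite_subset) simp
  moreover have "card {x. (x div k + s) div 2 = I} \<le> card {y..<y + 2 * k}" by (rule card_mono[OF _ sub]) simp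
  ultimately show ?thesis by simp
qed auto

lemma tile_last:
  fixes k s I :: nat assumes "0 < k" "(0 div k + s) div 2 \<le> I"
  shows "\<exists>l. \<forall>x. (x div k + s) div 2 \<le> I \<longleftrightarrow> x \<le> l"
proof -
  let ?A = "{x. (x div k + s) div 2 \<le> I}"
  have sub: "?A \<subseteq> {..(2 * I + 2) * k}"
  proof
    fix x assume "x \<in> ?A"
    then have "x div k < 2 * I + 2" by auto
    then have "x < (2 * I + 2) * k" using assms(1) by (simp only: div_less_iff_less_mult)
    then show "x \<in> {..(2 * I + 2) * k}" by simp
  qed
  have fin: "finite ?A" by (rule finite_subset[OF sub]) simp
  have "0 \<in> ?A" using assms(2) by simp
  then have "Max ?A \<in> ?A" using Max_in[OF fin] by blast
  then have m: "(Max ?A div k + s) div 2 \<le> I" by simp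
  show ?thesis
  proof (intro exI allI iffI)
    fix x assume "(x div k + s) div 2 \<le> I" then show "x \<le> Max ?A" using fin by simp
  next
    fix x assume "x \<le> Max ?A"
    then have "(x div k + s) div 2 \<le> (Max ?A div k + s) div 2" by (intro div_le_mono add_right_mono)
    then show "(x div k + s) div 2 \<le> I" using m by simp
  qed
qed

section \<open>Comparison of the optimum with tile paths\<close>

context far_input
begin

text \<open>The coarse path leaves a tile column in the tile row in which the detailed path leaves
  the last node column of it. A tile edge then carries at most the packets of \<open>2 * h\<close>
  horizontal edges with load \<open>2 * c\<close> or of \<open>2 * w\<close> vertical edges with
  load \<open>2 * B\<close>, both \<open>4 * (w * B)\<close>.\<close>

lemma tile_paths:
  assumes f: "feasible B c \<sigma> \<rho>" and pos: "0 < n" "0 < B" "0 < c" and K: "2 * (n * B) \<le> K"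
  defines "S \<equiv> {i. i < length \<sigma> \<and> delivered \<sigma> \<rho> i \<and> src (\<sigma> ! i) < dst (\<sigma> ! i)}"
  shows "\<exists>z. (\<forall>i\<in>S. \<forall>I. TI (src (\<sigma> ! i)) \<le> I \<and> I < TI (dst (\<sigma> ! i)) \<longrightarrow>
        enter (TI (src (\<sigma> ! i))) (TJ (row_of n (\<sigma> ! i))) (z i) I \<le> z i I \<and> z i I \<le> TJ (row_of n (\<sigma> ! i)) + K) \<and>
     (\<forall>a. card {i \<in> S. a \<in> edges (\<sigma> ! i, True, z i)} \<le> 4 * (w * B))"
proof -
  obtain e where e: "\<And>i x. i \<in> S \<Longrightarrow> src (\<sigma> ! i) \<le> x \<Longrightarrow> x < dst (\<sigma> ! i) \<Longrightarrow>
        enter (src (\<sigma> ! i)) (row_of n (\<sigma> ! i)) (e i) x \<le> e i x \<and> e i x \<le> row_of n (\<sigma> ! i) + 2 * (n * B)"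
    and eh: "\<And>x d. card {i \<in> S. src (\<sigma> ! i) \<le> x \<and> x < dst (\<sigma> ! i) \<and> e i x = d} \<le> 2 * c"
    and ev: "\<And>x d. card {i \<in> S. src (\<sigma> ! i) \<le> x \<and> x < dst (\<sigma> ! i) \<and>
         enter (src (\<sigma> ! i)) (row_of n (\<sigma> ! i)) (e i) x \<le> d \<and> d < e i x} \<le> 2 * B"
    using short_paths[OF valid f pos] unfolding S_def by blast
  have finS: "finite S" by (simp add: S_def)
  have mono: "e i x \<le> e i y" if "i \<in> S" "src (\<sigma> ! i) \<le> x" "x \<le> y" "y < dst (\<sigma> ! i)" for i x y
    using that(3,4)
  proof (induction y rule: dec_induct)
    case (step y)
    then show ?case using e[OF that(1), of "Suc y"] that(2) by (auto simp: enter_def split: if_splits)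
  qed simp
  have ge: "row_of n (\<sigma> ! i) \<le> e i y" if "i \<in> S" "src (\<sigma> ! i) \<le> y" "y < dst (\<sigma> ! i)" for i y
    using mono[OF that(1) order_refl that(2,3)] e[OF that(1), of "src (\<sigma> ! i)"] that by (simp add: enter_def)
  have "\<forall>I. \<exists>l. TI 0 \<le> I \<longrightarrow> (\<forall>x. TI x \<le> I \<longleftrightarrow> x \<le> l)"
    using tile_last[OF w0, of sx] by (simp add: TI_def XC_def)
  then obtain last where last: "\<And>I x. TI 0 \<le> I \<Longrightarrow> TI x \<le> I \<longleftrightarrow> x \<le> last I" by metis
  have last': "TI x \<le> I \<longleftrightarrow> x \<le> last I" if "TI a \<le> I" for x I a
    using last[of I x] TI_mono[of 0 a] that by simp
  define z where "z i I = TJ (e i (last I))" for i I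
  have col: "src (\<sigma> ! i) \<le> last I \<and> last I < dst (\<sigma> ! i)" if "TI (src (\<sigma> ! i)) \<le> I" "I < TI (dst (\<sigma> ! i))" for i I
    using last'[OF that(1)] that by (meson not_le)
  have z1: "enter (TI (src (\<sigma> ! i))) (TJ (row_of n (\<sigma> ! i))) (z i) I \<le> z i I \<and> z i I \<le> TJ (row_of n (\<sigma> ! i)) + K"
    if i: "i \<in> S" "TI (src (\<sigma> ! i)) \<le> I" "I < TI (dst (\<sigma> ! i))" for i I
  proof -
    let ?r = "row_of n (\<sigma> ! i)"
    have c: "src (\<sigma> ! i) \<le> last I" "last I < dst (\<sigma> ! i)" using col[OF i(2,3)] by auto
    have "enter (TI (src (\<sigma> ! i))) (TJ ?r) (z i) I \<le> z i I"
    proof (cases "I = TI (src (\<sigma> ! i))")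
      case True
      then show ?thesis using ge[OF i(1) c] by (simp add: enter_def z_def TJ_mono)
    next
      case False
      then have I1: "TI (src (\<sigma> ! i)) \<le> I - 1" "I - 1 < TI (dst (\<sigma> ! i))" using i by auto
      have "last (I - 1) \<le> last I"
        using last'[OF I1(1), of "last (I - 1)"] last'[OF i(2), of "last (I - 1)"]
        by (metis diff_le_self le_trans order_refl)
      then have "e i (last (I - 1)) \<le> e i (last I)" using mono[OF i(1)] col[OF I1] c by blast
      then show ?thesis using False by (simp add: enter_def z_def TJ_mono)
    qed
    moreover have "z i I \<le> TJ ?r + K"
    proof -
      have "e i (last I) \<le> ?r + K" using e[OF i(1) c] K by simp
      then have "z i I \<le> TJ (?r + K)" by (simp add: z_def TJ_mono)
      also have "\<dots> \<le> TJ ?r + K"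
      proof -
        have "(?r + K) div h \<le> (?r + K * h) div h" using h0 by (intro div_le_mono) simp
        then have "(?r + K) div h \<le> ?r div h + K" using h0 by simp
        then have "YC (?r + K) div 2 \<le> (YC ?r + K) div 2" by (intro div_le_mono) (simp add: YC_def)
        also have "\<dots> \<le> (YC ?r + K * 2) div 2" by (intro div_le_mono) simp
        finally show ?thesis by (simp add: TJ_def)
      qed
      finally show ?thesis .
    qed
    ultimately show ?thesis by simp
  qed
  have bound: "card {i \<in> S. Q i} \<le> 2 * u * (2 * t)"
    if "{i \<in> S. Q i} \<subseteq> (\<Union>x\<in>{x. (x div u + v) div 2 = I}. {i \<in> S. Q' x i})" "0 < u"
      "\<And>x. card {i \<in> S. Q' x i} \<le> 2 * t" for Q Q' u v I t
  proof -
    let ?X = "{x. (x div u + v) div 2 = I}"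
    have X: "finite ?X" "card ?X \<le> 2 * u" using card_tile_le[OF that(2), of v I] by auto
    have "card {i \<in> S. Q i} \<le> card (\<Union>x\<in>?X. {i \<in> S. Q' x i})"
      using finS X by (intro card_mono that(1)) auto
    also have "\<dots> \<le> (\<Sum>x\<in>?X. card {i \<in> S. Q' x i})" by (rule card_UN_le[OF X(1)])
    also have "\<dots> \<le> (\<Sum>x\<in>?X. 2 * t)" by (intro sum_mono that(3))
    also have "\<dots> = card ?X * (2 * t)" by simp
    also have "\<dots> \<le> 2 * u * (2 * t)" by (intro mult_le_mono1 X(2))
    finally show ?thesis .
  qed
  have z2: "card {i \<in> S. a \<in> edges (\<sigma> ! i, True, z i)} \<le> 4 * (w * B)" for a
  proof -
    obtain dir I L where a: "a = (dir, I, L)" by (cases a)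
    show ?thesis
    proof (cases dir)
      case False
      have "card {i \<in> S. a \<in> edges (\<sigma> ! i, True, z i)} \<le> 2 * h * (2 * c)"
      proof (rule bound[where Q' = "\<lambda>d i. src (\<sigma> ! i) \<le> last I \<and> last I < dst (\<sigma> ! i) \<and> e i (last I) = d", OF _ h0 eh])
        show "{i \<in> S. a \<in> edges (\<sigma> ! i, True, z i)} \<subseteq> (\<Union>x\<in>{x. (x div h + sd) div 2 = L}.
            {i \<in> S. src (\<sigma> ! i) \<le> last I \<and> last I < dst (\<sigma> ! i) \<and> e i (last I) = x})"
          using a False col by (auto simp: z_def TJ_def YC_def)
      qed
      then show ?thesis using wh by (simp add: mult_ac)
    next
      case True
      show ?thesis
      proof (cases "{i \<in> S. a \<in> edges (\<sigma> ! i, True, z i)} = {}")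
        case True then show ?thesis by (simp only: card.empty)
      next
        case ne: False
        have mem: "TI (src (\<sigma> ! i)) \<le> I \<and> I < TI (dst (\<sigma> ! i)) \<and>
            enter (TI (src (\<sigma> ! i))) (TJ (row_of n (\<sigma> ! i))) (z i) I \<le> L \<and> L < z i I"
          if "i \<in> S" "a \<in> edges (\<sigma> ! i, True, z i)" for i
          using that a True by auto
        have L0: "TJ 0 \<le> L"
        proof -
          obtain i where i: "i \<in> S" "a \<in> edges (\<sigma> ! i, True, z i)" using ne by blast
          note m = mem[OF i]
          show ?thesis
          proof (cases "I = TI (src (\<sigma> ! i))")
            case True
            then show ?thesis using m TJ_mono[of 0 "row_of n (\<sigma> ! i)"] by (simp add: enter_def)
          next
            case False
            then show ?thesis using m TJ_mono[of 0 "e i (last (I - 1))"] by (simp add: enter_def z_def)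
          qed
        qed
        \<comment> \<open>Row \<open>d\<close> is the top row of tile row \<open>L\<close>; a path
          using the vertical tile edge has to climb above it inside tile column
          \<open>I\<close>.\<close>
        obtain d where "\<And>x. TJ x \<le> L \<longleftrightarrow> x \<le> d"
          using tile_last[OF h0, of sd L] L0 by (auto simp: TJ_def YC_def)
        then have d: "TJ x \<le> L \<longleftrightarrow> x \<le> d" for x by blast
        have "card {i \<in> S. a \<in> edges (\<sigma> ! i, True, z i)} \<le> 2 * w * (2 * B)"
        proof (rule bound[where Q' = "\<lambda>x i. src (\<sigma> ! i) \<le> x \<and> x < dst (\<sigma> ! i) \<and>
             enter (src (\<sigma> ! i)) (row_of n (\<sigma> ! i)) (e i) x \<le> d \<and> d < e i x", OF _ w0 ev])
          show "{i \<in> S. a \<in> edges (\<sigma> ! i, True, z i)} \<subseteq> (\<Union>x\<in>{x. (x div w + sx) div 2 = I}.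
              {i \<in> S. src (\<sigma> ! i) \<le> x \<and> x < dst (\<sigma> ! i) \<and>
                 enter (src (\<sigma> ! i)) (row_of n (\<sigma> ! i)) (e i) x \<le> d \<and> d < e i x})"
          proof
            fix i assume "i \<in> {i \<in> S. a \<in> edges (\<sigma> ! i, True, z i)}"
            then have i: "i \<in> S" "a \<in> edges (\<sigma> ! i, True, z i)" by auto
            note m = mem[OF i]
            \<comment> \<open>The node column in which the path enters tile column
              \<open>I\<close>.\<close>
            define p where "p = (if I = TI (src (\<sigma> ! i)) then src (\<sigma> ! i) else Suc (last (I - 1)))"
            have up: "d < e i (last I)" using m d[of "e i (last I)"] by (simp add: z_def)
            have p: "src (\<sigma> ! i) \<le> p \<and> p \<le> last I \<and> I \<le> TI p \<and> enter (src (\<sigma> ! i)) (row_of n (\<sigma> ! i)) (e i) p \<le> d"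
            proof (cases "I = TI (src (\<sigma> ! i))")
              case True
              then show ?thesis using m d[of "row_of n (\<sigma> ! i)"] col by (simp add: p_def enter_def)
            next
              case False
              then have I1: "TI (src (\<sigma> ! i)) \<le> I - 1" "I - 1 < TI (dst (\<sigma> ! i))" using m by auto
              note c1 = col[OF I1]
              have "e i (last (I - 1)) \<le> d" using m d[of "e i (last (I - 1))"] False by (simp add: enter_def z_def)
              moreover have "last (I - 1) < last I"
              proof (rule ccontr)
                assume "\<not> last (I - 1) < last I"
                then have "e i (last I) \<le> e i (last (I - 1))"
                  using mono[OF i(1), of "last I" "last (I - 1)"] col[of i I] m c1 by simp
                then show False using up calculation by simp
              qed
              moreover have "\<not> TI (Suc (last (I - 1))) \<le> I - 1" using last'[OF I1(1)] by simp
              ultimately show ?thesis using c1 False by (simp add: p_def enter_def)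
            qed
            \<comment> \<open>The first column from \<open>p\<close> on that is left above row
              \<open>d\<close>, hence the one in which that row is crossed.\<close>
            define x where "x = (LEAST x. p \<le> x \<and> d < e i x)"
            have x: "p \<le> x" "d < e i x" "x \<le> last I"
              using LeastI[of "\<lambda>x. p \<le> x \<and> d < e i x" "last I"] Least_le[of "\<lambda>x. p \<le> x \<and> d < e i x" "last I"] p up
              by (auto simp: x_def)
            have "TI x = I" using last'[of "src (\<sigma> ! i)" I x] m x p TI_mono[of p x] by simp
            moreover have "enter (src (\<sigma> ! i)) (row_of n (\<sigma> ! i)) (e i) x \<le> d"
            proof (cases "x = p")
              case False
              then have "\<not> (p \<le> x - 1 \<and> d < e i (x - 1))"
                using not_less_Least[of "x - 1" "\<lambda>x. p \<le> x \<and> d < e i x"] x by (simp add: x_def)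
              then show ?thesis using x False p by (auto simp: enter_def)
            qed (use p in simp)
            moreover have "src (\<sigma> ! i) \<le> x" "x < dst (\<sigma> ! i)" using p x col[of i I] m by auto
            ultimately show "i \<in> (\<Union>x\<in>{x. (x div w + sx) div 2 = I}.
              {i \<in> S. src (\<sigma> ! i) \<le> x \<and> x < dst (\<sigma> ! i) \<and>
                 enter (src (\<sigma> ! i)) (row_of n (\<sigma> ! i)) (e i) x \<le> d \<and> d < e i x})"
              using x i by (auto simp: TI_def XC_def)
          qed
        qed
        then show ?thesis by (simp add: mult_ac)
      qed
    qed
  qed
  have "(\<forall>i\<in>S. \<forall>I. TI (src (\<sigma> ! i)) \<le> I \<and> I < TI (dst (\<sigma> ! i)) \<longrightarrow>
        enter (TI (src (\<sigma> ! i))) (TJ (row_of n (\<sigma> ! i))) (z i) I \<le> z i I \<and> z i I \<le> TJ (row_of n (\<sigma> ! i)) + K) \<and>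
     (\<forall>a. card {i \<in> S. a \<in> edges (\<sigma> ! i, True, z i)} \<le> 4 * (w * B))"
    by (intro conjI ballI allI impI z2; elim conjE; intro z1[THEN conjunct1] z1[THEN conjunct2]; assumption)
  then show ?thesis by (rule exI[of _ z])
qed

text \<open>A lost request with an expensive tile path is paid by \<open>rejected_by_price\<close>
  with \<open>L = 4 * (w * B)\<close>. If its tile path was cheap, both local tests failed:
  \<open>B\<close> accepted packets block its column and \<open>c\<close> its row, which matches the
  at most \<open>B + c\<close> optimal packets that start at the same point.\<close>

lemma far_competitive:
  assumes f: "feasible B c \<sigma> \<rho>" and pos: "0 < n" "0 < B" "0 < c" and K: "2 * (n * B) \<le> K"
  shows "real m * real (card {i. i < length \<sigma> \<and> delivered \<sigma> \<rho> i \<and> src (\<sigma> ! i) + 2 * w \<le> dst (\<sigma> ! i) \<and>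
            even (XC (src (\<sigma> ! i))) \<and> even (YC (row_of n (\<sigma> ! i)))})
     \<le> (real m + 8 * real (w * B) + real m * 2 * real (max w h)) * real (throughput \<sigma> (far_alg m P K \<sigma>))"
    (is "_ * real (card ?R) \<le> _")
proof -
  let ?pl = "plan D \<sigma>"
  define S where "S = {i. i < length \<sigma> \<and> delivered \<sigma> \<rho> i \<and> src (\<sigma> ! i) < dst (\<sigma> ! i)}"
  obtain z where z1: "\<And>i I. i \<in> S \<Longrightarrow> TI (src (\<sigma> ! i)) \<le> I \<and> I < TI (dst (\<sigma> ! i)) \<Longrightarrow>
        enter (TI (src (\<sigma> ! i))) (TJ (row_of n (\<sigma> ! i))) (z i) I \<le> z i I \<and> z i I \<le> TJ (row_of n (\<sigma> ! i)) + K"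
    and z2: "\<And>a. card {i \<in> S. a \<in> edges (\<sigma> ! i, True, z i)} \<le> 4 * (w * B)"
    using tile_paths[OF f pos K] unfolding S_def by blast
  define M where "M = {j. \<exists>v. ?pl j = Some v}"
  have finM: "finite M" using finite_plan[of D \<sigma> "\<lambda>_ _. True"] by (simp add: M_def)
  have cntM: "cnt ?pl (\<lambda>_. True) = card M" by (simp add: cnt_def M_def)
  have thr: "card M \<le> throughput \<sigma> (far_alg m P K \<sigma>)"
    unfolding throughput_def
  proof (rule card_mono)
    show "M \<subseteq> {i. i < length \<sigma> \<and> delivered \<sigma> (far_alg m P K \<sigma>) i}"
    proof
      fix i assume "i \<in> M"
      then obtain v where "?pl i = Some v" unfolding M_def by blast
      then show "i \<in> {i. i < length \<sigma> \<and> delivered \<sigma> (far_alg m P K \<sigma>) i}"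
        using far_delivered far_plan_Some(1) by (simp add: far_alg_def)
    qed
  qed simp
  let ?cost = "\<lambda>i. \<Sum>a\<in>edges (\<sigma> ! i, True, z i). price m P (load i a)"
  define Rc where "Rc = {i \<in> ?R. ?pl i = None \<and> 1 \<le> ?cost i}"
  define Rl where "Rl = {i \<in> ?R. ?pl i = None \<and> \<not> 1 \<le> ?cost i}"
  have fin: "finite ?R" "finite Rc" "finite Rl" by (auto simp: Rc_def Rl_def)
  have RS: "?R \<subseteq> S" using w0 by (auto simp: S_def)
  have "real m * real (card Rc) \<le> 2 * real (4 * (w * B)) * real (cnt ?pl (\<lambda>_. True))"
  proof (rule rejected_by_price[OF fin(2)])
    show "i < length \<sigma> \<and> finite (edges (\<sigma> ! i, True, z i)) \<and> 1 \<le> ?cost i" if "i \<in> Rc" for i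
      using that by (simp add: Rc_def del: edges.simps)
    fix a
    have "card {i \<in> Rc. a \<in> edges (\<sigma> ! i, True, z i)} \<le> card {i \<in> S. a \<in> edges (\<sigma> ! i, True, z i)}"
      using RS by (intro card_mono) (auto simp: S_def Rc_def simp del: edges.simps)
    then show "card {i \<in> Rc. a \<in> edges (\<sigma> ! i, True, z i)} \<le> 4 * (w * B)" using z2[of a] by linarith
  qed
  then have 1: "real m * real (card Rc) \<le> 8 * real (w * B) * real (card M)" by (simp add: cntM)
  let ?N = "\<lambda>p j. case the (?pl j) of (r, \<delta>, _) \<Rightarrow>
     if \<delta> then src r = fst p \<and> YC (row_of n r) = YC (snd p) else XC (src r) = XC (fst p) \<and> row_of n r = snd p"
  have 2: "card Rl \<le> 1 * (2 * max w h) * card M"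
  proof (rule charging_bound[OF fin(3) finM, where F = "\<lambda>i. (src (\<sigma> ! i), row_of n (\<sigma> ! i))" and K = "B + c" and N = ?N])
    fix p assume "p \<in> (\<lambda>i. (src (\<sigma> ! i), row_of n (\<sigma> ! i))) ` Rl"
    then obtain i where i: "i \<in> Rl" and p: "p = (src (\<sigma> ! i), row_of n (\<sigma> ! i))" by auto
    have "card {j \<in> Rl. (src (\<sigma> ! j), row_of n (\<sigma> ! j)) = p} \<le>
       card {j. j < length \<sigma> \<and> delivered \<sigma> \<rho> j \<and> src (\<sigma> ! j) = fst p \<and> fst p < dst (\<sigma> ! j) \<and>
            row_of n (\<sigma> ! j) div 1 = snd p}"
      using w0 by (intro card_mono) (auto simp: Rl_def)
    also have "\<dots> \<le> 1 * c + B" by (rule card_sources_le[OF valid f]) simp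
    finally have A: "card {j \<in> Rl. (src (\<sigma> ! j), row_of n (\<sigma> ! j)) = p} \<le> 1 * (B + c)" by simp
    have il: "i < length \<sigma>" and none: "?pl i = None" and iS: "i \<in> S" and
      ir: "src (\<sigma> ! i) + 2 * w \<le> dst (\<sigma> ! i)" "even (XC (src (\<sigma> ! i)))" "even (YC (row_of n (\<sigma> ! i)))"
      and cost: "?cost i < 1"
      using i RS by (auto simp: Rl_def simp del: edges.simps)
    let ?H = "build D \<sigma> i"
    have no: "\<not> far_ok m P K ?H (\<sigma> ! i, \<delta>, z i)" for \<delta>
    proof
      assume "far_ok m P K ?H (\<sigma> ! i, \<delta>, z i)"
      then have "\<exists>v. far_ok m P K ?H v \<and> fst v = \<sigma> ! i" by (intro exI[of _ "(\<sigma> ! i, \<delta>, z i)"]) simp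
      then have "far_decide m P K ?H (\<sigma> ! i) \<noteq> None" unfolding far_decide_def[of m P K ?H] by (simp only: if_True) simp
      then show False using none plan_nth[OF il, of D] by simp
    qed
    let ?qu = "\<lambda>(r', \<delta>', _). \<delta>' \<and> src r' = src (\<sigma> ! i) \<and> YC (row_of n r') = YC (row_of n (\<sigma> ! i))"
    let ?qr = "\<lambda>(r', \<delta>', _). \<not> \<delta>' \<and> XC (src r') = XC (src (\<sigma> ! i)) \<and> row_of n r' = row_of n (\<sigma> ! i)"
    have "B \<le> cnt ?H ?qu"
    proof (rule ccontr)
      assume "\<not> ?thesis"
      then have "far_ok m P K ?H (\<sigma> ! i, True, z i)"
        using ir cost z1[OF iS] by (simp del: edges.simps)
      then show False using no by blast
    qed
    moreover have "c \<le> cnt ?H ?qr"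
    proof (rule ccontr)
      assume "\<not> ?thesis"
      moreover have "edges (\<sigma> ! i, False, z i) = edges (\<sigma> ! i, True, z i)" by simp
      ultimately have "far_ok m P K ?H (\<sigma> ! i, False, z i)"
        using ir cost z1[OF iS] by (simp del: edges.simps)
      then show False using no by blast
    qed
    moreover have "cnt ?H Q \<le> cnt ?pl Q" for Q using il by (intro cnt_build_le) simp
    ultimately have "B + c \<le> cnt ?pl ?qu + cnt ?pl ?qr" by (meson add_mono le_trans)
    also have "\<dots> = card ({j. \<exists>v. ?pl j = Some v \<and> ?qu v} \<union> {j. \<exists>v. ?pl j = Some v \<and> ?qr v})"
      unfolding cnt_def by (intro card_Un_disjoint[symmetric] finite_plan) auto
    also have "\<dots> \<le> card {j \<in> M. ?N p j}"
      using finM by (intro card_mono) (auto simp: M_def p)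
    finally show "card {j \<in> Rl. (src (\<sigma> ! j), row_of n (\<sigma> ! j)) = p} \<le> 1 * (B + c) \<and> B + c \<le> card {j \<in> M. ?N p j}"
      using A by blast
  next
    fix j assume "j \<in> M"
    then obtain r \<delta> zj where j: "?pl j = Some (r, \<delta>, zj)" by (auto simp: M_def)
    let ?A = "{p \<in> (\<lambda>i. (src (\<sigma> ! i), row_of n (\<sigma> ! i))) ` Rl. ?N p j}"
    show "card ?A \<le> 2 * max w h"
    proof (cases \<delta>)
      case True
      \<comment> \<open>The blocked points lie on one line of a cell; counting this line in the
        whole tile loses a factor 2.\<close>
      let ?Y = "{y. (y div h + sd) div 2 = TJ (row_of n r)}"
      have Y: "finite ?Y" "card ?Y \<le> 2 * h" using card_tile_le[OF h0, of sd "TJ (row_of n r)"] by auto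
      have "?A \<subseteq> {src r} \<times> ?Y" using j True by (auto simp: TJ_def YC_def)
      then have "card ?A \<le> card ({src r} \<times> ?Y)" using Y by (intro card_mono) auto
      then show ?thesis using Y by (simp add: card_cartesian_product)
    next
      case False
      let ?Y = "{y. (y div w + sx) div 2 = TI (src r)}"
      have Y: "finite ?Y" "card ?Y \<le> 2 * w" using card_tile_le[OF w0, of sx "TI (src r)"] by auto
      have "?A \<subseteq> ?Y \<times> {row_of n r}" using j False by (auto simp: TI_def XC_def)
      then have "card ?A \<le> card (?Y \<times> {row_of n r})" using Y by (intro card_mono) auto
      then show ?thesis using Y by (simp add: card_cartesian_product)
    qed
  qed
  have "?R \<subseteq> M \<union> Rc \<union> Rl"
  proof
    fix i assume "i \<in> ?R"
    then show "i \<in> M \<union> Rc \<union> Rl" by (cases "?pl i") (simp_all add: M_def Rc_def Rl_def del: edges.simps split_paired_Ex)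
  qed
  then have "card ?R \<le> card (M \<union> Rc \<union> Rl)" using finM fin by (intro card_mono) auto
  also have "\<dots> \<le> card M + card Rc + card Rl" by (meson add_le_mono card_Un_le le_trans order_refl)
  finally have "real (card ?R) \<le> real (card M) + real (card Rc) + real (card Rl)" by linarith
  then have "real m * real (card ?R) \<le> real m * (real (card M) + real (card Rc) + real (card Rl))"
    by (intro mult_left_mono) auto
  also have "\<dots> = real m * real (card M) + real m * real (card Rc) + real m * real (card Rl)"
    by (simp add: algebra_simps)
  also have "\<dots> \<le> real m * real (card M) + 8 * real (w * B) * real (card M) + real m * (2 * real (max w h) * real (card M))"
  proof -
    have "real (card Rl) \<le> real (1 * (2 * max w h) * card M)" using 2 of_nat_le_iff by blast
    then have "real m * real (card Rl) \<le> real m * (2 * real (max w h) * real (card M))"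
      by (intro mult_left_mono) simp_all
    then show ?thesis using 1 by linarith
  qed
  also have "\<dots> = (real m + 8 * real (w * B) + real m * 2 * real (max w h)) * real (card M)"
    by (simp add: algebra_simps)
  also have "\<dots> \<le> (real m + 8 * real (w * B) + real m * 2 * real (max w h)) * real (throughput \<sigma> (far_alg m P K \<sigma>))"
    using thr by (intro mult_left_mono) auto
  finally show ?thesis .
qed

end

lemma OPT_attained:
  assumes "feasible B c \<sigma> \<rho>0"
  shows "\<exists>\<rho>. feasible B c \<sigma> \<rho> \<and> OPT B c \<sigma> = throughput \<sigma> \<rho>"
proof -
  let ?A = "{throughput \<sigma> \<rho> |\<rho>. feasible B c \<sigma> \<rho>}"
  have "throughput \<sigma> \<rho> \<le> length \<sigma>" for \<rho>
    using card_mono[of "{..<length \<sigma>}" "{i. i < length \<sigma> \<and> delivered \<sigma> \<rho> i}"] by (auto simp: throughput_def)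
  then have "?A \<subseteq> {..length \<sigma>}" by auto
  then have "finite ?A" by (rule finite_subset) simp
  moreover have "?A \<noteq> {}" using assms by auto
  ultimately have "Max ?A \<in> ?A" by (rule Max_in)
  then show ?thesis by (auto simp: OPT_def)
qed

section \<open>The randomized algorithm\<close>

text \<open>The two bits of \<open>j\<close> shift the cell indices and so select the source cells.
  \<open>2 * (c * q)\<close> separates near from far, and \<open>B / c\<close> rounded up gives just
  enough rows to carry \<open>B\<close> packets.\<close>

definition class_alg :: "nat \<Rightarrow> nat \<Rightarrow> nat \<Rightarrow> nat \<Rightarrow> nat \<Rightarrow> nat \<Rightarrow> nat \<Rightarrow> nat \<Rightarrow> request list \<Rightarrow> run" where
  "class_alg n B c q m P K j =
     (if j < 4 then grid.far_alg n B c (c * q) (B * q) (j mod 2) (j div 2) m P K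
      else near_alg n B c (2 * (c * q)) ((B + c - 1) div c))"

text \<open>The side capacity \<open>c * q * B\<close> must exceed \<open>3 * (m * k)\<close> for
  the routing, yet stay within a constant factor of \<open>m * k\<close> for the price argument; the
  lengths \<open>c * q\<close> and \<open>B * q\<close> enter the ratio directly.\<close>

locale algorithm_params =
  fixes n B c q m P K k :: nat
  assumes pos: "0 < n" "0 < B" "0 < c" "0 < q" "0 < m" "0 < k"
    and K: "2 * (n * B) \<le> K" and P: "2 * (n + 1) * (K + 1) \<le> P" and k: "P + 1 \<le> 2 ^ k"
    and mk: "3 * (m * k) < c * q * B" and qm: "c * q * B \<le> 10 * (m * k)"
    and wk: "c * q \<le> 6 * k" and hk: "B * q \<le> 6 * k"
begin

abbreviation "alg \<equiv> class_alg n B c q m P K"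

lemma far_locale:
  assumes "j < 4"
  shows "far n B c (c * q) (B * q) (j mod 2) m P K k"
proof
  have "2 * (n + j mod 2) * (K + 1) \<le> 2 * (n + 1) * (K + 1)" by (intro mult_le_mono) auto
  then show "2 * (n + j mod 2) * (K + 1) \<le> P" using P by linarith
qed (use pos k mk in \<open>auto simp: mult_ac\<close>)

lemma far_input_locale:
  assumes "j < 4" "valid_input n \<sigma>"
  shows "far_input n B c (c * q) (B * q) (j mod 2) m P K k \<sigma>"
proof -
  have "0 < P" using P by (cases P) auto
  then show ?thesis
    using far_locale[OF assms(1)] assms(2) by (simp add: far_input_def far_input_axioms_def)
qed

lemma near_params:
  defines "g \<equiv> (B + c - 1) div c"
  shows "0 < g" "g = 1 \<Longrightarrow> B \<le> c" "B \<le> g * c" "1 \<le> c" "g * c \<le> B + c"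
proof -
  have "B + c - 1 = g * c + (B + c - 1) mod c" by (simp add: g_def)
  moreover have "(B + c - 1) mod c < c" using pos by simp
  ultimately show "B \<le> g * c" "g * c \<le> B + c" using pos by linarith+
  then show "0 < g" "g = 1 \<Longrightarrow> B \<le> c" "1 \<le> c" using pos by (cases g; simp)+
qed

lemma alg_ok:
  shows "online n (alg j)"
    and "valid_input n \<sigma> \<Longrightarrow> feasible B c \<sigma> (alg j \<sigma>) \<and> nonpreemptive \<sigma> (alg j \<sigma>)"
proof -
  show "online n (alg j)"
    by (simp add: class_alg_def near_online grid.far_online)
  assume v: "valid_input n \<sigma>"
  show "feasible B c \<sigma> (alg j \<sigma>) \<and> nonpreemptive \<sigma> (alg j \<sigma>)"
  proof (cases "j < 4")
    case True
    interpret far_input n B c "c * q" "B * q" "j mod 2" "j div 2" m P K k \<sigma>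
      by (rule far_input_locale[OF True v])
    show ?thesis using True far_feasible far_nonpreemptive by (simp add: class_alg_def far_alg_def)
  next
    case False
    then show ?thesis using near_feasible[OF v] near_nonpreemptive by (simp add: class_alg_def)
  qed
qed

lemma near_bound:
  assumes v: "valid_input n \<sigma>" and f: "feasible B c \<sigma> \<rho>"
  shows "real (card {i. i < length \<sigma> \<and> delivered \<sigma> \<rho> i \<and> dst (\<sigma> ! i) < src (\<sigma> ! i) + 2 * (c * q)})
    \<le> 217 * real k * real (throughput \<sigma> (alg 4 \<sigma>))" (is "real (card ?N) \<le> _")
proof -
  have "card ?N \<le> (1 + 18 * (2 * (c * q))) * throughput \<sigma> (alg 4 \<sigma>)"
    using near_competitive[OF v f near_params, of "2 * (c * q)"] by (simp add: class_alg_def)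
  \<comment> \<open>216 is \<open>18 * 2 * 6\<close> by \<open>wk\<close>; the remaining 1 is
    absorbed by \<open>0 < k\<close>.\<close>
  also have "\<dots> \<le> (217 * k) * throughput \<sigma> (alg 4 \<sigma>)"
    using wk pos by (intro mult_le_mono1) linarith
  finally have "real (card ?N) \<le> real (217 * k * throughput \<sigma> (alg 4 \<sigma>))" by (rule of_nat_mono)
  then show ?thesis by simp
qed

definition "far_class \<sigma> \<rho> j = {i. i < length \<sigma> \<and> delivered \<sigma> \<rho> i \<and> src (\<sigma> ! i) + 2 * (c * q) \<le> dst (\<sigma> ! i) \<and>
    even (src (\<sigma> ! i) div (c * q) + j mod 2) \<and> even (row_of n (\<sigma> ! i) div (B * q) + j div 2)}"

lemma far_bound:
  assumes v: "valid_input n \<sigma>" and f: "feasible B c \<sigma> \<rho>" and j: "j < 4"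
  shows "real (card (far_class \<sigma> \<rho> j)) \<le> 217 * real k * real (throughput \<sigma> (alg j \<sigma>))"
proof -
  interpret far_input n B c "c * q" "B * q" "j mod 2" "j div 2" m P K k \<sigma>
    by (rule far_input_locale[OF j v])
  let ?t = "real (throughput \<sigma> (alg j \<sigma>))" and ?x = "max (c * q) (B * q)"
  have "real m * real (card (far_class \<sigma> \<rho> j)) \<le> (real m + 8 * real (c * q * B) + real m * 2 * real ?x) * ?t"
    using far_competitive[OF f pos(1-3) K] j by (simp add: far_class_def XC_def YC_def class_alg_def)
  \<comment> \<open>93 consists of 1 for acceptances, 80 for price rejections by \<open>qm\<close>
    and 12 for local rejections by \<open>wk\<close> and \<open>hk\<close>.\<close>
  also have "\<dots> \<le> (real m * (93 * real k)) * ?t"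
  proof (rule mult_right_mono)
    have "real (c * q * B) \<le> real (10 * (m * k))" using qm of_nat_le_iff by blast
    then have "8 * real (c * q * B) \<le> 8 * real (10 * (m * k))" by linarith
    then have "8 * real (c * q * B) \<le> real m * (80 * real k)" by (simp add: mult_ac)
    moreover have "real ?x \<le> real (6 * k)" using wk hk by (intro of_nat_mono) simp
    then have "real m * 2 * real ?x \<le> real m * (12 * real k)" using mult_left_mono[of "2 * real ?x" "12 * real k" "real m"] by simp
    moreover have "real m \<le> real m * real k" using pos by simp
    ultimately have "real m + 8 * real (c * q * B) + real m * 2 * real ?x \<le> real m * real k + real m * (80 * real k) + real m * (12 * real k)"
      by linarith
    also have "\<dots> = real m * (93 * real k)" by (simp add: algebra_simps)
    finally show "real m + 8 * real (c * q * B) + real m * 2 * real ?x \<le> real m * (93 * real k)" .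
  qed simp
  finally have "real m * real (card (far_class \<sigma> \<rho> j)) \<le> real m * (93 * real k * ?t)" by (simp add: mult_ac)
  then have "real (card (far_class \<sigma> \<rho> j)) \<le> 93 * real k * ?t" using pos(5) by (simp add: mult_le_cancel_left_pos)
  also have "\<dots> \<le> 217 * real k * ?t" by (intro mult_right_mono) auto
  finally show ?thesis .
qed

lemma OPT_le:
  assumes v: "valid_input n \<sigma>"
  shows "real (OPT B c \<sigma>) \<le> 217 * real k * (\<Sum>j<5. real (throughput \<sigma> (alg j \<sigma>)))"
proof -
  obtain \<rho> where f: "feasible B c \<sigma> \<rho>" and opt: "OPT B c \<sigma> = throughput \<sigma> \<rho>"
    using OPT_attained alg_ok(2)[OF v] by blast
  let ?N = "{i. i < length \<sigma> \<and> delivered \<sigma> \<rho> i \<and> dst (\<sigma> ! i) < src (\<sigma> ! i) + 2 * (c * q)}"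
  have "{i. i < length \<sigma> \<and> delivered \<sigma> \<rho> i} \<subseteq> ?N \<union> (\<Union>j<4. far_class \<sigma> \<rho> j)"
  proof
    fix i assume i: "i \<in> {i. i < length \<sigma> \<and> delivered \<sigma> \<rho> i}"
    show "i \<in> ?N \<union> (\<Union>j<4. far_class \<sigma> \<rho> j)"
    proof (cases "dst (\<sigma> ! i) < src (\<sigma> ! i) + 2 * (c * q)")
      case False
      \<comment> \<open>Shift bits equal to the parities of the source cell make both of its indices
        even.\<close>
      define a b where "a = src (\<sigma> ! i) div (c * q) mod 2" and "b = row_of n (\<sigma> ! i) div (B * q) mod 2"
      have ab: "a < 2" "b < 2" by (simp_all add: a_def b_def)
      have "(a + 2 * b) mod 2 = a" "(a + 2 * b) div 2 = b" using ab by auto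
      moreover have "even (src (\<sigma> ! i) div (c * q) + a)" "even (row_of n (\<sigma> ! i) div (B * q) + b)"
        by (simp_all add: a_def b_def even_iff_mod_2_eq_zero mod_add_right_eq mult_2[symmetric])
      ultimately have "i \<in> far_class \<sigma> \<rho> (a + 2 * b)" using i False by (simp add: far_class_def)
      moreover have "a + 2 * b < 4" using ab by linarith
      ultimately show ?thesis by blast
    qed (use i in simp)
  qed
  then have "throughput \<sigma> \<rho> \<le> card (?N \<union> (\<Union>j<4. far_class \<sigma> \<rho> j))"
    unfolding throughput_def by (intro card_mono) (auto simp: far_class_def)
  also have "\<dots> \<le> card ?N + (\<Sum>j<4. card (far_class \<sigma> \<rho> j))"
    by (intro order_trans[OF card_Un_le] add_left_mono card_UN_le) simp
  finally have "real (throughput \<sigma> \<rho>) \<le> real (card ?N + (\<Sum>j<4. card (far_class \<sigma> \<rho> j)))"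
    by (rule of_nat_mono)
  then have "real (OPT B c \<sigma>) \<le> real (card ?N) + (\<Sum>j<4. real (card (far_class \<sigma> \<rho> j)))"
    unfolding opt of_nat_add of_nat_sum .
  also have "\<dots> \<le> 217 * real k * real (throughput \<sigma> (alg 4 \<sigma>)) + (\<Sum>j<4. 217 * real k * real (throughput \<sigma> (alg j \<sigma>)))"
    using near_bound[OF v f] far_bound[OF v f] by (intro add_mono sum_mono) auto
  also have "\<dots> = 217 * real k * (\<Sum>j<Suc 4. real (throughput \<sigma> (alg j \<sigma>)))"
    by (simp only: sum.lessThan_Suc sum_distrib_left[symmetric] distrib_left)
  finally show ?thesis by simp
qed

text \<open>The uniform choice makes the sum over the classes five times the expectation, and
  \<open>1085 = 5 * 217\<close>.\<close>

lemma randomized: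
  defines "A \<equiv> map_pmf alg (pmf_of_set {..<5})"
  shows "rand_online_nonpreemptive n B c A"
    and "valid_input n \<sigma> \<Longrightarrow> real (OPT B c \<sigma>) / (1085 * real k) \<le> exp_throughput A \<sigma>"
proof -
  have ne: "{..<5::nat} \<noteq> {}" by (simp add: lessThan_empty_iff)
  show "rand_online_nonpreemptive n B c A"
    using alg_ok by (auto simp: rand_online_nonpreemptive_def A_def set_pmf_of_set[OF ne])
  assume v: "valid_input n \<sigma>"
  have "exp_throughput A \<sigma> = (\<Sum>j<5. real (throughput \<sigma> (alg j \<sigma>))) / 5"
    by (simp add: exp_throughput_def A_def integral_pmf_of_set[OF ne])
  then have "(\<Sum>j<5. real (throughput \<sigma> (alg j \<sigma>))) = 5 * exp_throughput A \<sigma>" by simp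
  then have "real (OPT B c \<sigma>) \<le> exp_throughput A \<sigma> * (1085 * real k)"
    using OPT_le[OF v] by (simp add: mult_ac)
  then show "real (OPT B c \<sigma>) / (1085 * real k) \<le> exp_throughput A \<sigma>"
    using pos(6) by (simp add: pos_divide_le_eq)
qed

end

section \<open>Choice of the parameters\<close>

lemma algorithm_params_ex:
  fixes n B c :: nat
  assumes B: "1 \<le> B" "real B \<le> log 2 (real n)" and c: "1 \<le> c" "real c \<le> log 2 (real n)"
  shows "\<exists>q m P K k. algorithm_params n B c q m P K k \<and> real k \<le> 10 * log 2 (real n)"
proof -
  have n0: "0 < n" using B by (cases "n = 0") (auto simp: log_def)
  have lg: "1 \<le> log 2 (real n)" using B by linarith
  define l where "l = nat \<lceil>log 2 (real n)\<rceil>"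
  have l: "log 2 (real n) \<le> real l" "real l \<le> log 2 (real n) + 1"
    using lg unfolding l_def by linarith+
  have l1: "B \<le> l" "c \<le> l" "1 \<le> l" using l lg B c by linarith+
  have nl: "n \<le> 2 ^ l"
  proof -
    have "real n = 2 powr (log 2 (real n))" using n0 by simp
    also have "\<dots> \<le> 2 powr real l" using l by simp
    also have "\<dots> = real (2 ^ l)" by (simp add: powr_realpow)
    finally show ?thesis using of_nat_le_iff by blast
  qed
  have Bn: "B \<le> n"
  proof -
    have "real n \<le> 2 powr real n" using of_nat_mono[OF less_imp_le[OF less_exp[of n]], where 'a = real] by (simp add: powr_realpow)
    then have "log 2 (real n) \<le> real n" using n0 by (simp add: log_le_iff)
    then have "real B \<le> real n" using B(2) by linarith
    then show ?thesis by simp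
  qed
  \<comment> \<open>\<open>K\<close> is the climb left by \<open>short_paths\<close>, and
    \<open>k\<close> is chosen such that
    \<open>P + 1 \<le> 16 * (n * n * n) \<le> 2 ^ k\<close>.\<close>
  define K P k where "K = 2 * (n * B)" and "P = 2 * (n + 1) * (K + 1)" and "k = 3 * l + 4"
  have "P + 1 \<le> 2 ^ k"
  proof -
    have n1: "1 \<le> n * n" "1 \<le> n * n * n" using n0 by simp_all
    have "K + 1 \<le> 3 * (n * n)" using mult_le_mono2[OF Bn, of n] n1 unfolding K_def by linarith
    then have "P \<le> 2 * (2 * n) * (3 * (n * n))" unfolding P_def using n0 by (intro mult_le_mono) auto
    also have "\<dots> = 12 * (n * n * n)" by simp
    finally have "P + 1 \<le> 16 * (n * n * n)" using n1 by linarith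
    also have "\<dots> \<le> 16 * (2 ^ l * 2 ^ l * 2 ^ l)" by (intro mult_le_mono nl order_refl)
    also have "\<dots> = 2 ^ k" by (simp add: k_def power_add power_mult power3_eq_cube power_commutes mult.commute[of 3])
    finally show ?thesis .
  qed
  moreover
  \<comment> \<open>The least \<open>q\<close> with \<open>c * q * B > 5 * k\<close>. Hence
    \<open>m\<close> is at least 1, and its rounding leaves \<open>c * q * B\<close> between
    \<open>5 * (m * k)\<close> and \<open>10 * (m * k)\<close>.\<close>
  define q where "q = 5 * k div (B * c) + 1"
  define m where "m = c * q * B div (5 * k)"
  have k0: "0 < k" by (simp add: k_def)
  have Bc: "0 < B * c" using B c by simp
  have big: "5 * k \<le> c * q * B"
  proof -
    have "5 * k < (5 * k div (B * c) + 1) * (B * c)" using Bc by (metis div_less_iff_less_mult less_add_one)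
    moreover have "c * q * B = q * (B * c)" by (simp only: mult_ac)
    ultimately show ?thesis by (simp add: q_def)
  qed
  have m1: "1 \<le> m" unfolding m_def using big k0 by (simp add: div_greater_zero_iff Suc_le_eq)
  have up: "m * (5 * k) \<le> c * q * B" unfolding m_def by simp
  have "c * q * B \<le> 10 * (m * k)"
  proof -
    have "c * q * B div (5 * k) < m + 1" by (simp add: m_def)
    then have "c * q * B < (m + 1) * (5 * k)" using k0 by (subst (asm) div_less_iff_less_mult) simp_all
    also have "(m + 1) * (5 * k) = 5 * (m * k) + 5 * k" by (simp add: algebra_simps)
    also have "\<dots> \<le> 5 * (m * k) + 5 * (m * k)" using m1 by (intro add_left_mono mult_le_mono2) simp
    finally show ?thesis by (simp add: mult.commute)
  qed
  moreover have "3 * (m * k) < c * q * B"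
  proof -
    have "0 < m * k" using m1 k0 by simp
    moreover have "m * (5 * k) = 5 * (m * k)" by simp
    ultimately show ?thesis using up by linarith
  qed
  moreover have "c * q \<le> 6 * k" "B * q \<le> 6 * k"
  proof -
    \<comment> \<open>Rounding up adds only one \<open>c\<close> or \<open>B\<close> to a side, at
      most \<open>k\<close> because both are at most \<open>log n\<close>.\<close>
    define y where "y = 5 * k div (B * c)"
    have y: "y * (B * c) \<le> 5 * k" by (simp add: y_def)
    have "c * y \<le> y * (B * c)" "B * y \<le> y * (B * c)" using B c by simp_all
    then have "c * y \<le> 5 * k" "B * y \<le> 5 * k" using y by linarith+
    moreover have "q = y + 1" by (simp add: q_def y_def)
    moreover have "B \<le> k" "c \<le> k" using l1 by (simp_all add: k_def)
    ultimately show "c * q \<le> 6 * k" "B * q \<le> 6 * k" by simp_all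
  qed
  ultimately have "algorithm_params n B c q m P K k"
    using n0 B(1) c(1) m1 k0 by unfold_locales (auto simp: q_def P_def K_def)
  moreover have "real k \<le> 10 * log 2 (real n)" using l lg by (simp add: k_def)
  ultimately show ?thesis by blast
qed

theorem theorem7p1:
  shows "\<exists>C::real. C > 0 \<and>
    (\<forall>n B c :: nat. 1 \<le> B \<and> real B \<le> log 2 (real n) \<and> 1 \<le> c \<and> real c \<le> log 2 (real n) \<longrightarrow>
       (\<exists>A. rand_online_nonpreemptive n B c A \<and>
            (\<forall>\<sigma>. valid_input n \<sigma> \<longrightarrow>
                 exp_throughput A \<sigma> \<ge> real (OPT B c \<sigma>) / (C * log 2 (real n)))))"
proof (intro exI[of _ "10850::real"] conjI allI impI)
  fix n B c :: nat
  assume a: "1 \<le> B \<and> real B \<le> log 2 (real n) \<and> 1 \<le> c \<and> real c \<le> log 2 (real n)"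
  then obtain q m P K k where p: "algorithm_params n B c q m P K k" and k10: "real k \<le> 10 * log 2 (real n)"
    using algorithm_params_ex[of B n c] by blast
  interpret algorithm_params n B c q m P K k by (rule p)
  show "\<exists>A. rand_online_nonpreemptive n B c A \<and>
            (\<forall>\<sigma>. valid_input n \<sigma> \<longrightarrow>
                 exp_throughput A \<sigma> \<ge> real (OPT B c \<sigma>) / (10850 * log 2 (real n)))"
  proof (intro exI conjI allI impI)
    show "rand_online_nonpreemptive n B c (map_pmf alg (pmf_of_set {..<5}))" by (rule randomized(1))
    fix \<sigma> assume v: "valid_input n \<sigma>"
    \<comment> \<open>\<open>10850\<close> is \<open>1085 * 10\<close>, by the bound on
      \<open>k\<close>.\<close>
    have "real (OPT B c \<sigma>) / (10850 * log 2 (real n)) \<le> real (OPT B c \<sigma>) / (1085 * real k)"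
    proof (rule divide_left_mono)
      have "0 < real k" using pos(6) by simp
      then show "1085 * real k \<le> 10850 * log 2 (real n)"
        "0 < 10850 * log 2 (real n) * (1085 * real k)" using k10 by (auto intro!: mult_pos_pos)
    qed simp
    also have "\<dots> \<le> exp_throughput (map_pmf alg (pmf_of_set {..<5})) \<sigma>" by (rule randomized(2)[OF v])
    finally show "exp_throughput (map_pmf alg (pmf_of_set {..<5})) \<sigma> \<ge> real (OPT B c \<sigma>) / (10850 * log 2 (real n))" .
  qed
qed simp

end
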